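(* Let $\mathbb{K}$ be a field of characteristic $0$, let $I$ be a curved Lie ideal of a curved DG-algebra $(A,d,R)$ over $\mathbb{K}$ and let $\pi\colon A\to A/I$ denote the projection. For every integer $k\ge 0$, with every choice of a morphism of graded vector spaces $s\colon A/I\to A$ such that $\pi s=\operatorname{Id}_{A/I}$ one can associate, in a canonical fashion, an $L_\infty$ morphism \[ \sigma^k\colon \frac{A}{I}\rightsquigarrow \frac{A}{[A,A]+I^{(k+1)}A}[2k]\] having as its linear component the map \[ \sigma^k_1\colon \frac{A}{I}\to \frac{A}{[A,A]+I^{(k+1)}A}[2k],\qquad \sigma^k_1(x)=\frac{1}{k!}\operatorname{tr}(R^{k}x).\]
   Context: Graded algebras are graded associative algebras with unit over $\mathbb{K}$; $[a,b]=ab-(-1)^{|a||b|}ba$ is the graded commutator. A curved DG-algebra $(A,d,R)$ is a graded algebra $A$ with a degree one derivation $d\colon A^*\to A^{*+1}$ and an element $R\in A^2$ (the curvature) such that $d(R)=0$ and $d^2(x)=[R,x]$ for all $x\in A$. A curved Lie ideal of $A$ is a homogeneous Lie ideal $I\subset A$ (i.e. $[A,I]\subset I$) such that $d(I)\subset I$ and $R\in I$. Then $A/I$ is a DG-Lie algebra. $[A,A]\subset A$ is the linear span of all graded commutators; $\operatorname{tr}\colon A\to A/[A,A]$ is the quotient map (also composed with further quotients). For a subspace $E\subset A$, $E^{(k)}$ ($k\ge1$) is the linear span of all products $e_1\cdots e_k$ with $e_i\in E$, and $EA$ is the linear span of all products $ea$, $e\in E,a\in A$. The quotient $\frac{A}{[A,A]+I^{(k+1)}A}$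 is a complex with the differential induced by $d$, and its shift $[2k]$ (with $V[n]^i=V^{n+i}$) is regarded as a DG-Lie algebra with trivial bracket. In the formula for $\sigma_1^k$, $x\in A/I$ is replaced by any lifting to $A$ (the result does not depend on it). $L_\infty$ morphisms into a DG-Lie algebra $(M,d_M,0)$ with trivial bracket: for a DG-Lie algebra $(L,\bar\partial,[-,-])$, let $S(L[1])$ be the symmetric coalgebra with the degree one coderivation $Q$ with $Q(1)=0$ and $Q(x_1\odot\cdots\odot x_n)=\sum_{i}(-1)^{i+|x_1|+\cdots+|x_{i-1}|}x_1\odot\cdots\odot\bar\partial x_i\odot\cdots\odot x_n+\sum_{\tau\in S(2,n-2)}\varepsilon(\tau)(-1)^{|x_{\tau(1)}|}[x_{\tau(1)},x_{\tau(2)}]\odot x_{\tau(3)}\odot\cdots\odot x_{\tau(n)}$, where $|x|$ is the degree in $L$, $S(2,n-2)$ is the set of $(2,n-2)$-unshuffles and $\varepsilon(\tau)$ is the symmetric Koszul sign in $L[1]^{\odot n}$. An $L_\infty$ morphism $f\colon L\rightsquigarrow M$ is a degree $0$ linear map $f\colon S(L[1])\to M[1]$ with $f(1)=0$ and $-d_M f=fQ$; equivalently it is the corestriction of a morphism of DG-coalgebras $S(L[1])\to S(M[1])$. Its Taylor coefficients are the restrictions $f_i\colon L[1]^{\odot i}\to M[1]$, and $f_1$, viewed as a map $L\to M$, is its linear component. *)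

theory Defs
  imports
    Complex_Main
    "HOL-Library.Poly_Mapping"
    "HOL-Library.Set_Algebras"
    "HOL-Combinatorics.Permutations"
begin

section \<open>Graded vector spaces, quotients, shifts\<close>

text \<open>
  The spaces \<open>A/I\<close>, \<open>A/([A,A] + I^(k+1) A)\<close> and \<open>S(L[1])\<close> are literal quotients, i.e. sets of
  cosets, so graded vector spaces are given by records with an explicit carrier.
  \<open>comp V i\<close> is the homogeneous component of degree \<open>i\<close>.
\<close>

record ('k, 'v) gvs =
  car :: "'v set"
  add :: "'v \<Rightarrow> 'v \<Rightarrow> 'v"
  null :: 'v
  smul :: "'k \<Rightarrow> 'v \<Rightarrow> 'v"
  comp :: "int \<Rightarrow> 'v set"

record ('k, 'v) dgvs = "('k, 'v) gvs" +
  diff :: "'v \<Rightarrow> 'v"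

record ('k, 'v) dgla = "('k, 'v) dgvs" +
  bracket :: "'v \<Rightarrow> 'v \<Rightarrow> 'v"

text \<open>\<open>ksign n\<close> is \<open>(-1)^n\<close> for an integer exponent \<open>n\<close>.\<close>

definition ksign :: "int \<Rightarrow> 'r::{one, uminus}" where
  "ksign n = (if even n then 1 else - 1)"

definition graded_linear ::
    "('k, 'v, 'e) gvs_scheme \<Rightarrow> ('k, 'w, 'f) gvs_scheme \<Rightarrow> ('v \<Rightarrow> 'w) \<Rightarrow> bool" where
  "graded_linear V W f \<longleftrightarrow>
     (\<forall>x\<in>car V. f x \<in> car W) \<and>
     (\<forall>x\<in>car V. \<forall>y\<in>car V. f (add V x y) = add W (f x) (f y)) \<and>
     (\<forall>c. \<forall>x\<in>car V. f (smul V c x) = smul W c (f x)) \<and>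
     (\<forall>i. \<forall>x\<in>comp V i. f x \<in> comp W i)"

text \<open>
  \<open>quot sc V G N\<close> is \<open>V/N\<close> for linear subspaces \<open>N \<subseteq> V\<close> of an ambient space with scalar
  multiplication \<open>sc\<close>, graded by the images of the \<open>G i\<close>.  A linear map or bilinear map on \<open>V\<close>
  that descends to the quotient is applied to representatives of cosets; adding \<open>N\<close> afterwards
  fills up the set of results to a coset.
\<close>

definition quot ::
    "('k \<Rightarrow> 'v \<Rightarrow> 'v::ab_group_add) \<Rightarrow> 'v set \<Rightarrow> (int \<Rightarrow> 'v set) \<Rightarrow> 'v set \<Rightarrow> ('k, 'v set) gvs" where
  "quot sc V G N =
     \<lparr> car = (\<lambda>x. x +o N) ` V,
       add = (\<lambda>X Y. X + Y),
       null = N,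
       smul = (\<lambda>c X. sc c ` X + N),
       comp = (\<lambda>i. (\<lambda>x. x +o N) ` G i) \<rparr>"

definition quot_map :: "('v \<Rightarrow> 'w::ab_group_add) \<Rightarrow> 'w set \<Rightarrow> 'v set \<Rightarrow> 'w set" where
  "quot_map f N X = f ` X + N"

definition quot_map2 :: "('v \<Rightarrow> 'v \<Rightarrow> 'w::ab_group_add) \<Rightarrow> 'w set \<Rightarrow> 'v set \<Rightarrow> 'v set \<Rightarrow> 'w set" where
  "quot_map2 f N X Y = {f x y | x y. x \<in> X \<and> y \<in> Y} + N"

definition gshift :: "int \<Rightarrow> ('k, 'v, 'e) gvs_scheme \<Rightarrow> ('k, 'v, 'e) gvs_scheme" where
  "gshift n V = V \<lparr> comp := (\<lambda>i. comp V (n + i)) \<rparr>"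

text \<open>The differential of \<open>V[n]\<close> is \<open>(-1)^n\<close> times that of \<open>V\<close>.\<close>

definition dgshift :: "int \<Rightarrow> ('k::field, 'v, 'e) dgvs_scheme \<Rightarrow> ('k, 'v, 'e) dgvs_scheme" where
  "dgshift n V = (gshift n V) \<lparr> diff := (\<lambda>x. smul V (ksign n) (diff V x)) \<rparr>"

section \<open>Curved DG-algebras and curved Lie ideals\<close>

text \<open>
  The ring type \<open>'a\<close> is the total space of the algebra \<open>A\<close>, which is the internal direct sum of
  the subspaces \<open>piece A i\<close>.  The sort \<open>{ring, monoid_mult}\<close> (rather than \<open>ring_1\<close>) admits the
  zero algebra.
\<close>

record ('k, 'a) curved_data =
  scal :: "'k \<Rightarrow> 'a \<Rightarrow> 'a"
  piece :: "int \<Rightarrow> 'a set"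
  der :: "'a \<Rightarrow> 'a"
  curv :: 'a

definition decomposition :: "(int \<Rightarrow> 'a::comm_monoid_add set) \<Rightarrow> 'a \<Rightarrow> (int \<Rightarrow> 'a) \<Rightarrow> bool" where
  "decomposition G a c \<longleftrightarrow>
     (\<forall>i. c i \<in> G i) \<and> finite {i. c i \<noteq> 0} \<and> a = (\<Sum>i | c i \<noteq> 0. c i)"

definition hpart :: "(int \<Rightarrow> 'a::comm_monoid_add set) \<Rightarrow> 'a \<Rightarrow> int \<Rightarrow> 'a" where
  "hpart G a = (THE c. decomposition G a c)"

text \<open>The bilinear extension of \<open>[a,b] = a b - (-1)^(|a| |b|) b a\<close> to inhomogeneous elements.\<close>

definition gcomm :: "(int \<Rightarrow> 'a::ring set) \<Rightarrow> 'a \<Rightarrow> 'a \<Rightarrow> 'a" where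
  "gcomm G a b =
     (\<Sum>i | hpart G a i \<noteq> 0. \<Sum>j | hpart G b j \<noteq> 0.
        hpart G a i * hpart G b j
        - (if even (i * j) then hpart G b j * hpart G a i else - (hpart G b j * hpart G a i)))"

locale graded_algebra = vector_space sc
  for sc :: "'k::field \<Rightarrow> 'a::{ring, monoid_mult} \<Rightarrow> 'a"
  and G :: "int \<Rightarrow> 'a set" +
  assumes scale_mult_left: "sc c (a * b) = sc c a * b"
    and scale_mult_right: "sc c (a * b) = a * sc c b"
    and subspace_piece: "subspace (G i)"
    and direct_sum: "\<exists>!c. decomposition G a c"
    and one_piece: "1 \<in> G 0"
    and mult_piece: "a \<in> G i \<Longrightarrow> b \<in> G j \<Longrightarrow> a * b \<in> G (i + j)"

lemma (in graded_algebra) gcomm_homogeneous: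
  assumes "a \<in> G i" and "b \<in> G j"
  shows "gcomm G a b = a * b - (if even (i * j) then b * a else - (b * a))"
proof -
  have part: "hpart G x = (\<lambda>l. if l = m then x else 0)" if "x \<in> G m" for x m
  proof -
    let ?c = "\<lambda>l. if l = m then x else 0"
    have sub: "{l. ?c l \<noteq> 0} \<subseteq> {m}" by auto
    have "finite {l. ?c l \<noteq> 0}" using sub finite_subset by blast
    moreover have "x = (\<Sum>l | ?c l \<noteq> 0. ?c l)"
      by (cases "x = 0") auto
    moreover have "?c l \<in> G l" for l
      using that subspace_0[OF subspace_piece] by auto
    ultimately have "decomposition G x ?c"
      unfolding decomposition_def by blast
    then show ?thesis
      unfolding hpart_def using direct_sum by (intro the1_equality)
  qed
  show ?thesis
    unfolding gcomm_def part[OF assms(1)] part[OF assms(2)]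
    by (cases "a = 0"; cases "b = 0") auto
qed

locale curved_dg_algebra =
  fixes A :: "('k::field, 'a::{ring, monoid_mult}) curved_data"
  assumes algebra: "graded_algebra (scal A) (piece A)"
    and der_linear: "Vector_Spaces.linear (scal A) (scal A) (der A)"
    and der_degree: "a \<in> piece A i \<Longrightarrow> der A a \<in> piece A (i + 1)"
    and der_mult: "a \<in> piece A i \<Longrightarrow>
      der A (a * b) = der A a * b + (if even i then a * der A b else - (a * der A b))"
    and curv_degree: "curv A \<in> piece A 2"
    and der_curv: "der A (curv A) = 0"
    and der_der: "der A (der A a) = gcomm (piece A) (curv A) a"

definition curved_lie_ideal ::
    "('k::field, 'a::{ring, monoid_mult}) curved_data \<Rightarrow> 'a set \<Rightarrow> bool" where
  "curved_lie_ideal A I \<longleftrightarrow>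
     module.subspace (scal A) I \<and>
     (\<forall>x\<in>I. \<forall>i. hpart (piece A) x i \<in> I) \<and>
     (\<forall>a. \<forall>x\<in>I. gcomm (piece A) a x \<in> I) \<and>
     (\<forall>x\<in>I. der A x \<in> I) \<and>
     curv A \<in> I"

definition gvs_of :: "('k, 'a::ab_group_add) curved_data \<Rightarrow> ('k, 'a) gvs" where
  "gvs_of A = \<lparr> car = UNIV, add = (+), null = 0, smul = scal A, comp = piece A \<rparr>"

definition quot_dgla :: "('k, 'a::ring) curved_data \<Rightarrow> 'a set \<Rightarrow> ('k, 'a set) dgla" where
  "quot_dgla A I = gvs.extend (quot (scal A) UNIV (piece A) I)
     \<lparr> diff = quot_map (der A) I, bracket = quot_map2 (gcomm (piece A)) I \<rparr>"

definition graded_section ::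
    "('k, 'a::ring) curved_data \<Rightarrow> 'a set \<Rightarrow> ('a set \<Rightarrow> 'a) \<Rightarrow> bool" where
  "graded_section A I s \<longleftrightarrow>
     graded_linear (quot_dgla A I) (gvs_of A) s \<and> (\<forall>X\<in>car (quot_dgla A I). s X +o I = X)"

definition comm_space :: "('k::field, 'a::ring) curved_data \<Rightarrow> 'a set" where
  "comm_space A = module.span (scal A) {gcomm (piece A) a b | a b. True}"

definition power_space ::
    "('k::field, 'a::{ring, monoid_mult}) curved_data \<Rightarrow> 'a set \<Rightarrow> nat \<Rightarrow> 'a set" where
  "power_space A E k = module.span (scal A) {prod_list es | es. length es = k \<and> set es \<subseteq> E}"

definition right_space :: "('k::field, 'a::ring) curved_data \<Rightarrow> 'a set \<Rightarrow> 'a set" where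
  "right_space A E = module.span (scal A) {e * a | e a. e \<in> E}"

definition trace_ideal ::
    "('k::field, 'a::{ring, monoid_mult}) curved_data \<Rightarrow> 'a set \<Rightarrow> nat \<Rightarrow> 'a set" where
  "trace_ideal A I k = comm_space A + right_space A (power_space A I (k + 1))"

text \<open>\<open>A/([A,A] + I^(k+1) A)\<close> before the shift by \<open>[2k]\<close>.\<close>

definition trace_complex ::
    "('k::field, 'a::{ring, monoid_mult}) curved_data \<Rightarrow> 'a set \<Rightarrow> nat \<Rightarrow> ('k, 'a set) dgvs" where
  "trace_complex A I k = gvs.extend (quot (scal A) UNIV (piece A) (trace_ideal A I k))
     \<lparr> diff = quot_map (der A) (trace_ideal A I k) \<rparr>"

definition tr ::
    "('k::field, 'a::{ring, monoid_mult}) curved_data \<Rightarrow> 'a set \<Rightarrow> nat \<Rightarrow> 'a \<Rightarrow> 'a set" where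
  "tr A I k a = a +o trace_ideal A I k"

section \<open>The symmetric coalgebra\<close>

text \<open>
  \<open>S(V)\<close> is the quotient of the free vector space on all lists \<open>[x\<^sub>1,\<dots>,x\<^sub>n]\<close> of elements
  of \<open>V\<close> (the list stands for \<open>x\<^sub>1 \<odot> \<dots> \<odot> x\<^sub>n\<close>, the empty list for \<open>1\<close>) by multilinearity
  and by \<open>x \<odot> y = (-1)^(|x| |y|) y \<odot> x\<close>.
\<close>

type_synonym ('k, 'v) sym = "('v list \<Rightarrow>\<^sub>0 'k) set"

definition pscale :: "'k::field \<Rightarrow> ('x \<Rightarrow>\<^sub>0 'k) \<Rightarrow> ('x \<Rightarrow>\<^sub>0 'k)" where
  "pscale c p = Poly_Mapping.map ((*) c) p"

abbreviation word :: "'v list \<Rightarrow> ('v list \<Rightarrow>\<^sub>0 'k::field)" where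
  "word xs \<equiv> Poly_Mapping.single xs 1"

definition sym_relations :: "('k::field, 'v, 'e) gvs_scheme \<Rightarrow> ('v list \<Rightarrow>\<^sub>0 'k) set" where
  "sym_relations V = module.span pscale
    ({word (xs @ add V u v # ys) - word (xs @ u # ys) - word (xs @ v # ys) | xs u v ys.
        xs \<in> lists (car V) \<and> ys \<in> lists (car V) \<and> u \<in> car V \<and> v \<in> car V} \<union>
     {word (xs @ smul V c u # ys) - pscale c (word (xs @ u # ys)) | xs c u ys.
        xs \<in> lists (car V) \<and> ys \<in> lists (car V) \<and> u \<in> car V} \<union>
     {word (xs @ u # v # ys) - pscale (ksign (i * j)) (word (xs @ v # u # ys)) | xs u v ys i j.
        xs \<in> lists (car V) \<and> ys \<in> lists (car V) \<and> u \<in> comp V i \<and> v \<in> comp V j})"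

text \<open>\<open>has_degrees V ds xs\<close>: each \<open>xs ! m\<close> is homogeneous of degree \<open>ds ! m\<close>.\<close>

definition has_degrees :: "('k, 'v, 'e) gvs_scheme \<Rightarrow> int list \<Rightarrow> 'v list \<Rightarrow> bool" where
  "has_degrees V ds xs \<longleftrightarrow> list_all2 (\<lambda>i x. x \<in> comp V i) ds xs"

definition Sym :: "('k::field, 'v, 'e) gvs_scheme \<Rightarrow> ('k, ('k, 'v) sym) gvs" where
  "Sym V = quot pscale
     {p. Poly_Mapping.keys p \<subseteq> lists (car V)}
     (\<lambda>i. module.span pscale {word xs | xs ds. has_degrees V ds xs \<and> sum_list ds = i})
     (sym_relations V)"

definition sym_class :: "('k::field, 'v, 'e) gvs_scheme \<Rightarrow> ('v list \<Rightarrow>\<^sub>0 'k) \<Rightarrow> ('k, 'v) sym" where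
  "sym_class V p = p +o sym_relations V"

text \<open>\<open>x\<^sub>1 \<odot> \<dots> \<odot> x\<^sub>n\<close>\<close>

definition sym_prod :: "('k::field, 'v, 'e) gvs_scheme \<Rightarrow> 'v list \<Rightarrow> ('k, 'v) sym" where
  "sym_prod V xs = sym_class V (word xs)"

section \<open>\<open>L\<^sub>\<infinity>\<close> morphisms into a DG-Lie algebra with trivial bracket\<close>

text \<open>
  Positions are numbered from \<open>0\<close>.  The unshuffles \<open>S(2,n-2)\<close>; there are none for \<open>n < 2\<close>.
\<close>

definition unshuffles2 :: "nat \<Rightarrow> (nat \<Rightarrow> nat) set" where
  "unshuffles2 n = {\<tau>. 2 \<le> n \<and> \<tau> permutes {..<n} \<and> \<tau> 0 < \<tau> 1 \<and> strict_mono_on {2..<n} \<tau>}"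

text \<open>
  The sign with \<open>x\<^sub>1 \<odot> \<dots> \<odot> x\<^sub>n = \<epsilon>(\<tau>) x\<^bsub>\<tau>(1)\<^esub> \<odot> \<dots> \<odot> x\<^bsub>\<tau>(n)\<^esub>\<close> for elements
  whose degrees (those of \<open>L[1]\<close> below) are listed in \<open>es\<close>.
\<close>

definition koszul_sign :: "int list \<Rightarrow> (nat \<Rightarrow> nat) \<Rightarrow> 'k::field" where
  "koszul_sign es \<tau> =
     (\<Prod>(p, q) \<in> {(p, q). p < q \<and> q < length es \<and> \<tau> q < \<tau> p}. ksign (es ! \<tau> p * es ! \<tau> q))"

text \<open>
  \<open>Q(x\<^sub>1 \<odot> \<dots> \<odot> x\<^sub>n)\<close> for homogeneous \<open>x\<^sub>m\<close>, where \<open>ds\<close> lists the degrees in \<open>L\<close>.  With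
  positions numbered from \<open>0\<close> the sign \<open>(-1)^i\<close> becomes \<open>(-1)^(i+1)\<close>.
\<close>

definition Q_value ::
    "('k::field, 'v, 'e) dgla_scheme \<Rightarrow> int list \<Rightarrow> 'v list \<Rightarrow> ('k, 'v) sym" where
  "Q_value L ds xs = sym_class (gshift 1 L)
     ((\<Sum>i<length xs. pscale (ksign (int i + 1 + (\<Sum>m<i. ds ! m))) (word (xs[i := diff L (xs ! i)])))
      + (\<Sum>\<tau>\<in>unshuffles2 (length xs).
           pscale (koszul_sign (map (\<lambda>e. e - 1) ds) \<tau> * ksign (ds ! \<tau> 0))
             (word (bracket L (xs ! \<tau> 0) (xs ! \<tau> 1) # map (\<lambda>m. xs ! \<tau> m) [2..<length xs]))))"

text \<open>
  \<open>f : S(L[1]) \<rightarrow> M[1]\<close> linear of degree \<open>0\<close> with \<open>f(1) = 0\<close> and \<open>- d\<^sub>M f = f Q\<close>.  The last identity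
  is required on the products of homogeneous elements, which span \<open>S(L[1])\<close>.  The target is
  given as a complex because its bracket is zero.
\<close>

definition linfty_morphism_abelian ::
    "('k::field, 'v, 'e) dgla_scheme \<Rightarrow> ('k, 'w, 'f) dgvs_scheme \<Rightarrow> (('k, 'v) sym \<Rightarrow> 'w) \<Rightarrow> bool" where
  "linfty_morphism_abelian L M f \<longleftrightarrow>
     graded_linear (Sym (gshift 1 L)) (gshift 1 M) f \<and>
     f (sym_prod (gshift 1 L) []) = null M \<and>
     (\<forall>ds xs. has_degrees L ds xs \<longrightarrow>
        smul M (- 1) (diff M (f (sym_prod (gshift 1 L) xs))) = f (Q_value L ds xs))"

definition linear_component ::
    "('k::field, 'v, 'e) dgla_scheme \<Rightarrow> (('k, 'v) sym \<Rightarrow> 'w) \<Rightarrow> 'v \<Rightarrow> 'w" where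
  "linear_component L f x = f (sym_prod (gshift 1 L) [x])"

section \<open>Morphisms of the data\<close>

text \<open>
  Morphisms of triples (curved DG-algebra, curved Lie ideal, section of the projection).  They
  express that a construction depending on such a triple is canonical, i.e. natural.
\<close>

definition curved_morphism ::
    "('k::field, 'a::{ring, monoid_mult}) curved_data \<Rightarrow> 'a set \<Rightarrow> ('a set \<Rightarrow> 'a) \<Rightarrow>
     ('k, 'b::{ring, monoid_mult}) curved_data \<Rightarrow> 'b set \<Rightarrow> ('b set \<Rightarrow> 'b) \<Rightarrow> ('a \<Rightarrow> 'b) \<Rightarrow> bool" where
  "curved_morphism A I s B J t \<phi> \<longleftrightarrow>
     graded_linear (gvs_of A) (gvs_of B) \<phi> \<and>
     \<phi> 1 = 1 \<and> (\<forall>a a'. \<phi> (a * a') = \<phi> a * \<phi> a') \<and>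
     (\<forall>a. \<phi> (der A a) = der B (\<phi> a)) \<and> \<phi> (curv A) = curv B \<and>
     (\<forall>x\<in>I. \<phi> x \<in> J) \<and>
     (\<forall>a. \<phi> (s (a +o I)) = t (\<phi> a +o J))"

end

theory Submission
  imports Defs
begin

text \<open>
  Let \<open>\<pi> : A \<rightarrow> A/I\<close> be the projection and \<open>p = s \<pi>\<close>, a graded projection of \<open>A\<close> with kernel \<open>I\<close>.  The
  morphism is a Chern--Simons form.  The linear maps \<open>S(L[1]) \<rightarrow> A\<close>, with \<open>L = A/I\<close>, form a graded algebra
  under convolution, and \<open>D f = d f - (-1)^|f| f Q\<close> is an odd derivation of it.  The section is an element of
  degree \<open>1\<close>, to be thought of as a connection form.  The path \<open>t s\<close> has the curvature
    \<open>R_t = R + t D s + t^2 s s\<close>,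
  and \<open>R_1\<close> has values in \<open>I\<close>: its components \<open>R\<close>, \<open>d p x - p d x\<close> and, up to sign, \<open>p[x,y] - [p x, p y]\<close>
  vanish modulo \<open>I\<close> because \<open>R\<close> lies in \<open>I\<close> and \<open>\<pi>\<close> is compatible with \<open>d\<close> and with the bracket.  The Bianchi
  identity \<open>D R_t = t (R_t s - s R_t)\<close> and the cyclic symmetry of the trace give
    \<open>D tr (s R_t^k) = 1/(k+1) d/dt tr (R_t^(k+1))\<close>.
  Hence \<open>\<sigma>^k = 1/k! tr (\<integral> s R_t^k dt)\<close>, integrated over \<open>[0,1]\<close>, satisfies
    \<open>D \<sigma>^k = 1/(k+1)! (tr R_1^(k+1) - tr R_0^(k+1))\<close>,
  which is zero modulo \<open>I^(k+1) A\<close> since \<open>R_1\<close> and \<open>R_0 = R\<close> both have values in \<open>I\<close>.  This is the equation of an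
  \<open>L\<^sub>\<infinity>\<close> morphism.  On a single element only the term \<open>s R^k\<close> of the integrand survives, which gives the
  linear component.  The construction uses only \<open>s\<close>, \<open>d\<close>, \<open>R\<close> and the product, so it is natural.

  Cochains are pulled back along \<open>\<pi>\<close>: they are functions on lists of elements of \<open>A\<close> together with their
  degrees, and \<open>Q\<close> is formed with \<open>d\<close> and the bracket of \<open>A\<close> itself, while \<open>s\<close> is represented by \<open>p\<close>.  Then
  \<open>Q\<close> does not square to zero, but still \<open>p Q Q = 0\<close> (\<open>coder_coder_sec\<close>), from which the identity
  \<open>D D p = R p - p R\<close> behind the Bianchi identity follows (\<open>cdiff_dsec\<close>).  Convolution and \<open>Q\<close> are both defined by recursion on the list, that is by their commutation
  rules with the contraction by the first argument.  In this form associativity, the Leibniz rule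
  (\<open>cdiff_conv\<close>) and cyclicity up to commutators (\<open>conv_commutator\<close>) are inductions on the list in which each
  sign is checked by parity.

  The core of the proof is formed by \<open>bianchi\<close>, \<open>transgression\<close>, \<open>trace_euler_power\<close>, \<open>curvature_in_ideal\<close> and
  their combination \<open>cs_cocycle\<close>.  To pass to \<open>S(L[1])\<close> one shows that the Chern--Simons cochain is graded
  symmetric, multilinear and annihilated by \<open>I\<close> (\<open>sm_cs\<close>), extends it to inhomogeneous arguments, and rewrites
  the recursive \<open>Q\<close> as the sum over unshuffles (\<open>coder_sum\<close>, \<open>koszul_sign_unshuffle\<close>).
\<close>

section \<open>Signs\<close>

text \<open>
  The sign \<open>(-1)^n\<close> as an operator on an arbitrary abelian group, because cochains take values both in \<open>A\<close> and
  in polynomials over \<open>A\<close>.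
\<close>

definition sg :: "int \<Rightarrow> 'c::ab_group_add \<Rightarrow> 'c" where
  "sg n x = (if even n then x else - x)"

lemma sg_simps [simp]:
  "sg 0 x = x" "sg n 0 = 0" "sg 1 x = - x" "sg 2 x = x"
  by (auto simp: sg_def)

lemma sg_add: "sg n (x + y) = sg n x + sg n y"
  by (simp add: sg_def)

lemma sg_uminus: "sg n (- x) = - sg n x"
  by (simp add: sg_def)

lemma sg_diff: "sg n (x - y) = sg n x - sg n y"
  by (simp add: sg_def)

lemma sg_sg: "sg m (sg n x) = sg (m + n) x"
  by (simp add: sg_def)

lemma sg_cong: "even (m - n) \<Longrightarrow> sg m x = sg n x"
  by (auto simp: sg_def)

lemma sg_sum: "sg n (\<Sum>i\<in>S. f i) = (\<Sum>i\<in>S. sg n (f i))"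
  by (simp add: sg_def sum_negf)

section \<open>The convolution product of cochains\<close>

text \<open>
  An argument \<open>(e, x)\<close> carries the degree \<open>e\<close> of \<open>x\<close> in \<open>L[1]\<close>, one less than its degree in \<open>L\<close>.
\<close>

type_synonym ('v, 'c) cochain = "(int \<times> 'v) list \<Rightarrow> 'c"

abbreviation contr :: "int \<times> 'v \<Rightarrow> ('v, 'c) cochain \<Rightarrow> ('v, 'c) cochain" where
  "contr a f \<equiv> (\<lambda>w. f (a # w))"

text \<open>
  In \<open>conv q f g\<close> the number \<open>q\<close> is the degree of \<open>g\<close>.  Contraction by the first argument \<open>a\<close> acts from the
  right, as a derivation of degree \<open>fst a\<close>: to reach \<open>f\<close> it has to pass \<open>g\<close>.  Contracting \<open>g\<close> changes its
  degree, whence \<open>q + fst a\<close> in the second term.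
\<close>

fun conv :: "int \<Rightarrow> ('v, 'c::ring) cochain \<Rightarrow> ('v, 'c) cochain \<Rightarrow> ('v, 'c) cochain" where
  "conv q f g [] = f [] * g []"
| "conv q f g (a # w) = sg (fst a * q) (conv q (contr a f) g w) + conv (q + fst a) f (contr a g) w"

lemma contr_conv:
  "contr a (conv q f g) = (\<lambda>w. sg (fst a * q) (conv q (contr a f) g w) + conv (q + fst a) f (contr a g) w)"
  by (rule ext) simp

lemma conv_cong:
  assumes "\<And>w. list_all ok w \<Longrightarrow> f w = f' w" and "\<And>w. list_all ok w \<Longrightarrow> g w = g' w"
    and "list_all ok w"
  shows "conv q f g w = conv q f' g' w"
  using assms
proof (induction w arbitrary: q f g f' g')
  case (Cons a w)
  have "conv q (contr a f) g w = conv q (contr a f') g' w"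
    using Cons.prems by (intro Cons.IH) auto
  moreover have "conv (q + fst a) f (contr a g) w = conv (q + fst a) f' (contr a g') w"
    using Cons.prems by (intro Cons.IH) auto
  ultimately show ?case by simp
qed simp

lemma conv_parity:
  fixes f g :: "('a, 'b::ring) cochain"
  shows "even (q - q') \<Longrightarrow> conv q f g w = conv q' f g w"
proof (induction w arbitrary: q q' f g)
  case (Cons a w)
  have "sg (fst a * q) x = sg (fst a * q') x" for x :: "'b::ring"
    using Cons.prems by (intro sg_cong) (auto simp: algebra_simps)
  then show ?case using Cons.IH[OF Cons.prems] Cons.IH[of "q + fst a" "q' + fst a"] Cons.prems by simp
qed simp

lemma conv_add_left: "conv q (\<lambda>w. f w + f' w) g w = conv q f g w + conv q f' g w"
proof (induction w arbitrary: q f f' g)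
  case (Cons a w)
  show ?case using Cons.IH[of q "contr a f" "contr a f'"] Cons.IH[of "q + fst a" f f']
    by (simp add: sg_add)
qed (simp add: algebra_simps)

lemma conv_add_right: "conv q f (\<lambda>w. g w + g' w) w = conv q f g w + conv q f g' w"
proof (induction w arbitrary: q f g g')
  case (Cons a w)
  show ?case using Cons.IH[of q "contr a f"] Cons.IH[of "q + fst a" f "contr a g" "contr a g'"]
    by (simp add: sg_add)
qed (simp add: algebra_simps)

lemma conv_uminus_left: "conv q (\<lambda>w. - f w) g w = - conv q f g w"
proof (induction w arbitrary: q f g)
  case (Cons a w)
  show ?case using Cons.IH[of q "contr a f"] Cons.IH[of "q + fst a" f]
    by (simp add: sg_uminus)
qed simp

lemma conv_uminus_right: "conv q f (\<lambda>w. - g w) w = - conv q f g w"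
proof (induction w arbitrary: q f g)
  case (Cons a w)
  show ?case using Cons.IH[of q "contr a f"] Cons.IH[of "q + fst a" f "contr a g"]
    by (simp add: sg_uminus)
qed simp

lemma conv_zero_left [simp]: "conv q (\<lambda>w. 0) g w = 0"
  using conv_add_left[of q "\<lambda>w. 0" "\<lambda>w. 0" g w] by simp

lemma conv_zero_right [simp]: "conv q f (\<lambda>w. 0) w = 0"
  using conv_add_right[of q f "\<lambda>w. 0" "\<lambda>w. 0" w] by simp

lemma conv_diff_left: "conv q (\<lambda>w. f w - f' w) g w = conv q f g w - conv q f' g w"
  using conv_add_left[of q f "\<lambda>w. - f' w"] by (simp add: conv_uminus_left)

lemma conv_diff_right: "conv q f (\<lambda>w. g w - g' w) w = conv q f g w - conv q f g' w"
  using conv_add_right[of q f g "\<lambda>w. - g' w"] by (simp add: conv_uminus_right)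

lemma conv_sg_left: "conv q (\<lambda>w. sg n (f w)) g w = sg n (conv q f g w)"
  by (simp add: sg_def conv_uminus_left)

lemma conv_sg_right: "conv q f (\<lambda>w. sg n (g w)) w = sg n (conv q f g w)"
  by (simp add: sg_def conv_uminus_right)

lemma conv_assoc: "conv (q + r) f (conv r g h) w = conv r (conv q f g) h w"
proof (induction w arbitrary: q r f g h)
  case (Cons a w)
  have 1: "conv (q + r) (contr a f) (conv r g h) w = conv r (conv q (contr a f) g) h w"
    by (rule Cons.IH)
  have 2: "conv (q + r + fst a) f (conv r (contr a g) h) w = conv r (conv (q + fst a) f (contr a g)) h w"
    using Cons.IH[of "q + fst a" r f "contr a g" h] by (simp only: add.assoc add.commute[of r])
  have 3: "conv (q + r + fst a) f (conv (r + fst a) g (contr a h)) w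
      = conv (r + fst a) (conv q f g) (contr a h) w"
    using Cons.IH[of q "r + fst a" f g "contr a h"] by (simp only: add.assoc)
  show ?case
    by (simp only: conv.simps contr_conv conv_add_left conv_add_right conv_sg_left conv_sg_right 1 2 3)
       (simp add: sg_add sg_sg algebra_simps)
qed (simp add: algebra_simps)

lemma conv_closed:
  assumes "\<And>w. list_all ok w \<Longrightarrow> f w \<in> X" and "\<And>w. list_all ok w \<Longrightarrow> g w \<in> Y"
    and "\<And>x y. x \<in> X \<Longrightarrow> y \<in> Y \<Longrightarrow> x * y \<in> Z"
    and "\<And>x y. x \<in> Z \<Longrightarrow> y \<in> Z \<Longrightarrow> x + y \<in> Z" and "\<And>x. x \<in> Z \<Longrightarrow> - x \<in> Z"
    and "list_all ok w"
  shows "conv q f g w \<in> Z"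
  using assms(1,2,6)
proof (induction w arbitrary: q f g)
  case (Cons a w)
  have "conv q (contr a f) g w \<in> Z" "conv (q + fst a) f (contr a g) w \<in> Z"
    using Cons.prems by (auto intro!: Cons.IH)
  then show ?case using assms(4,5) by (simp add: sg_def)
qed (use assms(3) in simp)

text \<open>
  For naturality: a homomorphism \<open>h\<close> of the coefficients that is compatible with a map \<open>\<phi>\<close> of the arguments.
\<close>

lemma conv_natural:
  assumes add: "\<And>x y. h (x + y) = h x + h y" and mult: "\<And>x y. h (x * y) = h x * h y"
    and f: "\<And>w. list_all ok w \<Longrightarrow> h (f w) = f' (map (apsnd \<phi>) w)"
    and g: "\<And>w. list_all ok w \<Longrightarrow> h (g w) = g' (map (apsnd \<phi>) w)"
    and w: "list_all ok w"
  shows "h (conv q f g w) = conv q f' g' (map (apsnd \<phi>) w)"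
proof -
  interpret h: additive h using add by unfold_locales
  have sg: "h (sg n x) = sg n (h x)" for n x by (simp add: sg_def h.minus)
  show ?thesis using f g w
  proof (induction w arbitrary: q f g f' g')
    case (Cons a w)
    have "h (conv q (contr a f) g w) = conv q (contr (apsnd \<phi> a) f') g' (map (apsnd \<phi>) w)"
      using Cons.prems by (intro Cons.IH) auto
    moreover have "h (conv (q + fst a) f (contr a g) w)
        = conv (q + fst a) f' (contr (apsnd \<phi> a) g') (map (apsnd \<phi>) w)"
      using Cons.prems by (intro Cons.IH) auto
    ultimately show ?case by (simp add: add sg)
  qed (use mult in simp)
qed

section \<open>The differential on cochains\<close>

text \<open>
  Degree \<open>p\<close> of a cochain as a map \<open>S(L[1]) \<rightarrow> A\<close>.  Only lists of admissible arguments are tested, those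
  that consist of elements which have the degree attached to them.
\<close>

definition homog :: "(int \<times> 'v \<Rightarrow> bool) \<Rightarrow> (int \<Rightarrow> 'c set) \<Rightarrow> int \<Rightarrow> ('v, 'c) cochain \<Rightarrow> bool" where
  "homog ok H p f \<longleftrightarrow> (\<forall>w. list_all ok w \<longrightarrow> f w \<in> H (p + sum_list (map fst w)))"

lemma homog_Nil: "homog ok H p f \<Longrightarrow> f [] \<in> H p"
  by (force simp: homog_def dest: spec[of _ "[]"])

lemma homog_contr: "homog ok H p f \<Longrightarrow> ok a \<Longrightarrow> homog ok H (p + fst a) (contr a f)"
  by (force simp: homog_def add.assoc dest: spec[of _ "a # _"])

text \<open>
  The operators \<open>f \<mapsto> f Q\<close> and its quadratic constituent.  Splitting off the first argument \<open>a\<close>, one has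
  \<open>Q (a \<odot> w) = Q a \<odot> w + ad_a w + (-1)^|a| a \<odot> Q w\<close>, where \<open>Q a = - d a\<close> and \<open>ad_a\<close>, of degree \<open>fst a + 1\<close>,
  replaces each argument in turn by its bracket with \<open>a\<close>.  The bracket stays at the position of the replaced
  argument, so that \<open>ad_a\<close> is again a derivation for the contractions.
\<close>

fun lie :: "('v \<Rightarrow> 'v \<Rightarrow> 'v) \<Rightarrow> int \<times> 'v \<Rightarrow> ('v, 'c::ring) cochain \<Rightarrow> ('v, 'c) cochain" where
  "lie br a f [] = 0"
| "lie br a f (b # w) = sg (fst a + 1) (f ((fst a + fst b + 1, br (snd a) (snd b)) # w))
     + sg ((fst a + 1) * fst b) (lie br a (contr b f) w)"

fun coder :: "('v \<Rightarrow> 'v) \<Rightarrow> ('v \<Rightarrow> 'v \<Rightarrow> 'v) \<Rightarrow> ('v, 'c::ring) cochain \<Rightarrow> ('v, 'c) cochain" where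
  "coder dv br f [] = 0"
| "coder dv br f (a # w) = - f ((fst a + 1, dv (snd a)) # w) + lie br a f w
     + sg (fst a) (coder dv br (contr a f) w)"

lemma lie_add: "lie br a (\<lambda>w. f w + g w) w = lie br a f w + lie br a g w"
  by (induction w arbitrary: f g) (simp_all add: sg_add)

lemma lie_uminus: "lie br a (\<lambda>w. - f w) w = - lie br a f w"
  by (induction w arbitrary: f) (simp_all add: sg_uminus)

lemma lie_sg: "lie br a (\<lambda>w. sg n (f w)) w = sg n (lie br a f w)"
  by (simp add: sg_def lie_uminus)

lemma coder_add: "coder dv br (\<lambda>w. f w + g w) w = coder dv br f w + coder dv br g w"
  by (induction w arbitrary: f g) (simp_all add: sg_add lie_add)

lemma coder_uminus: "coder dv br (\<lambda>w. - f w) w = - coder dv br f w"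
  by (induction w arbitrary: f) (simp_all add: sg_uminus lie_uminus)

lemma coder_sg: "coder dv br (\<lambda>w. sg n (f w)) w = sg n (coder dv br f w)"
  by (simp add: sg_def coder_uminus)

lemma coder_zero [simp]: "coder dv br (\<lambda>w. 0) w = 0"
  using coder_add[of dv br "\<lambda>w. 0" "\<lambda>w. 0" w] by simp

lemma lie_additive_natural:
  assumes "additive h" shows "h (lie br a f w) = lie br a (\<lambda>w. h (f w)) w"
proof -
  interpret additive h by fact
  have sg: "h (sg n x) = sg n (h x)" for n x by (simp add: sg_def minus)
  show ?thesis
    by (induction w arbitrary: f) (simp_all add: zero add sg )
qed

lemma coder_additive_natural:
  assumes "additive h" shows "h (coder dv br f w) = coder dv br (\<lambda>w. h (f w)) w"
proof -
  interpret additive h by fact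
  have sg: "h (sg n x) = sg n (h x)" for n x by (simp add: sg_def minus)
  show ?thesis
    by (induction w arbitrary: f)
      (simp_all add: zero add minus diff sg  lie_additive_natural[OF assms])
qed

text \<open>
  The induction step is the commutation of \<open>ad_a\<close> with the contraction by \<open>b\<close>: their commutator is the
  contraction by the bracket of \<open>a\<close> and \<open>b\<close>, which is a derivation by definition.
\<close>

lemma lie_conv:
  "lie br a (conv q f g) w = conv (q + fst a + 1) f (lie br a g) w
     + sg ((fst a + 1) * q) (conv q (lie br a f) g w)"
proof (induction w arbitrary: q f g)
  case (Cons b w)
  define c where "c = (fst a + fst b + 1, br (snd a) (snd b))"
  have contr_lie: "contr b (lie br a h) = (\<lambda>w. sg (fst a + 1) (contr c h w)
     + sg ((fst a + 1) * fst b) (lie br a (contr b h) w))" for h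
    by (rule ext) (simp add: c_def)
  have c: "fst c = fst a + fst b + 1" by (simp add: c_def)
  have par: "conv (q + fst c) f (contr c g) w = conv (q + fst a + 1 + fst b) f (contr c g) w"
    by (simp add: c algebra_simps)
  have par2: "conv (q + fst b + fst a + 1) f h w = conv (q + fst a + 1 + fst b) f h w" for h
    by (simp add: algebra_simps)
  have "lie br a (conv q f g) (b # w) = sg (fst a + 1) (conv q f g (c # w))
     + sg ((fst a + 1) * fst b) (lie br a (contr b (conv q f g)) w)"
    by (simp add: c_def)
  also have "\<dots> = sg (fst a + 1) (sg (fst c * q) (conv q (contr c f) g w) + conv (q + fst c) f (contr c g) w)
     + sg ((fst a + 1) * fst b) (sg (fst b * q) (conv (q + fst a + 1) (contr b f) (lie br a g) w
     + sg ((fst a + 1) * q) (conv q (lie br a (contr b f)) g w))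
     + (conv (q + fst b + fst a + 1) f (lie br a (contr b g)) w
     + sg ((fst a + 1) * (q + fst b)) (conv (q + fst b) (lie br a f) (contr b g) w)))"
    by (simp only: contr_conv lie_add lie_sg Cons.IH conv.simps)
  also have "\<dots> = conv (q + fst a + 1) f (lie br a g) (b # w)
     + sg ((fst a + 1) * q) (conv q (lie br a f) g (b # w))"
    unfolding conv.simps contr_lie conv_add_left conv_add_right conv_sg_left conv_sg_right par par2
    unfolding c
    by (cases "even (fst a)"; cases "even (fst b)"; cases "even q") (simp_all add: sg_def)
  finally show ?case .
qed simp

text \<open>
  In the same way the commutator of \<open>Q\<close> with the contraction by \<open>a\<close> consists of the contraction by \<open>Q a\<close> and of
  \<open>ad_a\<close>, which are already known to be derivations.
\<close>

lemma coder_conv: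
  "coder dv br (conv q f g) w = conv (q + 1) f (coder dv br g) w + sg q (conv q (coder dv br f) g w)"
proof (induction w arbitrary: q f g)
  case (Cons a w)
  define c where "c = (fst a + 1, dv (snd a))"
  have contr_coder: "contr a (coder dv br h) = (\<lambda>w. - contr c h w + lie br a h w
     + sg (fst a) (coder dv br (contr a h) w))" for h
    by (rule ext) (simp add: c_def)
  have c: "fst c = fst a + 1" by (simp add: c_def)
  have par: "conv (q + fst c) f h w = conv (q + 1 + fst a) f h w" 
    "conv (q + fst a + 1) f h w = conv (q + 1 + fst a) f h w" for h
    by (simp_all add: c algebra_simps)
  have "coder dv br (conv q f g) (a # w) = - conv q f g (c # w) + lie br a (conv q f g) w
     + sg (fst a) (coder dv br (contr a (conv q f g)) w)"
    by (simp add: c_def)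
  also have "\<dots> = - (sg (fst c * q) (conv q (contr c f) g w) + conv (q + fst c) f (contr c g) w)
     + (conv (q + fst a + 1) f (lie br a g) w + sg ((fst a + 1) * q) (conv q (lie br a f) g w))
     + sg (fst a) (sg (fst a * q) (conv (q + 1) (contr a f) (coder dv br g) w 
         + sg q (conv q (coder dv br (contr a f)) g w))
       + (conv (q + fst a + 1) f (coder dv br (contr a g)) w 
         + sg (q + fst a) (conv (q + fst a) (coder dv br f) (contr a g) w)))"
    by (simp only: contr_conv lie_conv coder_add coder_sg Cons.IH conv.simps)
  also have "\<dots> = conv (q + 1) f (coder dv br g) (a # w) + sg q (conv q (coder dv br f) g (a # w))"
    unfolding conv.simps contr_coder conv_add_left conv_add_right conv_sg_left conv_sg_right 
      conv_uminus_left conv_uminus_right par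
    unfolding c
    by (cases "even (fst a)"; cases "even q") (simp_all add: sg_def)
  finally show ?case .
qed simp

text \<open>
  The common ground of a curved DG-algebra and the polynomials over it.
\<close>

locale odd_derivation =
  fixes H :: "int \<Rightarrow> 'c::ring set" and d :: "'c \<Rightarrow> 'c"
  assumes H_zero: "0 \<in> H i"
    and H_add: "x \<in> H i \<Longrightarrow> y \<in> H i \<Longrightarrow> x + y \<in> H i"
    and H_uminus: "x \<in> H i \<Longrightarrow> - x \<in> H i"
    and H_mult: "x \<in> H i \<Longrightarrow> y \<in> H j \<Longrightarrow> x * y \<in> H (i + j)"
    and d_add: "d (x + y) = d x + d y"
    and d_degree: "x \<in> H i \<Longrightarrow> d x \<in> H (i + 1)"
    and d_mult: "x \<in> H i \<Longrightarrow> d (x * y) = d x * y + sg i (x * d y)"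
begin

sublocale d: additive d
  using d_add by unfold_locales

lemma d_sg: "d (sg n x) = sg n (d x)"
  by (simp add: sg_def d.minus)

lemma H_sg: "x \<in> H i \<Longrightarrow> sg n x \<in> H i"
  by (simp add: sg_def H_uminus)

lemma homog_conv:
  assumes "homog ok H p f" and "homog ok H q g"
  shows "homog ok H (p + q) (conv r f g)"
  unfolding homog_def
proof (intro allI impI)
  fix w assume "list_all ok w"
  with assms show "conv r f g w \<in> H (p + q + sum_list (map fst w))"
  proof (induction w arbitrary: p q r f g)
    case Nil
    then show ?case using H_mult[of "f []" p "g []" q] by (auto dest: homog_Nil)
  next
    case (Cons a w)
    then have 1: "homog ok H (p + fst a) (contr a f)" and 2: "homog ok H (q + fst a) (contr a g)"
      by (auto intro: homog_contr)
    have "conv r (contr a f) g w \<in> H (p + q + (fst a + sum_list (map fst w)))"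
      using Cons.IH[OF 1 Cons.prems(2)] Cons.prems(3) by (simp add: algebra_simps)
    moreover have "conv (r + fst a) f (contr a g) w \<in> H (p + q + (fst a + sum_list (map fst w)))"
      using Cons.IH[OF Cons.prems(1) 2] Cons.prems(3) by (simp add: algebra_simps)
    ultimately show ?case by (auto intro: H_add H_sg)
  qed
qed

lemma d_conv:
  assumes "homog ok H p f" and "list_all ok w"
  shows "d (conv q f g w) = conv q (\<lambda>w. d (f w)) g w + sg p (conv (q + 1) f (\<lambda>w. d (g w)) w)"
  using assms
proof (induction w arbitrary: p q f g)
  case Nil
  then show ?case using d_mult[of "f []" p "g []"] by (auto dest: homog_Nil)
next
  case (Cons a w)
  have 1: "d (conv q (contr a f) g w) = conv q (contr a (\<lambda>w. d (f w))) g w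
      + sg (p + fst a) (conv (q + 1) (contr a f) (\<lambda>w. d (g w)) w)"
    using Cons.IH[OF homog_contr[OF Cons.prems(1), of a]] Cons.prems by simp
  have 2: "d (conv (q + fst a) f (contr a g) w) = conv (q + fst a) (\<lambda>w. d (f w)) (contr a g) w
      + sg p (conv (q + 1 + fst a) f (contr a (\<lambda>w. d (g w))) w)"
    using Cons.IH[OF Cons.prems(1), of "q + fst a" "contr a g"] Cons.prems
    by (simp add: algebra_simps)
  show ?case unfolding conv.simps d_add d_sg 1 2
    by (cases "even (fst a)"; cases "even q"; cases "even p") (simp_all add: sg_def)
qed

text \<open>
  The differential \<open>D f = d f - (-1)^p f Q\<close> of a cochain \<open>f\<close> of degree \<open>p\<close>.
\<close>

definition cdiff :: "('v \<Rightarrow> 'v) \<Rightarrow> ('v \<Rightarrow> 'v \<Rightarrow> 'v) \<Rightarrow> int \<Rightarrow> ('v, 'c) cochain \<Rightarrow> ('v, 'c) cochain" where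
  "cdiff dv br p f = (\<lambda>w. d (f w) - sg p (coder dv br f w))"

lemma cdiff_add: "cdiff dv br p (\<lambda>w. f w + g w) w = cdiff dv br p f w + cdiff dv br p g w"
  by (simp add: cdiff_def d_add coder_add sg_add)

lemma cdiff_conv:
  assumes "homog ok H p f" and "list_all ok w"
  shows "cdiff dv br (p + q) (conv q f g) w
    = conv q (cdiff dv br p f) g w + sg p (conv (q + 1) f (cdiff dv br q g) w)"
  unfolding cdiff_def d_conv[OF assms] coder_conv conv_diff_left conv_diff_right conv_sg_left conv_sg_right
  by (cases "even p"; cases "even q") (simp_all add: sg_def)

end

text \<open>
  Composed with a trace, convolution is graded commutative: after contracting all arguments one is left with
  products of homogeneous elements, and each of them differs from the product in the opposite order by a commutator.
\<close>

lemma conv_commutator: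
  assumes "homog ok H p f" and "homog ok H q g" and "list_all ok w"
    and T0: "\<And>x y. x \<in> T \<Longrightarrow> y \<in> T \<Longrightarrow> x + y \<in> T" and Tm: "\<And>x. x \<in> T \<Longrightarrow> - x \<in> T"
    and T: "\<And>x y i j. x \<in> H i \<Longrightarrow> y \<in> H j \<Longrightarrow> x * y - sg (i * j) (y * x) \<in> T"
  shows "conv q f g w - sg (p * q) (conv p g f w) \<in> T"
  using assms(1-3)
proof (induction w arbitrary: p q f g)
  case Nil
  then show ?case using T[of "f []" p "g []" q] by (auto dest: homog_Nil)
next
  case (Cons a w)
  have sgT: "sg n x \<in> T" if "x \<in> T" for n x using that Tm by (simp add: sg_def)
  have 1: "conv q (contr a f) g w - sg ((p + fst a) * q) (conv (p + fst a) g (contr a f) w) \<in> T"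
    using Cons by (intro Cons.IH) (auto intro: homog_contr)
  have 2: "conv (q + fst a) f (contr a g) w - sg (p * (q + fst a)) (conv p (contr a g) f w) \<in> T"
    using Cons by (intro Cons.IH) (auto intro: homog_contr)
  have "conv q f g (a # w) - sg (p * q) (conv p g f (a # w))
    = sg (fst a * q) (conv q (contr a f) g w - sg ((p + fst a) * q) (conv (p + fst a) g (contr a f) w))
    + (conv (q + fst a) f (contr a g) w - sg (p * (q + fst a)) (conv p (contr a g) f w))"
    unfolding conv.simps by (cases "even p"; cases "even q"; cases "even (fst a)") (simp_all add: sg_def)
  also have "\<dots> \<in> T" using sgT 1 2 T0 by blast
  finally show ?case .
qed

section \<open>Additive maps out of finitely supported functions\<close>

definition pm_ext :: "('x \<Rightarrow> 'c \<Rightarrow> 'd::comm_monoid_add) \<Rightarrow> ('x \<Rightarrow>\<^sub>0 'c::zero) \<Rightarrow> 'd" where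
  "pm_ext \<phi> p = (\<Sum>x\<in>Poly_Mapping.keys p. \<phi> x (Poly_Mapping.lookup p x))"

lemma pm_ext_superset:
  assumes "finite S" and "Poly_Mapping.keys p \<subseteq> S" and "\<And>x. \<phi> x 0 = 0"
  shows "pm_ext \<phi> p = (\<Sum>x\<in>S. \<phi> x (Poly_Mapping.lookup p x))"
  unfolding pm_ext_def using assms by (intro sum.mono_neutral_left) (auto simp: in_keys_iff)

lemma pm_ext_add:
  fixes \<phi> :: "'x \<Rightarrow> 'c::monoid_add \<Rightarrow> 'd::ab_group_add"
  assumes "\<And>x a b. \<phi> x (a + b) = \<phi> x a + \<phi> x b"
  shows "pm_ext \<phi> (p + q) = pm_ext \<phi> p + pm_ext \<phi> q"
proof -
  have 0: "\<phi> x 0 = 0" for x using assms[of x 0 0] by simp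
  let ?S = "Poly_Mapping.keys p \<union> Poly_Mapping.keys q"
  have fin: "finite ?S" by simp
  have keys: "Poly_Mapping.keys (p + q) \<subseteq> ?S" by (rule Poly_Mapping.keys_add)
  show ?thesis
    by (subst (1 2 3) pm_ext_superset[where S = ?S])
       (use fin keys 0 in \<open>auto simp: lookup_add assms sum.distrib\<close>)
qed

lemma pm_ext_single: "\<phi> x 0 = 0 \<Longrightarrow> pm_ext \<phi> (Poly_Mapping.single x a) = \<phi> x a"
  by (simp add: pm_ext_def)

lemma pm_ext_zero [simp]: "pm_ext \<phi> 0 = 0"
  by (simp add: pm_ext_def)

text \<open>
  Induction over the monomials of \<open>p\<close> itself, so that \<open>Q\<close> may use a property of the coefficients of \<open>p\<close>.
\<close>

lemma pm_closed:
  fixes p :: "'x \<Rightarrow>\<^sub>0 'c::comm_monoid_add"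
  assumes "Q 0" and "\<And>p q. Q p \<Longrightarrow> Q q \<Longrightarrow> Q (p + q)"
    and "\<And>x. x \<in> Poly_Mapping.keys p \<Longrightarrow> Q (Poly_Mapping.single x (Poly_Mapping.lookup p x))"
  shows "Q p"
proof -
  have p: "p = (\<Sum>x\<in>Poly_Mapping.keys p. Poly_Mapping.single x (Poly_Mapping.lookup p x))"
    by (rule poly_mapping_eqI) (auto simp: lookup_sum lookup_single when_def in_keys_iff)
  have "Q (\<Sum>x\<in>S. Poly_Mapping.single x (Poly_Mapping.lookup p x))"
    if "S \<subseteq> Poly_Mapping.keys p" "finite S" for S
    using that(2,1) by (induction S rule: finite_induct) (auto intro: assms)
  then show ?thesis using p by (metis finite_keys order_refl)
qed

text \<open>
  Statements on a product of polynomials need to be checked on monomials only.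
\<close>

lemma pm_biadditive_closed:
  fixes p :: "'x \<Rightarrow>\<^sub>0 'c::comm_monoid_add" and q :: "'y \<Rightarrow>\<^sub>0 'e::comm_monoid_add"
    and B :: "_ \<Rightarrow> _ \<Rightarrow> 'd::ab_group_add"
  assumes l: "\<And>p p' q. B (p + p') q = B p q + B p' q" and r: "\<And>p q q'. B p (q + q') = B p q + B p q'"
    and "0 \<in> Z" and "\<And>x y. x \<in> Z \<Longrightarrow> y \<in> Z \<Longrightarrow> x + y \<in> Z"
    and "\<And>m n. m \<in> Poly_Mapping.keys p \<Longrightarrow> n \<in> Poly_Mapping.keys q \<Longrightarrow>
      B (Poly_Mapping.single m (Poly_Mapping.lookup p m)) (Poly_Mapping.single n (Poly_Mapping.lookup q n)) \<in> Z"
  shows "B p q \<in> Z"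
proof -
  have B0: "B 0 q = 0" "B p 0 = 0" for p q using l[of 0 0 q] r[of p 0 0] by simp_all
  have "B (Poly_Mapping.single m (Poly_Mapping.lookup p m)) q \<in> Z" if "m \<in> Poly_Mapping.keys p" for m
    by (rule pm_closed[where Q = "\<lambda>q. B _ q \<in> Z"]) (use that assms B0 in auto)
  then show ?thesis
    by (intro pm_closed[where Q = "\<lambda>p. B p q \<in> Z" and p = p]) (use assms B0 in auto)
qed

lemma pm_biadditive_eqI:
  fixes p :: "'x \<Rightarrow>\<^sub>0 'c::comm_monoid_add" and q :: "'y \<Rightarrow>\<^sub>0 'e::comm_monoid_add"
    and B C :: "_ \<Rightarrow> _ \<Rightarrow> 'd::ab_group_add"
  assumes "\<And>p p' q. B (p + p') q = B p q + B p' q" and "\<And>p q q'. B p (q + q') = B p q + B p q'"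
    and "\<And>p p' q. C (p + p') q = C p q + C p' q" and "\<And>p q q'. C p (q + q') = C p q + C p q'"
    and "\<And>m n. m \<in> Poly_Mapping.keys p \<Longrightarrow> n \<in> Poly_Mapping.keys q \<Longrightarrow>
      B (Poly_Mapping.single m (Poly_Mapping.lookup p m)) (Poly_Mapping.single n (Poly_Mapping.lookup q n))
      = C (Poly_Mapping.single m (Poly_Mapping.lookup p m)) (Poly_Mapping.single n (Poly_Mapping.lookup q n))"
  shows "B p q = C p q"
proof -
  have "B p q - C p q \<in> {0}"
    by (rule pm_biadditive_closed[where B = "\<lambda>p q. B p q - C p q"]) (use assms in auto)
  then show ?thesis by simp
qed

section \<open>Polynomials with coefficients in a graded algebra\<close>

lemma lookup_mapp_zero:
  "h m 0 = 0 \<Longrightarrow> Poly_Mapping.lookup (Poly_Mapping.mapp h p) m = h m (Poly_Mapping.lookup p m)"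
  by (simp add: lookup_mapp when_def in_keys_iff)

lemma mapp_add:
  fixes h :: "'x \<Rightarrow> 'c::monoid_add \<Rightarrow> 'd::ab_group_add"
  assumes "\<And>m a b. h m (a + b) = h m a + h m b"
  shows "Poly_Mapping.mapp h (p + q) = Poly_Mapping.mapp h p + Poly_Mapping.mapp h q"
proof -
  have "h x 0 = 0" for x using assms[of x 0 0] by simp
  then show ?thesis
    by (intro poly_mapping_eqI) (simp add: lookup_mapp_zero lookup_add assms)
qed

lemma mapp_single: "h m 0 = 0 \<Longrightarrow>
    Poly_Mapping.mapp h (Poly_Mapping.single m a) = Poly_Mapping.single m (h m a)"
  by (rule poly_mapping_eqI) (auto simp: lookup_mapp lookup_single when_def in_keys_iff)

text \<open>
  A finitely supported function \<open>nat \<Rightarrow>\<^sub>0 'a\<close> is a polynomial in a central variable \<open>t\<close>.  Its values at \<open>t = 1\<close>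
  and \<open>t = 0\<close> are the endpoints of the path of curvatures; both evaluations are ring homomorphisms.
\<close>

definition pm_eval1 :: "(nat \<Rightarrow>\<^sub>0 'a::ring) \<Rightarrow> 'a" where
  "pm_eval1 = pm_ext (\<lambda>m a. a)"

lemma pm_eval1_add: "pm_eval1 (p + q) = pm_eval1 p + pm_eval1 q"
  unfolding pm_eval1_def by (rule pm_ext_add) simp

lemma pm_eval1_single [simp]: "pm_eval1 (Poly_Mapping.single m a) = a"
  by (simp add: pm_eval1_def pm_ext_single)

lemma pm_eval1_mult: "pm_eval1 (p * q) = pm_eval1 p * pm_eval1 q"
  by (rule pm_biadditive_eqI[where B = "\<lambda>p q. pm_eval1 (p * q)"])
     (auto simp: algebra_simps pm_eval1_add mult_single)

lemma lookup_mult_zero: "Poly_Mapping.lookup (p * q) (0::nat)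
    = Poly_Mapping.lookup p 0 * (Poly_Mapping.lookup q 0 :: 'a::ring)"
  by (rule pm_biadditive_eqI[where B = "\<lambda>p q. Poly_Mapping.lookup (p * q) 0"])
     (auto simp: algebra_simps lookup_add mult_single lookup_single when_def)

definition pcoeffs :: "'a set \<Rightarrow> (nat \<Rightarrow>\<^sub>0 'a::zero) set" where
  "pcoeffs X = {p. \<forall>m. Poly_Mapping.lookup p m \<in> X}"

lemma pcoeffs_zero: "0 \<in> X \<Longrightarrow> 0 \<in> pcoeffs X"
  by (simp add: pcoeffs_def)

lemma pcoeffs_add: "(\<And>x y. x \<in> X \<Longrightarrow> y \<in> X \<Longrightarrow> x + y \<in> X) \<Longrightarrow> p \<in> pcoeffs X \<Longrightarrow> q \<in> pcoeffs X \<Longrightarrow> p + q \<in> pcoeffs X"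
  by (simp add: pcoeffs_def lookup_add)

lemma pcoeffs_uminus: "(\<And>x. x \<in> X \<Longrightarrow> - x \<in> X) \<Longrightarrow> p \<in> pcoeffs X \<Longrightarrow> - p \<in> pcoeffs X"
  by (simp add: pcoeffs_def)

lemma pcoeffs_single: "0 \<in> X \<Longrightarrow> a \<in> X \<Longrightarrow> Poly_Mapping.single m a \<in> pcoeffs X"
  by (simp add: pcoeffs_def lookup_single when_def)

lemma sg_single: "sg n (Poly_Mapping.single m a) = Poly_Mapping.single m (sg n a)"
  by (simp add: sg_def single_uminus)

context odd_derivation begin

text \<open>
  The calculus of cochains therefore applies to polynomial coefficients, with \<open>t\<close> of degree zero and \<open>d t = 0\<close>.
\<close>

lemma odd_derivation_poly: "odd_derivation (\<lambda>i. pcoeffs (H i)) (Poly_Mapping.mapp (\<lambda>_. d))"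
proof
  fix x y :: "nat \<Rightarrow>\<^sub>0 'c" and i j
  have dadd: "Poly_Mapping.mapp (\<lambda>_. d) (x + y) = Poly_Mapping.mapp (\<lambda>_. d) x + Poly_Mapping.mapp (\<lambda>_. d) y"
    for x y :: "nat \<Rightarrow>\<^sub>0 'c" by (rule mapp_add) (rule d_add)
  show "Poly_Mapping.mapp (\<lambda>_. d) (x + y) = Poly_Mapping.mapp (\<lambda>_. d) x + Poly_Mapping.mapp (\<lambda>_. d) y"
    by (rule dadd)
  show "0 \<in> pcoeffs (H i)" by (intro pcoeffs_zero H_zero)
  {
    assume x: "x \<in> pcoeffs (H i)"
    show "- x \<in> pcoeffs (H i)" using x by (intro pcoeffs_uminus H_uminus)
    show "Poly_Mapping.mapp (\<lambda>_. d) x \<in> pcoeffs (H (i + 1))"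
      using x by (simp add: pcoeffs_def lookup_mapp_zero d.zero d_degree)
    show "x + y \<in> pcoeffs (H i)" if "y \<in> pcoeffs (H i)" using x that by (intro pcoeffs_add H_add)
    show "x * y \<in> pcoeffs (H (i + j))" if "y \<in> pcoeffs (H j)"
    proof (rule pm_biadditive_closed[where B = "\<lambda>p q. p * q"])
      fix m n
      show "Poly_Mapping.single m (Poly_Mapping.lookup x m) * Poly_Mapping.single n (Poly_Mapping.lookup y n)
          \<in> pcoeffs (H (i + j))"
        using x that by (auto simp: mult_single pcoeffs_def lookup_single when_def H_zero intro!: H_mult)
    qed (auto simp: algebra_simps intro: pcoeffs_zero H_zero pcoeffs_add H_add)
    show "Poly_Mapping.mapp (\<lambda>_. d) (x * y)
      = Poly_Mapping.mapp (\<lambda>_. d) x * y + sg i (x * Poly_Mapping.mapp (\<lambda>_. d) y)"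
    proof (rule pm_biadditive_eqI[where B = "\<lambda>x y. Poly_Mapping.mapp (\<lambda>_. d) (x * y)"])
      fix m n
      have "Poly_Mapping.lookup x m \<in> H i" using x by (simp add: pcoeffs_def)
      then show "Poly_Mapping.mapp (\<lambda>_. d)
          (Poly_Mapping.single m (Poly_Mapping.lookup x m) * Poly_Mapping.single n (Poly_Mapping.lookup y n))
        = Poly_Mapping.mapp (\<lambda>_. d) (Poly_Mapping.single m (Poly_Mapping.lookup x m)) *
            Poly_Mapping.single n (Poly_Mapping.lookup y n)
          + sg i (Poly_Mapping.single m (Poly_Mapping.lookup x m) *
              Poly_Mapping.mapp (\<lambda>_. d) (Poly_Mapping.single n (Poly_Mapping.lookup y n)))"
        by (simp add: mult_single mapp_single d.zero d_mult single_add sg_single)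
    qed (auto simp: algebra_simps dadd sg_add)
  }
qed

lemma commutator_poly:
  assumes "0 \<in> T" and "\<And>x y. x \<in> T \<Longrightarrow> y \<in> T \<Longrightarrow> x + y \<in> T"
    and "\<And>x y i j. x \<in> H i \<Longrightarrow> y \<in> H j \<Longrightarrow> x * y - sg (i * j) (y * x) \<in> T"
    and "x \<in> pcoeffs (H i)" and "y \<in> pcoeffs (H j)"
  shows "x * y - sg (i * j) (y * x) \<in> pcoeffs T"
proof (rule pm_biadditive_closed[where B = "\<lambda>x y. x * y - sg (i * j) (y * x)"])
  fix m n
  have "Poly_Mapping.lookup x m * Poly_Mapping.lookup y n
     - sg (i * j) (Poly_Mapping.lookup y n * Poly_Mapping.lookup x m) \<in> T"
    using assms(3-5) by (simp add: pcoeffs_def)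
  then show "Poly_Mapping.single m (Poly_Mapping.lookup x m) * Poly_Mapping.single n (Poly_Mapping.lookup y n)
     - sg (i * j) (Poly_Mapping.single n (Poly_Mapping.lookup y n) * Poly_Mapping.single m (Poly_Mapping.lookup x m))
     \<in> pcoeffs T"
    by (simp add: mult_single sg_single add.commute[of n] flip: single_diff)
       (auto intro!: pcoeffs_single assms(1))
qed (auto simp: algebra_simps sg_add intro: pcoeffs_zero pcoeffs_add assms(1,2))

end

section \<open>Graded algebras\<close>

context graded_algebra begin

lemma piece_zero: "0 \<in> G i" and piece_add: "x \<in> G i \<Longrightarrow> y \<in> G i \<Longrightarrow> x + y \<in> G i"
  and piece_uminus: "x \<in> G i \<Longrightarrow> - x \<in> G i" and piece_scale: "x \<in> G i \<Longrightarrow> sc c x \<in> G i"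
  using subspace_piece[of i] by (auto simp: subspace_0 subspace_add subspace_neg subspace_scale)

lemma piece_diff: "x \<in> G i \<Longrightarrow> y \<in> G i \<Longrightarrow> x - y \<in> G i"
  using subspace_piece[of i] by (auto simp: subspace_diff)

lemma decomposition_hpart: "decomposition G a (hpart G a)"
  unfolding hpart_def using direct_sum[of a] by (rule theI')

lemma hpart_eqI: "decomposition G a c \<Longrightarrow> hpart G a = c"
  unfolding hpart_def using direct_sum by (intro the1_equality)

lemma hpart_in: "hpart G a i \<in> G i"
  and finite_hpart: "finite {i. hpart G a i \<noteq> 0}"
  and hpart_sum_support: "(\<Sum>i | hpart G a i \<noteq> 0. hpart G a i) = a"
  using decomposition_hpart[of a] by (auto simp: decomposition_def)

lemma hpart_sum:
  assumes "finite S" and "{i. hpart G a i \<noteq> 0} \<subseteq> S"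
  shows "(\<Sum>i\<in>S. hpart G a i) = a"
  using hpart_sum_support[of a] sum.mono_neutral_left[OF assms, of "hpart G a"] by auto

lemma hpart_eqI_sum:
  assumes "\<And>i. c i \<in> G i" and "finite S" and "\<And>i. i \<notin> S \<Longrightarrow> c i = 0" and "a = (\<Sum>i\<in>S. c i)"
  shows "hpart G a = c"
proof (rule hpart_eqI)
  have sub: "{i. c i \<noteq> 0} \<subseteq> S" using assms(3) by auto
  have "(\<Sum>i | c i \<noteq> 0. c i) = (\<Sum>i\<in>S. c i)"
    using assms(2) sub by (intro sum.mono_neutral_left) auto
  then show "decomposition G a c"
    using assms finite_subset[OF sub assms(2)] by (simp add: decomposition_def)
qed

lemma hpart_add: "hpart G (a + b) i = hpart G a i + hpart G b i"
proof -
  let ?S = "{i. hpart G a i \<noteq> 0} \<union> {i. hpart G b i \<noteq> 0}"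
  have "hpart G (a + b) = (\<lambda>i. hpart G a i + hpart G b i)"
    by (rule hpart_eqI_sum[where S = ?S])
      (auto simp: hpart_in piece_add finite_hpart sum.distrib hpart_sum)
  then show ?thesis by simp
qed

lemma hpart_scale: "hpart G (sc c a) i = sc c (hpart G a i)"
proof -
  have "hpart G (sc c a) = (\<lambda>i. sc c (hpart G a i))"
    by (rule hpart_eqI_sum[where S = "{i. hpart G a i \<noteq> 0}"])
      (auto simp: hpart_in piece_scale finite_hpart hpart_sum_support simp flip: scale_sum_right)
  then show ?thesis by simp
qed

lemma hpart_homogeneous: "a \<in> G i \<Longrightarrow> hpart G a = (\<lambda>j. if j = i then a else 0)"
  by (rule hpart_eqI_sum[where S = "{i}"]) (auto simp: piece_zero)

lemma gcomm_sg: "a \<in> G i \<Longrightarrow> b \<in> G j \<Longrightarrow> gcomm G a b = a * b - sg (i * j) (b * a)"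
  by (auto simp: gcomm_homogeneous sg_def)

text \<open>
  To compare commutators of different elements, both are summed over a common finite set of degrees.
\<close>

lemma gcomm_expand:
  assumes "finite S" "{i. hpart G a i \<noteq> 0} \<subseteq> S" "finite U" "{i. hpart G b i \<noteq> 0} \<subseteq> U"
  shows "gcomm G a b = (\<Sum>i\<in>S. \<Sum>j\<in>U. hpart G a i * hpart G b j - sg (i * j) (hpart G b j * hpart G a i))"
proof -
  have "(\<Sum>j | hpart G b j \<noteq> 0. hpart G a i * hpart G b j - sg (i * j) (hpart G b j * hpart G a i))
      = (\<Sum>j\<in>U. hpart G a i * hpart G b j - sg (i * j) (hpart G b j * hpart G a i))" for i
    using assms by (intro sum.mono_neutral_left) auto
  moreover have "(\<Sum>i | hpart G a i \<noteq> 0. \<Sum>j\<in>U. hpart G a i * hpart G b j - sg (i * j) (hpart G b j * hpart G a i))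
      = (\<Sum>i\<in>S. \<Sum>j\<in>U. hpart G a i * hpart G b j - sg (i * j) (hpart G b j * hpart G a i))"
    using assms by (intro sum.mono_neutral_left) auto
  ultimately show ?thesis by (simp add: gcomm_def sg_def if_distrib)
qed

lemma gcomm_sum_homogeneous:
  "gcomm G a b = (\<Sum>i | hpart G a i \<noteq> 0. \<Sum>j | hpart G b j \<noteq> 0. gcomm G (hpart G a i) (hpart G b j))"
  by (subst gcomm_expand[OF finite_hpart order_refl finite_hpart order_refl])
     (simp add: gcomm_sg[OF hpart_in hpart_in])

lemma gcomm_add_left: "gcomm G (a + a') b = gcomm G a b + gcomm G a' b"
proof -
  let ?S = "{i. hpart G a i \<noteq> 0} \<union> {i. hpart G a' i \<noteq> 0}" and ?U = "{i. hpart G b i \<noteq> 0}"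
  show ?thesis
    by (subst (1 2 3) gcomm_expand[where S = ?S and U = ?U])
       (auto simp: finite_hpart hpart_add algebra_simps sg_add sum.distrib sum_subtractf)
qed

lemma gcomm_add_right: "gcomm G b (a + a') = gcomm G b a + gcomm G b a'"
proof -
  let ?S = "{i. hpart G a i \<noteq> 0} \<union> {i. hpart G a' i \<noteq> 0}" and ?U = "{i. hpart G b i \<noteq> 0}"
  show ?thesis
    by (subst (1 2 3) gcomm_expand[where S = ?U and U = ?S])
       (auto simp: finite_hpart hpart_add algebra_simps sg_add sum.distrib sum_subtractf)
qed

lemma gcomm_scale_left: "gcomm G (sc c a) b = sc c (gcomm G a b)"
proof -
  let ?S = "{i. hpart G a i \<noteq> 0}" and ?U = "{i. hpart G b i \<noteq> 0}"
  have sg: "sg n (sc c x) = sc c (sg n x)" for n x by (simp add: sg_def)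
  show ?thesis
    by (subst (1 2) gcomm_expand[where S = ?S and U = ?U])
       (auto simp: finite_hpart hpart_scale sg scale_sum_right scale_right_diff_distrib
          simp flip: scale_mult_left scale_mult_right)
qed

lemma gcomm_scale_right: "gcomm G b (sc c a) = sc c (gcomm G b a)"
proof -
  let ?S = "{i. hpart G a i \<noteq> 0}" and ?U = "{i. hpart G b i \<noteq> 0}"
  have sg: "sg n (sc c x) = sc c (sg n x)" for n x by (simp add: sg_def)
  show ?thesis
    by (subst (1 2) gcomm_expand[where S = ?U and U = ?S])
       (auto simp: finite_hpart hpart_scale sg scale_sum_right scale_right_diff_distrib
          simp flip: scale_mult_left scale_mult_right)
qed

lemma gcomm_degree: "a \<in> G i \<Longrightarrow> b \<in> G j \<Longrightarrow> gcomm G a b \<in> G (i + j)"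
  using mult_piece[of a i b j] mult_piece[of b j a i]
  by (auto simp: gcomm_sg sg_def add.commute[of j] intro!: piece_diff piece_add piece_uminus)

lemma gcomm_swap: "a \<in> G i \<Longrightarrow> b \<in> G j \<Longrightarrow> gcomm G b a = - sg (i * j) (gcomm G a b)"
  by (simp add: gcomm_sg sg_def mult.commute[of j])

lemma gcomm_jacobi:
  assumes "a \<in> G i" "b \<in> G j" "c \<in> G k"
  shows "gcomm G a (gcomm G b c) = gcomm G (gcomm G a b) c + sg (i * j) (gcomm G b (gcomm G a c))"
  unfolding gcomm_sg[OF assms(1) gcomm_degree[OF assms(2,3)]] gcomm_sg[OF gcomm_degree[OF assms(1,2)] assms(3)]
    gcomm_sg[OF assms(2) gcomm_degree[OF assms(1,3)]]
  unfolding gcomm_sg[OF assms(1,2)] gcomm_sg[OF assms(1,3)] gcomm_sg[OF assms(2,3)]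
  by (cases "even i"; cases "even j"; cases "even k") (simp_all add: sg_def algebra_simps)

end

context curved_dg_algebra begin

sublocale graded_algebra "scal A" "piece A" by (rule algebra)

lemma der_add: "der A (x + y) = der A x + der A y"
  by (rule module_hom.add[OF Vector_Spaces.linear.axioms(3)[OF der_linear]])

lemma der_scale: "der A (scal A c x) = scal A c (der A x)"
  by (rule module_hom.scale[OF Vector_Spaces.linear.axioms(3)[OF der_linear]])

sublocale odd_derivation "piece A" "der A"
  by unfold_locales (auto simp: piece_zero piece_add piece_uminus mult_piece der_add der_degree der_mult sg_def)

lemma der_gcomm: 
  assumes "x \<in> piece A i" "y \<in> piece A j"
  shows "der A (gcomm (piece A) x y) = gcomm (piece A) (der A x) y + sg i (gcomm (piece A) x (der A y))"
  unfolding gcomm_sg[OF assms] gcomm_sg[OF der_degree[OF assms(1)] assms(2)] 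
    gcomm_sg[OF assms(1) der_degree[OF assms(2)]] d.diff d_sg d_mult[OF assms(1)] d_mult[OF assms(2)]
  by (cases "even i"; cases "even j") (simp_all add: sg_def algebra_simps)

end

section \<open>The Chern--Simons cochain\<close>

text \<open>
  The cochain concentrated in arity zero.  For \<open>u = curv A\<close> it is the curvature of the connection zero.
\<close>

definition unit_co :: "'c::zero \<Rightarrow> ('v, 'c) cochain" where
  "unit_co u = (\<lambda>w. if w = [] then u else 0)"

primrec cpow :: "'c::ring \<Rightarrow> ('v, 'c) cochain \<Rightarrow> nat \<Rightarrow> ('v, 'c) cochain" where
  "cpow u f 0 = unit_co u"
| "cpow u f (Suc k) = conv 0 f (cpow u f k)"

text \<open>
  The connection form: \<open>p\<close> in arity one.
\<close>

definition sec_co :: "('v \<Rightarrow> 'c::zero) \<Rightarrow> ('v, 'c) cochain" where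
  "sec_co p = (\<lambda>w. case w of [a] \<Rightarrow> p (snd a) | _ \<Rightarrow> 0)"

text \<open>
  The differential \<open>D p\<close> of the connection form; \<open>Q\<close> enters with a plus sign because \<open>p\<close> has degree one.
\<close>

definition dsec_co :: "('k, 'a::{ring, monoid_mult}) curved_data \<Rightarrow> ('a \<Rightarrow> 'a) \<Rightarrow> ('a, 'a) cochain" where
  "dsec_co A p = (\<lambda>w. der A (sec_co p w) + coder (der A) (gcomm (piece A)) (sec_co p) w)"

definition lift :: "nat \<Rightarrow> ('v, 'c::zero) cochain \<Rightarrow> ('v, nat \<Rightarrow>\<^sub>0 'c) cochain" where
  "lift m f = (\<lambda>w. Poly_Mapping.single m (f w))"

text \<open>
  The curvature \<open>R_t = R + t D p + t^2 p p\<close> of the connection \<open>t p\<close>.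
\<close>

definition curv_path :: "('k, 'a::{ring, monoid_mult}) curved_data \<Rightarrow> ('a \<Rightarrow> 'a) \<Rightarrow> ('a, nat \<Rightarrow>\<^sub>0 'a) cochain" where
  "curv_path A p = (\<lambda>w. lift 0 (unit_co (curv A)) w + lift 1 (dsec_co A p) w
     + lift 2 (conv 1 (sec_co p) (sec_co p)) w)"

text \<open>
  The integral over \<open>[0,1]\<close> of \<open>F(t)/t\<close>, for a polynomial \<open>F\<close> divisible by \<open>t\<close>.  Working with \<open>t d/dt\<close> and
  \<open>dt/t\<close> instead of \<open>d/dt\<close> and \<open>dt\<close> avoids index shifts; a constant term is discarded because \<open>1 / 0 = 0\<close>.
\<close>

definition pm_integral :: "('k::field, 'a::{ring, monoid_mult}) curved_data \<Rightarrow> (nat \<Rightarrow>\<^sub>0 'a) \<Rightarrow> 'a" where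
  "pm_integral A = pm_ext (\<lambda>m. scal A (1 / of_nat m))"

text \<open>
  \<open>1/k!\<close> times the integral of \<open>p R_t^k\<close>; the factor \<open>t\<close> of the connection \<open>t p\<close> cancels the \<open>1/t\<close> in
  the integral.
\<close>

definition chern_simons :: "('k::field_char_0, 'a::{ring, monoid_mult}) curved_data \<Rightarrow> ('a \<Rightarrow> 'a) \<Rightarrow> nat \<Rightarrow> ('a, 'a) cochain" where
  "chern_simons A p k = (\<lambda>w. scal A (1 / fact k) (pm_integral A
     (conv 0 (lift 1 (sec_co p)) (cpow (Poly_Mapping.single 0 1) (curv_path A p) k) w)))"

lemma unit_co_Nil [simp]: "unit_co u [] = u" and unit_co_Cons [simp]: "unit_co u (a # w) = 0"
  by (simp_all add: unit_co_def)

lemma sec_co_simps [simp]: "sec_co p [] = 0" "sec_co p [a] = p (snd a)" "sec_co p (a # b # w) = 0"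
  by (simp_all add: sec_co_def)

lemma conv_unit_left: "conv q (unit_co u) f w = u * f w"
  by (induction w arbitrary: q f) (auto simp: sg_def)

lemma conv_unit_right: "even q \<Longrightarrow> conv q f (unit_co u) w = f w * u"
  by (induction w arbitrary: q f) (auto simp: sg_def)

lemma conv_even_derivation:
  assumes add: "\<And>x y. h (x + y) = h x + h y" and mult: "\<And>x y. h (x * y) = h x * y + x * h y"
  shows "h (conv q f g w) = conv q (\<lambda>w. h (f w)) g w + conv q f (\<lambda>w. h (g w)) w"
proof -
  interpret h: additive h using add by unfold_locales
  have sg: "h (sg n x) = sg n (h x)" for n x by (simp add: sg_def h.minus)
  show ?thesis
    by (induction w arbitrary: q f g) (simp_all add: mult add sg sg_add)
qed

lemma conv_hom:
  assumes "\<And>x y. h (x + y) = h x + h y" and "\<And>x y. h (x * y) = h x * h y"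
  shows "h (conv q f g w) = conv q (\<lambda>w. h (f w)) (\<lambda>w. h (g w)) w"
proof -
  interpret h: additive h using assms(1) by unfold_locales
  have sg: "h (sg n x) = sg n (h x)" for n x by (simp add: sg_def h.minus)
  show ?thesis by (induction w arbitrary: q f g) (simp_all add: assms sg)
qed

lemma cpow_hom:
  assumes "\<And>x y. h (x + y) = h x + h y" and "\<And>x y. h (x * y) = h x * h y"
  shows "h (cpow u f k w) = cpow (h u) (\<lambda>w. h (f w)) k w"
proof (induction k arbitrary: w)
  case 0
  have "h 0 = 0" using assms(1)[of 0 0] by simp
  then show ?case by (simp add: unit_co_def)
next
  case (Suc k)
  have "(\<lambda>w. h (cpow u f k w)) = cpow (h u) (\<lambda>w. h (f w)) k" using Suc by auto
  then show ?case by (simp add: conv_hom[of h] assms)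
qed

lemma cpow_add:
  assumes "\<And>x. u * x = x"
  shows "conv 0 (cpow u f i) (cpow u f j) = cpow u f (i + j)"
proof (induction i)
  case 0
  then show ?case by (auto simp: conv_unit_left assms)
next
  case (Suc i)
  show ?case
  proof
    fix w
    have "conv 0 (cpow u f (Suc i)) (cpow u f j) w = conv 0 f (conv 0 (cpow u f i) (cpow u f j)) w"
      using conv_assoc[of 0 0 f "cpow u f i" "cpow u f j" w] by simp
    then show "conv 0 (cpow u f (Suc i)) (cpow u f j) w = cpow u f (Suc i + j) w"
      by (simp only: Suc) simp
  qed
qed

lemma conv_lift: "conv q (lift m f) (lift n g) = lift (m + n) (conv q f g)"
proof
  fix w show "conv q (lift m f) (lift n g) w = lift (m + n) (conv q f g) w"
    by (induction w arbitrary: q f g) (auto simp: lift_def mult_single sg_single single_add)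
qed

text \<open>
  The attached degree is the degree in \<open>L[1]\<close>, hence the shift by one.
\<close>

definition good :: "(int \<Rightarrow> 'v set) \<Rightarrow> int \<times> 'v \<Rightarrow> bool" where
  "good G a \<longleftrightarrow> snd a \<in> G (fst a + 1)"

lemma good_Pair [simp]: "good G (e, x) \<longleftrightarrow> x \<in> G (e + 1)"
  by (simp add: good_def)

text \<open>
  Here \<open>p\<close> is the composition of the projection to \<open>A/I\<close> with a section.
\<close>

locale curved_projection = curved_dg_algebra A
  for A :: "('k::field_char_0, 'a::{ring, monoid_mult}) curved_data" +
  fixes I :: "'a set" and p :: "'a \<Rightarrow> 'a"
  assumes ideal: "curved_lie_ideal A I"
    and p_add: "p (x + y) = p x + p y" and p_scale: "p (scal A c x) = scal A c (p x)"
    and p_degree: "x \<in> piece A i \<Longrightarrow> p x \<in> piece A i"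
    and p_kill: "x \<in> I \<Longrightarrow> p x = 0" and p_mod: "p x - x \<in> I"
begin

abbreviation "br \<equiv> gcomm (piece A)"
abbreviation "ok \<equiv> good (piece A)"

sublocale poly: odd_derivation "\<lambda>i. pcoeffs (piece A i)" "Poly_Mapping.mapp (\<lambda>_. der A)"
  by (rule odd_derivation_poly)

sublocale p: additive p using p_add by unfold_locales

lemma ideal_subspace: "subspace I" and ideal_hpart: "x \<in> I \<Longrightarrow> hpart (piece A) x i \<in> I"
  and ideal_br: "x \<in> I \<Longrightarrow> br a x \<in> I" and ideal_der: "x \<in> I \<Longrightarrow> der A x \<in> I" and ideal_curv: "curv A \<in> I"
  using ideal by (auto simp: curved_lie_ideal_def)

lemmas ideal_0 = subspace_0[OF ideal_subspace] and ideal_add = subspace_add[OF ideal_subspace]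
  and ideal_neg = subspace_neg[OF ideal_subspace] and ideal_diff = subspace_diff[OF ideal_subspace]

lemma ideal_sg: "x \<in> I \<Longrightarrow> sg n x \<in> I"
  by (simp add: sg_def ideal_neg)

lemma ideal_br_left: "x \<in> I \<Longrightarrow> br x a \<in> I"
  unfolding gcomm_sum_homogeneous[of x a]
proof (intro subspace_sum[OF ideal_subspace])
  fix i j assume "x \<in> I"
  have "br (hpart (piece A) x i) (hpart (piece A) a j)
      = - sg (j * i) (br (hpart (piece A) a j) (hpart (piece A) x i))"
    by (rule gcomm_swap) (rule hpart_in)+
  then show "br (hpart (piece A) x i) (hpart (piece A) a j) \<in> I"
    using \<open>x \<in> I\<close> by (simp add: ideal_neg ideal_sg ideal_br ideal_hpart)
qed

lemma der_one: "der A 1 = 0"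
  using d_mult[OF one_piece, of 1] by simp

lemma coder_sec_simps [simp]:
  "coder (der A) br (sec_co p) [] = 0"
  "coder (der A) br (sec_co p) [a] = - p (der A (snd a))"
  "coder (der A) br (sec_co p) [a, b] = sg (fst a + 1) (p (br (snd a) (snd b)))"
  by (simp_all add: sg_def)

text \<open>
  Together with the next lemma: \<open>Q\<close> lowers the arity by at most one, so \<open>D p\<close> lives in arities one and two and
  \<open>p Q Q\<close> in arities one to three.
\<close>

lemma lie_vanish:
  assumes "\<And>w. length w \<ge> n \<Longrightarrow> f w = 0" "length w \<ge> n"
  shows "lie b a f w = 0"
  using assms
proof (induction w arbitrary: n f)
  case (Cons c w)
  have "lie b a (contr c f) w = 0"
    by (rule Cons.IH[of "n - 1"]) (use Cons.prems in auto)
  then show ?case using Cons.prems by simp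
qed simp

lemma coder_vanish:
  assumes "\<And>w. length w \<ge> n \<Longrightarrow> f w = 0" "length w \<ge> Suc n"
  shows "coder dv b f w = 0"
  using assms
proof (induction w arbitrary: n f)
  case (Cons c w)
  have "coder dv b (contr c f) w = 0"
  proof (cases n)
    case 0
    then have "contr c f = (\<lambda>w. 0)" using Cons.prems by auto
    then show ?thesis by simp
  next
    case (Suc m)
    show ?thesis by (rule Cons.IH[of m]) (use Cons.prems Suc in auto)
  qed
  moreover have "lie b c f w = 0" by (rule lie_vanish[of n]) (use Cons.prems in auto)
  ultimately show ?case using Cons.prems by simp
qed simp

lemma dsec_simps:
  "dsec_co A p [] = 0"
  "dsec_co A p [a] = der A (p (snd a)) - p (der A (snd a))"
  "dsec_co A p [a, b] = sg (fst a + 1) (p (br (snd a) (snd b)))"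
  "dsec_co A p (a # b # c # w) = 0"
proof -
  have "coder (der A) br (sec_co p) (a # b # c # w) = 0"
    by (rule coder_vanish[of 2]) (auto simp: sec_co_def split: list.split)
  then show "dsec_co A p (a # b # c # w) = 0" by (simp add: dsec_co_def d.zero)
qed (simp_all add: dsec_co_def d.zero del: coder.simps)

lemma homog_unit: "u \<in> piece A i \<Longrightarrow> homog ok (piece A) i (unit_co u)"
  by (auto simp: homog_def unit_co_def piece_zero)

lemma homog_sec: "homog ok (piece A) 1 (sec_co p)"
  by (auto simp: homog_def sec_co_def piece_zero good_def add.commute p_degree split: list.split)

lemma dsec_eq: "dsec_co A p = cdiff (der A) br 1 (sec_co p)"
  by (rule ext) (simp add: dsec_co_def cdiff_def)

lemma homog_dsec: "homog ok (piece A) 2 (dsec_co A p)"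
  unfolding homog_def
proof (intro allI impI)
  fix w assume w: "list_all ok w"
  consider "w = []" | a where "w = [a]" | a b where "w = [a, b]" | a b c v where "w = a # b # c # v"
    by (metis list.exhaust)
  then show "dsec_co A p w \<in> piece A (2 + sum_list (map fst w))"
  proof cases
    case (2 a)
    then have a: "snd a \<in> piece A (fst a + 1)" using w by (simp add: good_def)
    have "der A (p (snd a)) \<in> piece A (fst a + 1 + 1)" "p (der A (snd a)) \<in> piece A (fst a + 1 + 1)"
      using der_degree[OF p_degree[OF a]] p_degree[OF der_degree[OF a]] by simp_all
    moreover have "fst a + 1 + 1 = 2 + fst a" by simp
    ultimately show ?thesis by (simp add: 2 dsec_simps piece_diff)
  next
    case (3 a b)
    then have a: "br (snd a) (snd b) \<in> piece A ((fst a + 1) + (fst b + 1))"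
      using w by (intro gcomm_degree) (simp_all add: good_def)
    moreover have "(fst a + 1) + (fst b + 1) = 2 + (fst a + fst b)" by simp
    ultimately show ?thesis by (simp add: 3 dsec_simps H_sg p_degree)
  qed (simp_all add: dsec_simps piece_zero)
qed

lemma coder_coder_sec_pair:
  assumes "x \<in> piece A i" "y \<in> piece A j"
  shows "p (br (der A x) y) + sg i (p (br x (der A y))) = p (der A (br x y))"
  by (simp add: der_gcomm[OF assms] p_add sg_def p.minus p.diff)

lemma coder_unit: "coder dv b (unit_co u) w = 0"
proof -
  have lie: "lie b a (\<lambda>w. 0) w = 0" for a w by (induction w) auto
  have "lie b a (unit_co u) w = 0" for a w by (cases w) (auto simp: lie)
  then show ?thesis by (cases w) auto
qed

lemma cdiff_curv: "cdiff (der A) br 2 (unit_co (curv A)) w = 0"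
  by (cases w) (simp_all add: cdiff_def coder_unit der_curv d.zero del: coder.simps)

text \<open>
  Although \<open>Q Q\<close> is not zero on \<open>A\<close>, it is annihilated by \<open>p\<close>.  In arity one \<open>d d x = [R, x]\<close> lies in \<open>I\<close>; in
  arity two this is the Leibniz rule for the bracket and in arity three the Jacobi identity.
\<close>

lemma coder_coder_sec:
  assumes "list_all ok w"
  shows "coder (der A) br (coder (der A) br (sec_co p)) w = 0"
proof -
  let ?f = "coder (der A) br (sec_co p)"
  consider "w = []" | a where "w = [a]" | a b where "w = [a, b]" | a b c where "w = [a, b, c]"
    | a b c e v where "w = a # b # c # e # v"
    by (metis list.exhaust)
  then show ?thesis
  proof cases
    case (2 a)
    have "der A (der A (snd a)) \<in> I" unfolding der_der by (intro ideal_br_left ideal_curv)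
    then show ?thesis using 2 by (simp add: p_kill)
  next
    case (3 a b)
    obtain e x e' y where ab: "a = (e, x)" "b = (e', y)" by (cases a; cases b)
    then have "x \<in> piece A (e + 1)" "y \<in> piece A (e' + 1)" using 3 assms by auto
    from coder_coder_sec_pair[OF this, symmetric] show ?thesis
      unfolding 3 ab by (simp add: sg_def)
  next
    case (4 a b c)
    obtain e x e' y e'' z where abc: "a = (e, x)" "b = (e', y)" "c = (e'', z)" by (cases a; cases b; cases c)
    then have xyz: "x \<in> piece A (e + 1)" "y \<in> piece A (e' + 1)" "z \<in> piece A (e'' + 1)"
      using 4 assms by auto
    have j: "p (br x (br y z)) = p (br (br x y) z) + sg ((e + 1) * (e' + 1)) (p (br y (br x z)))"
      unfolding gcomm_jacobi[OF xyz] by (simp add: p_add sg_def p.minus)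
    have "p (br (br x y) z) = p (br x (br y z)) - sg ((e + 1) * (e' + 1)) (p (br y (br x z)))"
      using j by simp
    then show ?thesis unfolding 4 abc
      by (cases "even e"; cases "even e'"; cases "even e''") (simp_all add: sg_def)
  next
    case (5 a b c e v)
    have "?f w = 0" if "length w \<ge> 3" for w
      by (rule coder_vanish[of 2]) (use that in \<open>auto simp: sec_co_def split: list.split\<close>)
    then show ?thesis by (intro coder_vanish[of 3 ?f]) (auto simp: 5)
  qed simp
qed

end

lemma pm_one_mult:
  fixes x :: "nat \<Rightarrow>\<^sub>0 'a::{ring, monoid_mult}"
  shows "Poly_Mapping.single 0 1 * x = x" "x * Poly_Mapping.single 0 1 = x"
proof -
  show "Poly_Mapping.single 0 1 * x = x"
    by (rule pm_closed[where p = x and Q = "\<lambda>x. Poly_Mapping.single 0 1 * x = x"])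
       (simp_all add: distrib_left mult_single)
  show "x * Poly_Mapping.single 0 1 = x"
    by (rule pm_closed[where p = x and Q = "\<lambda>x. x * Poly_Mapping.single 0 1 = x"])
       (simp_all add: distrib_right mult_single)
qed

context curved_projection begin

section \<open>The Bianchi identity\<close>

text \<open>
  \<open>D D p = R p - p R\<close>: the terms \<open>d p Q\<close> cancel, \<open>p Q Q\<close> vanishes, and \<open>d d\<close> is the commutator with \<open>R\<close>.
\<close>

lemma cdiff_dsec:
  assumes "list_all ok w"
  shows "cdiff (der A) br 2 (dsec_co A p) w
    = conv 1 (unit_co (curv A)) (sec_co p) w - conv 0 (sec_co p) (unit_co (curv A)) w"
proof -
  let ?s = "sec_co p"
  have "coder (der A) br (\<lambda>w. der A (?s w)) w = der A (coder (der A) br ?s w)"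
    using coder_additive_natural[OF d.additive_axioms, of "der A" br ?s w] by simp
  then have "cdiff (der A) br 2 (dsec_co A p) w = der A (der A (?s w))"
    by (simp add: cdiff_def dsec_co_def d_add coder_add coder_coder_sec[OF assms])
  also have "\<dots> = curv A * ?s w - ?s w * curv A"
  proof -
    obtain i where "?s w \<in> piece A i" using homog_sec assms by (auto simp: homog_def)
    then show ?thesis using gcomm_sg[OF curv_degree] by (simp add: der_der sg_def)
  qed
  finally show ?thesis by (simp add: conv_unit_left conv_unit_right)
qed

text \<open>
  Polynomial cochains: \<open>ts\<close> is the connection \<open>t p\<close>, \<open>Rt\<close> its curvature and \<open>Pt k\<close> the \<open>k\<close>-th power of \<open>Rt\<close>.
\<close>

abbreviation "Rt \<equiv> curv_path A p"
abbreviation "ts \<equiv> lift 1 (sec_co p)"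
abbreviation "Pt \<equiv> cpow (Poly_Mapping.single 0 1) (curv_path A p)"
abbreviation "ss \<equiv> conv 1 (sec_co p) (sec_co p)"
abbreviation "pdiff \<equiv> poly.cdiff (der A) br"

lemma homog_lift: "homog ok (piece A) i f \<Longrightarrow> homog ok (\<lambda>i. pcoeffs (piece A i)) i (lift m f)"
  by (auto simp: homog_def lift_def intro!: pcoeffs_single piece_zero)

lemma homog_ss: "homog ok (piece A) 2 ss"
  using homog_conv[OF homog_sec homog_sec] by simp

lemma homog_Rt: "homog ok (\<lambda>i. pcoeffs (piece A i)) 2 Rt"
proof -
  have "homog ok (\<lambda>i. pcoeffs (piece A i)) 2 (lift 0 (unit_co (curv A)))"
    "homog ok (\<lambda>i. pcoeffs (piece A i)) 2 (lift 1 (dsec_co A p))"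
    "homog ok (\<lambda>i. pcoeffs (piece A i)) 2 (lift 2 ss)"
    using homog_unit[OF curv_degree] homog_dsec homog_ss by (auto intro: homog_lift)
  then show ?thesis by (auto simp: homog_def curv_path_def intro!: poly.H_add)
qed

lemma homog_ts: "homog ok (\<lambda>i. pcoeffs (piece A i)) 1 ts"
  by (intro homog_lift homog_sec)

lemma homog_Pt: "homog ok (\<lambda>i. pcoeffs (piece A i)) (2 * int k) (Pt k)"
proof (induction k)
  case 0
  show ?case by (auto simp: homog_def unit_co_def piece_zero pcoeffs_zero intro!: pcoeffs_single one_piece)
next
  case (Suc k)
  show ?case using poly.homog_conv[OF homog_Rt Suc] by (simp add: algebra_simps)
qed

lemma pdiff_lift: "pdiff i (lift m f) w = Poly_Mapping.single m (cdiff (der A) br i f w)"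
proof -
  have "additive (Poly_Mapping.single m :: 'a \<Rightarrow> _)" by unfold_locales (rule single_add)
  from coder_additive_natural[OF this, of "der A" br f w, symmetric]
  show ?thesis
    by (simp add: poly.cdiff_def cdiff_def lift_def mapp_single d.zero sg_single single_diff)
qed

text \<open>
  The coefficients of \<open>t\<close> and \<open>t^2\<close> are \<open>D D p = R p - p R\<close> and \<open>D (p p) = (D p) p - p (D p)\<close>; the coefficient
  of \<open>t^3\<close> vanishes by associativity.
\<close>

lemma bianchi:
  assumes "list_all ok w"
  shows "pdiff 2 Rt w = conv 1 Rt ts w - conv 0 ts Rt w"
proof -
  have ss: "cdiff (der A) br 2 ss w = conv 1 (dsec_co A p) (sec_co p) w - conv 0 (sec_co p) (dsec_co A p) w"
    using cdiff_conv[OF homog_sec assms, of "der A" br 1 "sec_co p"] conv_parity[of 2 0 "sec_co p" "dsec_co A p" w]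
    by (simp add: dsec_eq)
  have sss: "conv 1 ss (sec_co p) w = conv 0 (sec_co p) ss w"
    using conv_assoc[of 1 1 "sec_co p" "sec_co p" "sec_co p" w] conv_parity[of 2 0 "sec_co p" ss w] by simp
  have "pdiff 2 Rt w = pdiff 2 (lift 0 (unit_co (curv A))) w + pdiff 2 (lift 1 (dsec_co A p)) w
      + pdiff 2 (lift 2 ss) w"
    unfolding curv_path_def by (simp only: poly.cdiff_add)
  also have "\<dots> = conv 1 Rt ts w - conv 0 ts Rt w"
    unfolding pdiff_lift cdiff_curv cdiff_dsec[OF assms] ss curv_path_def conv_add_left conv_add_right conv_lift
    unfolding lift_def sss by (simp add: single_diff numeral_eq_Suc)
  finally show ?thesis .
qed

text \<open>
  \<open>f \<mapsto> f (t p) - (t p) f\<close> is a derivation on even cochains, and by the Bianchi identity it agrees with \<open>D\<close> on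
  \<open>Rt\<close>, hence on its powers.
\<close>

lemma pdiff_Pt:
  "list_all ok w \<Longrightarrow> pdiff (2 * int k) (Pt k) w = conv 1 (Pt k) ts w - conv 0 ts (Pt k) w"
proof (induction k arbitrary: w)
  case 0
  have "pdiff 0 (Pt 0) w = 0"
    by (cases w) (simp_all add: poly.cdiff_def coder_unit mapp_single d.zero der_one poly.d.zero del: coder.simps)
  then show ?case by (simp add: conv_unit_left conv_unit_right pm_one_mult)
next
  case (Suc k)
  have "pdiff (2 * int (Suc k)) (Pt (Suc k)) w = pdiff (2 + 2 * int k) (conv (2 * int k) Rt (Pt k)) w"
  proof -
    have "conv 0 Rt (Pt k) = conv (2 * int k) Rt (Pt k)" by (rule ext, rule conv_parity) simp
    then show ?thesis by (simp add: algebra_simps)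
  qed
  also have "\<dots> = conv (2 * int k) (pdiff 2 Rt) (Pt k) w + conv (2 * int k + 1) Rt (pdiff (2 * int k) (Pt k)) w"
    using poly.cdiff_conv[OF homog_Rt Suc.prems] by simp
  also have "conv (2 * int k) (pdiff 2 Rt) (Pt k) w = conv 0 (\<lambda>w. conv 1 Rt ts w - conv 0 ts Rt w) (Pt k) w"
  proof -
    have "conv (2 * int k) (pdiff 2 Rt) (Pt k) w = conv 0 (pdiff 2 Rt) (Pt k) w" by (rule conv_parity) simp
    also have "\<dots> = conv 0 (\<lambda>w. conv 1 Rt ts w - conv 0 ts Rt w) (Pt k) w"
      by (rule conv_cong[where ok = ok], erule bianchi, rule refl, rule Suc.prems)
    finally show ?thesis .
  qed
  also have "conv (2 * int k + 1) Rt (pdiff (2 * int k) (Pt k)) w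
    = conv 1 Rt (\<lambda>w. conv 1 (Pt k) ts w - conv 0 ts (Pt k) w) w"
  proof -
    have "conv (2 * int k + 1) Rt (pdiff (2 * int k) (Pt k)) w = conv 1 Rt (pdiff (2 * int k) (Pt k)) w"
      by (rule conv_parity) simp
    also have "\<dots> = conv 1 Rt (\<lambda>w. conv 1 (Pt k) ts w - conv 0 ts (Pt k) w) w"
      by (rule conv_cong[where ok = ok], rule refl, erule Suc.IH, rule Suc.prems)
    finally show ?thesis .
  qed
  finally show ?case
    using conv_assoc[of 0 1 Rt "Pt k" ts w] conv_assoc[of 1 0 Rt ts "Pt k" w] conv_assoc[of 0 0 ts Rt "Pt k" w]
    by (simp add: conv_diff_left conv_diff_right)
qed


section \<open>The trace and the ideal\<close>

text \<open>
  The kernel of the trace to \<open>A/([A,A] + I^(k+1) A)\<close>.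
\<close>

abbreviation "TT k \<equiv> trace_ideal A I k"

lemma subspace_TT: "subspace (TT k)"
proof -
  have "trace_ideal A I k = {x + y | x y. x \<in> comm_space A \<and> y \<in> right_space A (power_space A I (k + 1))}"
    by (auto simp: trace_ideal_def set_plus_def)
  then show ?thesis
    unfolding comm_space_def right_space_def by (simp add: subspace_sums)
qed

lemmas T_0 = subspace_0[OF subspace_TT] and T_add = subspace_add[OF subspace_TT]
  and T_neg = subspace_neg[OF subspace_TT] and T_diff = subspace_diff[OF subspace_TT]
  and T_scale = subspace_scale[OF subspace_TT]

lemma comm_space_T: "x \<in> comm_space A \<Longrightarrow> x \<in> TT k"
  unfolding trace_ideal_def right_space_def
  using set_plus_intro[OF _ span_zero] by fastforce

lemma right_space_T: "x \<in> right_space A (power_space A I (k + 1)) \<Longrightarrow> x \<in> TT k"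
  unfolding trace_ideal_def comm_space_def
  using set_plus_intro[OF span_zero] by fastforce

lemma power_space_T: "x \<in> power_space A I (k + 1) \<Longrightarrow> x \<in> TT k"
proof -
  assume "x \<in> power_space A I (k + 1)"
  then have "x * 1 \<in> right_space A (power_space A I (k + 1))"
    unfolding right_space_def by (intro span_base) blast
  then show ?thesis using right_space_T by simp
qed

lemma T_commutator:
  assumes "x \<in> piece A i" "y \<in> piece A j"
  shows "x * y - sg (i * j) (y * x) \<in> TT k"
  unfolding gcomm_sg[OF assms, symmetric]
  by (rule comm_space_T) (auto simp: comm_space_def intro: span_base)

lemma power_space_mult:
  assumes "x \<in> I" "y \<in> power_space A I n"
  shows "x * y \<in> power_space A I (Suc n)"
  using assms(2) unfolding power_space_def
proof (induction rule: span_induct_alt)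
  case base
  then show ?case by (simp add: span_zero)
next
  case (step c y z)
  then obtain es where "y = prod_list es" "length es = n" "set es \<subseteq> I" by auto
  then have "x * y \<in> {prod_list es | es. length es = Suc n \<and> set es \<subseteq> I}"
    using assms(1) by (auto intro!: exI[of _ "x # es"])
  moreover have "x * (scal A c y + z) = scal A c (x * y) + x * z"
    by (simp add: algebra_simps scale_mult_right)
  ultimately show ?case using step by (auto intro: span_add span_scale span_base)
qed

lemma cpow_power_space:
  assumes "\<And>w. list_all ok w \<Longrightarrow> f w \<in> I" "list_all ok w"
  shows "cpow 1 f n w \<in> power_space A I n"
  using assms(2)
proof (induction n arbitrary: w)
  case 0
  have "1 \<in> power_space A I 0" unfolding power_space_def by (rule span_base) auto
  then show ?case by (simp add: unit_co_def power_space_def span_zero)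
next
  case (Suc n)
  have "conv 0 f (cpow 1 f n) w \<in> power_space A I (Suc n)"
    by (rule conv_closed[where ok = ok and X = I and Y = "power_space A I n"])
       (use assms(1) Suc power_space_mult in \<open>auto simp: power_space_def span_add span_neg\<close>)
  then show ?case by simp
qed

text \<open>
  The defining property of the connection: its curvature at \<open>t = 1\<close> vanishes modulo \<open>I\<close>, because the identity of
  \<open>A/I\<close> is a morphism of DG-Lie algebras.  In arity two \<open>p p\<close> is, up to sign, the bracket \<open>[p x, p y]\<close>.
\<close>

lemma curvature_in_ideal:
  assumes "list_all ok w"
  shows "unit_co (curv A) w + dsec_co A p w + ss w \<in> I"
proof -
  consider "w = []" | a where "w = [a]" | a b where "w = [a, b]" | a b c v where "w = a # b # c # v"
    by (metis list.exhaust)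
  then show ?thesis
  proof cases
    case 1
    then show ?thesis by (simp add: dsec_simps ideal_curv)
  next
    case (2 a)
    have "der A (p (snd a)) - p (der A (snd a))
      = der A (p (snd a) - snd a) - (p (der A (snd a)) - der A (snd a))"
      by (simp add: d.diff)
    also have "\<dots> \<in> I" by (intro ideal_diff ideal_der p_mod)
    finally show ?thesis using 2 by (simp add: dsec_simps)
  next
    case (3 a b)
    obtain e x e' y where ab: "a = (e, x)" "b = (e', y)" by (cases a; cases b)
    then have xy: "p x \<in> piece A (e + 1)" "p y \<in> piece A (e' + 1)"
      using 3 assms p_degree by auto
    have "br (p x) (p y) - br x y = br (p x - x) (p y) + br x (p y - y)"
      using gcomm_add_left[of "p x - x" x "p y"] gcomm_add_right[of x "p y - y" y] by simp
    also have "\<dots> \<in> I" by (intro ideal_add ideal_br ideal_br_left p_mod)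
    finally have "sg (e + 1) ((p (br x y) - br x y) - (br (p x) (p y) - br x y)) \<in> I"
      using ideal_sg[OF ideal_diff[OF p_mod]] by blast
    moreover have "ss w = - sg (e + 1) (br (p x) (p y))"
      unfolding gcomm_sg[OF xy] by (simp add: 3 ab sg_def)
    ultimately show ?thesis by (simp add: 3 ab dsec_simps sg_diff)
  next
    case (4 a b c v)
    then show ?thesis by (simp add: dsec_simps ideal_0)
  qed
qed


section \<open>Transgression\<close>

text \<open>
  The Euler derivation \<open>t d/dt\<close>.
\<close>

definition euler :: "(nat \<Rightarrow>\<^sub>0 'a) \<Rightarrow> (nat \<Rightarrow>\<^sub>0 'a)" where
  "euler = Poly_Mapping.mapp (\<lambda>m. scal A (of_nat m))"

definition pscal :: "'k \<Rightarrow> (nat \<Rightarrow>\<^sub>0 'a) \<Rightarrow> (nat \<Rightarrow>\<^sub>0 'a)" where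
  "pscal c = Poly_Mapping.mapp (\<lambda>_. scal A c)"

lemma lookup_pscal: "Poly_Mapping.lookup (pscal c x) m = scal A c (Poly_Mapping.lookup x m)"
  by (simp add: pscal_def lookup_mapp_zero)

lemma lookup_euler: "Poly_Mapping.lookup (euler x) m = scal A (of_nat m) (Poly_Mapping.lookup x m)"
  by (simp add: euler_def lookup_mapp_zero)

lemma euler_add: "euler (x + y) = euler x + euler y"
  by (rule poly_mapping_eqI) (simp add: lookup_euler lookup_add scale_right_distrib)

lemma euler_single: "euler (Poly_Mapping.single m a) = Poly_Mapping.single m (scal A (of_nat m) a)"
  by (simp add: euler_def mapp_single)

lemma euler_mult: "euler (x * y) = euler x * y + x * euler y"
  by (rule pm_biadditive_eqI[where B = "\<lambda>x y. euler (x * y)"])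
     (simp_all add: algebra_simps euler_add mult_single euler_single scale_left_distrib single_add
       flip: scale_mult_left scale_mult_right)

lemma euler_degree: "x \<in> pcoeffs (piece A i) \<Longrightarrow> euler x \<in> pcoeffs (piece A i)"
  by (simp add: pcoeffs_def lookup_euler piece_scale)

lemma pm_integral_add: "pm_integral A (x + y) = pm_integral A x + pm_integral A y"
  unfolding pm_integral_def by (rule pm_ext_add) (rule scale_right_distrib)

lemma pm_integral_single: "pm_integral A (Poly_Mapping.single m a) = scal A (1 / of_nat m) a"
  by (simp add: pm_integral_def pm_ext_single)

sublocale pm_integral: additive "pm_integral A"
  by unfold_locales (rule pm_integral_add)

lemma pm_integral_closed:
  assumes "subspace X" "x \<in> pcoeffs X"
  shows "pm_integral A x \<in> X"
  unfolding pm_integral_def pm_ext_def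
  by (intro subspace_sum subspace_scale assms(1)) (use assms(2) in \<open>simp add: pcoeffs_def\<close>)

lemma pm_integral_pscal: "pm_integral A (pscal c x) = scal A c (pm_integral A x)"
proof (rule pm_closed[where p = x and Q = "\<lambda>x. pm_integral A (pscal c x) = scal A c (pm_integral A x)"])
  show "pm_integral A (pscal c 0) = scal A c (pm_integral A 0)"
  proof -
    have "pscal c 0 = 0" by (rule poly_mapping_eqI) (simp add: lookup_pscal)
    then show ?thesis by (simp add: pm_integral.zero)
  qed
next
  fix x y :: "nat \<Rightarrow>\<^sub>0 'a"
  have "pscal c (x + y) = pscal c x + pscal c y"
    unfolding pscal_def by (rule mapp_add) (rule scale_right_distrib)
  then show "pm_integral A (pscal c x) = scal A c (pm_integral A x) \<Longrightarrow>
    pm_integral A (pscal c y) = scal A c (pm_integral A y) \<Longrightarrow>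
    pm_integral A (pscal c (x + y)) = scal A c (pm_integral A (x + y))"
    by (simp add: pm_integral_add scale_right_distrib)
qed (simp add: pscal_def mapp_single pm_integral_single mult.commute)

lemma pm_integral_der: "pm_integral A (Poly_Mapping.mapp (\<lambda>_. der A) x) = der A (pm_integral A x)"
  by (rule pm_closed[where p = x and
        Q = "\<lambda>x. pm_integral A (Poly_Mapping.mapp (\<lambda>_. der A) x) = der A (pm_integral A x)"])
     (simp_all add: poly.d_add poly.d.zero d.zero d_add pm_integral_add mapp_single pm_integral_single der_scale
       pm_integral.zero)

text \<open>
  The fundamental theorem of calculus: \<open>\<integral> (t F'(t)) dt/t = F(1) - F(0)\<close>.
\<close>

lemma pm_integral_euler:
  "pm_integral A (euler x) = pm_eval1 x - Poly_Mapping.lookup x 0"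
proof (rule pm_closed[where p = x and
      Q = "\<lambda>x. pm_integral A (euler x) = pm_eval1 x - Poly_Mapping.lookup x 0"])
  show "pm_integral A (euler 0) = pm_eval1 0 - Poly_Mapping.lookup 0 0"
    using euler_add[of 0 0] pm_eval1_add[of 0 "0 :: nat \<Rightarrow>\<^sub>0 'a"] by (simp add: pm_integral.zero)
qed (auto simp: euler_add pm_integral_add pm_eval1_add lookup_add euler_single pm_integral_single
       lookup_single when_def)

abbreviation "ERt \<equiv> (\<lambda>w. euler (Rt w))"

lemma ERt_eq: "ERt w = lift 1 (dsec_co A p) w + (lift 2 ss w + lift 2 ss w)"
proof -
  have "scal A 2 x = x + x" for x
    using scale_left_distrib[of 1 1 x] by simp
  then show ?thesis
    by (simp add: curv_path_def lift_def euler_add euler_single single_add)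
qed

lemma homog_ERt: "homog ok (\<lambda>i. pcoeffs (piece A i)) 2 ERt"
  using homog_Rt by (auto simp: homog_def euler_degree)

lemma pT_add: "x \<in> pcoeffs (TT n) \<Longrightarrow> y \<in> pcoeffs (TT n) \<Longrightarrow> x + y \<in> pcoeffs (TT n)"
  by (intro pcoeffs_add T_add)

lemma pT_neg: "x \<in> pcoeffs (TT n) \<Longrightarrow> - x \<in> pcoeffs (TT n)"
  by (intro pcoeffs_uminus T_neg)

lemma poly_trace:
  assumes "homog ok (\<lambda>i. pcoeffs (piece A i)) i f" "homog ok (\<lambda>i. pcoeffs (piece A i)) j g" "list_all ok w"
  shows "conv j f g w - sg (i * j) (conv i g f w) \<in> pcoeffs (TT n)"
  by (rule conv_commutator[OF assms pT_add pT_neg])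
     (auto intro!: commutator_poly T_0 T_add T_commutator)

lemma poly_trace_even:
  assumes "homog ok (\<lambda>i. pcoeffs (piece A i)) i f" "homog ok (\<lambda>i. pcoeffs (piece A i)) j g" "list_all ok w"
    and "even i" "even j"
  shows "conv 0 f g w - conv 0 g f w \<in> pcoeffs (TT n)"
  using poly_trace[OF assms(1-3), of n] conv_parity[of j 0 f g w] conv_parity[of i 0 g f w] assms(4,5)
  by (simp add: sg_def)

lemma homog_conv_Pt: "homog ok (\<lambda>i. pcoeffs (piece A i)) i f \<Longrightarrow>
    homog ok (\<lambda>i. pcoeffs (piece A i)) (i + 2 * int k) (conv q f (Pt k))"
  by (rule poly.homog_conv) (auto intro: homog_Pt)

text \<open>
  Modulo commutators, \<open>D (t p R_t^k) = t (dR_t/dt) R_t^k\<close>.  By the Leibniz rule and \<open>pdiff_Pt\<close> the left side is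
  \<open>t (D p) R_t^k - (t p) R_t^k (t p) + (t p) (t p) R_t^k\<close>.  Since \<open>p\<close> is odd, cyclicity turns the second term
  into another copy of the third one, and \<open>t D p + 2 t^2 p p\<close> is \<open>t dR_t/dt\<close>.
\<close>

lemma transgression:
  assumes w: "list_all ok w"
  shows "pdiff (2 * int k + 1) (conv 0 ts (Pt k)) w - conv 0 ERt (Pt k) w \<in> pcoeffs (TT n)"
proof -
  have dts: "pdiff 1 ts = lift 1 (dsec_co A p)"
    by (rule ext, subst pdiff_lift) (simp add: lift_def dsec_eq)
  have "pdiff (2 * int k + 1) (conv 0 ts (Pt k)) w = pdiff (1 + 2 * int k) (conv (2 * int k) ts (Pt k)) w"
  proof -
    have "conv 0 ts (Pt k) = conv (2 * int k) ts (Pt k)" by (rule ext, rule conv_parity) simp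
    then show ?thesis by (simp add: algebra_simps)
  qed
  also have "\<dots> = conv (2 * int k) (pdiff 1 ts) (Pt k) w - conv (2 * int k + 1) ts (pdiff (2 * int k) (Pt k)) w"
    using poly.cdiff_conv[OF homog_ts w, of "der A" br "2 * int k" "Pt k"] by simp
  also have "conv (2 * int k) (pdiff 1 ts) (Pt k) w = conv 0 (lift 1 (dsec_co A p)) (Pt k) w"
    unfolding dts by (rule conv_parity) simp
  also have "conv (2 * int k + 1) ts (pdiff (2 * int k) (Pt k)) w
    = conv 1 ts (\<lambda>w. conv 1 (Pt k) ts w - conv 0 ts (Pt k) w) w"
  proof -
    have "conv (2 * int k + 1) ts (pdiff (2 * int k) (Pt k)) w = conv 1 ts (pdiff (2 * int k) (Pt k)) w"
      by (rule conv_parity) simp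
    also have "\<dots> = conv 1 ts (\<lambda>w. conv 1 (Pt k) ts w - conv 0 ts (Pt k) w) w"
      by (rule conv_cong[where ok = ok], rule refl, erule pdiff_Pt, rule w)
    finally show ?thesis .
  qed
  finally have 1: "pdiff (2 * int k + 1) (conv 0 ts (Pt k)) w
    = conv 0 (lift 1 (dsec_co A p)) (Pt k) w - conv 1 ts (conv 1 (Pt k) ts) w + conv 1 ts (conv 0 ts (Pt k)) w"
    by (simp add: conv_diff_right)
  have tt: "conv 1 ts ts = lift 2 ss" by (simp add: conv_lift numeral_eq_Suc)
  have 2: "conv 1 ts (conv 0 ts (Pt k)) w = conv 0 (lift 2 ss) (Pt k) w"
    using conv_assoc[of 1 0 ts ts "Pt k" w] unfolding tt by simp
  have "conv 1 ts (conv 1 (Pt k) ts) w + conv 1 (conv 1 (Pt k) ts) ts w \<in> pcoeffs (TT n)"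
  proof -
    have h: "homog ok (\<lambda>i. pcoeffs (piece A i)) (2 * int k + 1) (conv 1 (Pt k) ts)"
      by (rule poly.homog_conv[OF homog_Pt homog_ts])
    show ?thesis
      using poly_trace[OF homog_ts h w, of n] conv_parity[of "2 * int k + 1" 1 ts "conv 1 (Pt k) ts" w]
      by (simp add: sg_def)
  qed
  moreover have "conv 1 (conv 1 (Pt k) ts) ts w = conv 0 (Pt k) (lift 2 ss) w"
    using conv_assoc[of 1 1 "Pt k" ts ts w] conv_parity[of 2 0 "Pt k" "lift 2 ss" w] unfolding tt by simp
  moreover have "conv 0 (lift 2 ss) (Pt k) w - conv 0 (Pt k) (lift 2 ss) w \<in> pcoeffs (TT n)"
    using homog_lift[OF homog_ss] homog_Pt w by (rule poly_trace_even) auto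
  ultimately have "(conv 1 ts (conv 1 (Pt k) ts) w + conv 0 (Pt k) (lift 2 ss) w)
      + (conv 0 (lift 2 ss) (Pt k) w - conv 0 (Pt k) (lift 2 ss) w) \<in> pcoeffs (TT n)"
    by (intro pT_add[of "_ + _"]) simp_all
  moreover have "(x + z) + (y - z) = x + y" for x y z :: "nat \<Rightarrow>\<^sub>0 'a" by simp
  ultimately have "conv 1 ts (conv 1 (Pt k) ts) w + conv 0 (lift 2 ss) (Pt k) w \<in> pcoeffs (TT n)"
    by (simp only:)
  then have "- (conv 1 ts (conv 1 (Pt k) ts) w + conv 0 (lift 2 ss) (Pt k) w) \<in> pcoeffs (TT n)"
    by (rule pT_neg)
  moreover have "conv 0 ERt (Pt k) w = conv 0 (lift 1 (dsec_co A p)) (Pt k) w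
      + (conv 0 (lift 2 ss) (Pt k) w + conv 0 (lift 2 ss) (Pt k) w)"
    unfolding ERt_eq by (simp only: conv_add_left)
  moreover have "x - y + z - (x + (z + z)) = - (y + z)" for x y z :: "nat \<Rightarrow>\<^sub>0 'a" by simp
  ultimately show ?thesis unfolding 1 2 by (simp only:)
qed

text \<open>
  For \<open>i = 0\<close> this says that the trace of \<open>t d/dt R_t^(k+1)\<close> is \<open>k + 1\<close> times the trace of
  \<open>(t dR_t/dt) R_t^k\<close>.  The additional factor \<open>R_t^i\<close> on the left makes the induction on \<open>k\<close> work: it collects
  the factors that have been split off.
\<close>

lemma trace_euler_power:
  assumes w: "list_all ok w"
  shows "conv 0 (Pt i) (\<lambda>w. euler (Pt (Suc k) w)) w - pscal (of_nat (Suc k)) (conv 0 ERt (Pt (i + k)) w)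
    \<in> pcoeffs (TT n)"
proof (induction k arbitrary: i)
  note one = pm_one_mult
  have E: "(\<lambda>w. euler (Pt (Suc k) w)) = (\<lambda>w. conv 0 ERt (Pt k) w + conv 0 Rt (\<lambda>w. euler (Pt k w)) w)" for k
    by (rule ext) (simp add: conv_even_derivation[of euler] euler_add euler_mult)
  have R: "conv 0 (Pt i) Rt = Pt (Suc i)" for i
  proof -
    have "Pt (Suc 0) = Rt" by (rule ext) (simp add: conv_unit_right one)
    then show ?thesis using cpow_add[of "Poly_Mapping.single 0 1" Rt i "Suc 0", OF one(1)]
      by (simp only: add_Suc_right add_0_right)
  qed
  have A: "conv 0 (Pt i) (conv 0 ERt (Pt k)) w - conv 0 ERt (Pt (i + k)) w \<in> pcoeffs (TT n)" for i k
  proof -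
    have "conv 0 (conv 0 ERt (Pt k)) (Pt i) w = conv 0 ERt (conv 0 (Pt k) (Pt i)) w"
      using conv_assoc[of 0 0 ERt "Pt k" "Pt i" w] by simp
    also have "\<dots> = conv 0 ERt (Pt (i + k)) w"
      using cpow_add[of "Poly_Mapping.single 0 1" Rt k i, OF one(1)] by (simp add: add.commute)
    finally show ?thesis
      using poly_trace_even[OF homog_Pt homog_conv_Pt[OF homog_ERt] w, of i k 0 n] by simp
  qed
  have scal1: "pscal 1 x = x" and scalSuc: "pscal (of_nat (Suc m)) x = x + pscal (of_nat m) x" for x m
    by (rule poly_mapping_eqI, simp add: lookup_pscal lookup_add scale_left_distrib)+
  {
    case 0
    have "(\<lambda>w. euler (Pt 0 w)) = (\<lambda>w. 0)"
      by (rule ext, rule poly_mapping_eqI) (simp add: lookup_euler unit_co_def lookup_single when_def)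
    then show ?case using A[of i 0] unfolding E by (simp add: conv_add_right scal1)
  next
    case (Suc k)
    have "conv 0 (Pt i) (conv 0 Rt (\<lambda>w. euler (Pt (Suc k) w))) w
        = conv 0 (Pt (Suc i)) (\<lambda>w. euler (Pt (Suc k) w)) w"
      using conv_assoc[of 0 0 "Pt i" Rt "\<lambda>w. euler (Pt (Suc k) w)" w] by (simp only: R) simp
    then have "conv 0 (Pt i) (\<lambda>w. euler (Pt (Suc (Suc k)) w)) w
        - pscal (of_nat (Suc (Suc k))) (conv 0 ERt (Pt (i + Suc k)) w)
      = (conv 0 (Pt i) (conv 0 ERt (Pt (Suc k))) w - conv 0 ERt (Pt (i + Suc k)) w)
        + (conv 0 (Pt (Suc i)) (\<lambda>w. euler (Pt (Suc k) w)) w - pscal (of_nat (Suc k)) (conv 0 ERt (Pt (Suc i + k)) w))"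
      unfolding E[of "Suc k"] scalSuc[of "Suc k"] conv_add_right by simp
    then show ?case using pT_add[OF A[of i "Suc k"] Suc.IH[of "Suc i"]] by simp
  }
qed

lemma cpow_eval:
  assumes "list_all ok w"
  shows "pm_eval1 (Pt (Suc n) w) \<in> TT n" "Poly_Mapping.lookup (Pt (Suc n) w) 0 \<in> TT n"
proof -
  have "pm_eval1 (Pt (Suc n) w) = cpow 1 (\<lambda>w. pm_eval1 (Rt w)) (Suc n) w"
    using cpow_hom[of pm_eval1, OF pm_eval1_add pm_eval1_mult, of "Poly_Mapping.single 0 1" Rt "Suc n" w] by simp
  moreover have "pm_eval1 (Rt w) \<in> I" if "list_all ok w" for w
    using curvature_in_ideal[OF that] by (simp add: curv_path_def lift_def pm_eval1_add)
  ultimately show "pm_eval1 (Pt (Suc n) w) \<in> TT n"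
    using cpow_power_space[of "\<lambda>w. pm_eval1 (Rt w)" w "Suc n"] assms power_space_T[of _ n] by simp
  have "Poly_Mapping.lookup (Pt (Suc n) w) 0 = cpow 1 (\<lambda>w. Poly_Mapping.lookup (Rt w) 0) (Suc n) w"
    using cpow_hom[of "\<lambda>x. Poly_Mapping.lookup x 0", OF lookup_add lookup_mult_zero, of "Poly_Mapping.single 0 1" Rt "Suc n" w]
    by simp
  moreover have "Poly_Mapping.lookup (Rt w) 0 \<in> I" for w
    by (simp add: curv_path_def lift_def lookup_add lookup_single unit_co_def ideal_curv ideal_0)
  ultimately show "Poly_Mapping.lookup (Pt (Suc n) w) 0 \<in> TT n"
    using cpow_power_space[of "\<lambda>w. Poly_Mapping.lookup (Rt w) 0" w "Suc n"] assms power_space_T[of _ n] by simp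
qed

abbreviation "cs \<equiv> chern_simons A p"

lemma homog_cs: "homog ok (piece A) (2 * int k + 1) (cs k)"
  using homog_conv_Pt[OF homog_ts, of k 0]
  by (auto simp: homog_def chern_simons_def add.commute intro!: piece_scale pm_integral_closed subspace_piece)

text \<open>
  The equation \<open>D \<sigma>^k = 0\<close> modulo \<open>[A,A] + I^(k+1) A\<close>, since \<open>2 k + 1\<close> is odd: \<open>transgression\<close> and
  \<open>trace_euler_power\<close> make \<open>(k + 1)! D \<sigma>^k\<close> the integral of the derivative of \<open>tr R_t^(k+1)\<close>, and at both ends of
  the interval \<open>R_t\<close> has values in \<open>I\<close>.
\<close>

lemma cs_cocycle:
  assumes w: "list_all ok w"
  shows "der A (cs k w) + coder (der A) br (cs k) w \<in> TT k"
proof -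
  let ?f = "conv 0 ts (Pt k)" and ?J = "pm_integral A"
  define c :: 'k where "c = 1 / fact k"
  have "additive (\<lambda>x. scal A c (?J x))"
    by unfold_locales (simp add: pm_integral_add scale_right_distrib)
  from coder_additive_natural[OF this, of "der A" br ?f w]
  have "der A (cs k w) + coder (der A) br (cs k) w = scal A c (?J (pdiff (2 * int k + 1) ?f w))"
    by (simp add: poly.cdiff_def sg_def pm_integral_add scale_right_distrib pm_integral_der chern_simons_def
        der_scale c_def)
  moreover have "?J (pdiff (2 * int k + 1) ?f w) \<in> TT k"
  proof -
    let ?X = "conv 0 ERt (Pt k) w"
    have 1: "?J (pdiff (2 * int k + 1) ?f w) - ?J ?X \<in> TT k"
      using pm_integral_closed[OF subspace_TT transgression[OF w, of k k]] by (simp add: pm_integral.diff)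
    have "conv 0 (Pt 0) (\<lambda>w. euler (Pt (Suc k) w)) w = euler (Pt (Suc k) w)"
      by (simp add: conv_unit_left pm_one_mult)
    then have 2: "?J (euler (Pt (Suc k) w)) - scal A (of_nat (Suc k)) (?J ?X) \<in> TT k"
      using pm_integral_closed[OF subspace_TT trace_euler_power[OF w, of 0 k k]]
      by (simp only: pm_integral.diff pm_integral_pscal) simp
    have "?J (euler (Pt (Suc k) w)) \<in> TT k"
      unfolding pm_integral_euler by (intro T_diff cpow_eval w)
    from T_diff[OF this 2] have "scal A (of_nat (Suc k)) (?J ?X) \<in> TT k" by simp
    then have "scal A (1 / of_nat (Suc k)) (scal A (of_nat (Suc k)) (?J ?X)) \<in> TT k" by (rule T_scale)
    moreover have "1 / of_nat (Suc k) * of_nat (Suc k) = (1 :: 'k)" 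
      using of_nat_neq_0[of k, where 'a = 'k] by (simp del: of_nat_Suc)
    ultimately have "?J ?X \<in> TT k" by (simp only: scale_scale scale_one)
    from T_add[OF 1 this] show ?thesis by simp
  qed
  ultimately show ?thesis by (simp add: T_scale)
qed

lemma Pt_Nil: "Pt k [] = Poly_Mapping.single 0 (curv A ^ k)"
  by (induction k) (simp_all add: curv_path_def lift_def dsec_simps mult_single)

lemma cs_Nil: "cs k [] = 0"
  by (simp add: chern_simons_def lift_def pm_integral.zero)

lemma cs_single: "cs k [(e, x)] = scal A (1 / fact k) (p x * curv A ^ k)"
  by (simp add: chern_simons_def lift_def Pt_Nil mult_single pm_integral_single)

end

section \<open>Symmetric multilinear cochains\<close>

text \<open>
  Cochains that are multilinear, vanish if one argument lies in \<open>I\<close>, and are graded symmetric.  The first clause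
  comprises additivity, compatibility with scalars and the vanishing on \<open>I\<close>, so that these three can be carried
  through each construction together.
\<close>

definition sym_multi ::
    "('k \<Rightarrow> 'v \<Rightarrow> 'v) \<Rightarrow> (int \<Rightarrow> 'v::ab_group_add set) \<Rightarrow> 'v set \<Rightarrow> ('k \<Rightarrow> 'c \<Rightarrow> 'c) \<Rightarrow> ('v, 'c::ab_group_add) cochain \<Rightarrow> bool" where
  "sym_multi sv G I scl f \<longleftrightarrow>
     (\<forall>us vs e c x y z. list_all (good G) us \<longrightarrow> list_all (good G) vs \<longrightarrow>
        x \<in> G (e + 1) \<longrightarrow> y \<in> G (e + 1) \<longrightarrow> z \<in> G (e + 1) \<longrightarrow> z \<in> I \<longrightarrow>
        f (us @ (e, sv c x + y + z) # vs) = scl c (f (us @ (e, x) # vs)) + f (us @ (e, y) # vs)) \<and>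
     (\<forall>us vs a b. list_all (good G) us \<longrightarrow> list_all (good G) vs \<longrightarrow> good G a \<longrightarrow> good G b \<longrightarrow>
        f (us @ a # b # vs) = sg (fst a * fst b) (f (us @ b # a # vs)))"

lemma sym_multi_linear:
  assumes "sym_multi sv G I scl f" "list_all (good G) us" "list_all (good G) vs"
    "x \<in> G (e + 1)" "y \<in> G (e + 1)" "z \<in> G (e + 1)" "z \<in> I"
  shows "f (us @ (e, sv c x + y + z) # vs) = scl c (f (us @ (e, x) # vs)) + f (us @ (e, y) # vs)"
  by (rule conjunct1[OF assms(1)[unfolded sym_multi_def], rule_format, OF assms(2-)])

lemma sym_multi_swap:
  assumes "sym_multi sv G I scl f" "list_all (good G) us" "list_all (good G) vs" "good G a" "good G b"
  shows "f (us @ a # b # vs) = sg (fst a * fst b) (f (us @ b # a # vs))"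
  by (rule conjunct2[OF assms(1)[unfolded sym_multi_def], rule_format, OF assms(2-)])

lemma sym_multi_contr:
  assumes f: "sym_multi sv G I scl f" and a: "good G a"
  shows "sym_multi sv G I scl (contr a f)"
  unfolding sym_multi_def
proof (intro conjI allI impI)
  fix us vs e c x y z
  assume "list_all (good G) us" "list_all (good G) vs"
    "x \<in> G (e + 1)" "y \<in> G (e + 1)" "z \<in> G (e + 1)" "z \<in> I"
  then show "contr a f (us @ (e, sv c x + y + z) # vs)
      = scl c (contr a f (us @ (e, x) # vs)) + contr a f (us @ (e, y) # vs)"
    using sym_multi_linear[OF f, of "a # us" vs x e y z c] a by simp
next
  fix us vs b c
  assume "list_all (good G) us" "list_all (good G) vs" "good G b" "good G c"
  then show "contr a f (us @ b # c # vs) = sg (fst b * fst c) (contr a f (us @ c # b # vs))"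
    using sym_multi_swap[OF f, of "a # us" vs b c] a by simp
qed

lemma sym_multi_additive:
  assumes f: "sym_multi sv G I scl f" and h: "additive h" and hs: "\<And>c x. h (scl c x) = scl' c (h x)"
  shows "sym_multi sv G I scl' (\<lambda>w. h (f w))"
proof -
  interpret h: additive h by (rule h)
  have sg: "h (sg n x) = sg n (h x)" for n x by (simp add: sg_def h.minus)
  show ?thesis
    unfolding sym_multi_def
  proof (intro conjI allI impI)
    fix us vs e c x y z
    assume *: "list_all (good G) us" "list_all (good G) vs"
      "x \<in> G (e + 1)" "y \<in> G (e + 1)" "z \<in> G (e + 1)" "z \<in> I"
    show "h (f (us @ (e, sv c x + y + z) # vs)) = scl' c (h (f (us @ (e, x) # vs))) + h (f (us @ (e, y) # vs))"
      unfolding sym_multi_linear[OF f *] h.add hs ..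
  next
    fix us vs a b
    assume *: "list_all (good G) us" "list_all (good G) vs" "good G a" "good G b"
    show "h (f (us @ a # b # vs)) = sg (fst a * fst b) (h (f (us @ b # a # vs)))"
      unfolding sym_multi_swap[OF f *] sg ..
  qed
qed

lemma sym_multi_add:
  assumes "sym_multi sv G I scl f" "sym_multi sv G I scl g" "\<And>c x y. scl c (x + y) = scl c x + scl c y"
  shows "sym_multi sv G I scl (\<lambda>w. f w + g w)"
  unfolding sym_multi_def
proof (intro conjI allI impI)
  fix us vs e c x y z
  assume *: "list_all (good G) us" "list_all (good G) vs"
    "x \<in> G (e + 1)" "y \<in> G (e + 1)" "z \<in> G (e + 1)" "z \<in> I"
  show "f (us @ (e, sv c x + y + z) # vs) + g (us @ (e, sv c x + y + z) # vs)
      = scl c (f (us @ (e, x) # vs) + g (us @ (e, x) # vs)) + (f (us @ (e, y) # vs) + g (us @ (e, y) # vs))"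
    unfolding sym_multi_linear[OF assms(1) *] sym_multi_linear[OF assms(2) *] assms(3) by simp
next
  fix us vs a b
  assume *: "list_all (good G) us" "list_all (good G) vs" "good G a" "good G b"
  show "f (us @ a # b # vs) + g (us @ a # b # vs) = sg (fst a * fst b) (f (us @ b # a # vs) + g (us @ b # a # vs))"
    unfolding sym_multi_swap[OF assms(1) *] sym_multi_swap[OF assms(2) *] sg_add by simp
qed

lemma conv_scal:
  assumes "\<And>c x y. scl c (x + y) = scl c x + scl c y"
  shows "(\<And>c x y. scl c (x * y) = scl c x * y) \<Longrightarrow> conv q (\<lambda>w. scl c (f w)) g w = scl c (conv q f g w)"
    "(\<And>c x y. scl c (x * y) = x * scl c y) \<Longrightarrow> conv q f (\<lambda>w. scl c (g w)) w = scl c (conv q f g w)"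
proof -
  interpret h: additive "scl c" using assms by unfold_locales
  have sg: "scl c (sg n x) = sg n (scl c x)" for n x by (simp add: sg_def h.minus)
  show "(\<And>c x y. scl c (x * y) = scl c x * y) \<Longrightarrow> conv q (\<lambda>w. scl c (f w)) g w = scl c (conv q f g w)"
    by (induction w arbitrary: q f g) (simp_all add: assms sg)
  show "(\<And>c x y. scl c (x * y) = x * scl c y) \<Longrightarrow> conv q f (\<lambda>w. scl c (g w)) w = scl c (conv q f g w)"
    by (induction w arbitrary: q f g) (simp_all add: assms sg)
qed

text \<open>
  Both clauses are inherited along contractions, so the induction over the arguments \<open>us\<close> in front of the position
  in question reduces to the case in which that position comes first.
\<close>

lemma sym_multi_conv:
  assumes f: "sym_multi sv G I scl f" and g: "sym_multi sv G I scl g"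
    and add: "\<And>c x y. scl c (x + y) = scl c x + scl c y"
    and ml: "\<And>c x y. scl c (x * y) = scl c x * y" and mr: "\<And>c x y. scl c (x * y) = x * scl c y"
  shows "sym_multi sv G I scl (conv q f g)"
proof -
  have sg: "scl c (sg n x) = sg n (scl c x)" for n c x
  proof -
    interpret h: additive "scl c" using add by unfold_locales
    show ?thesis by (simp add: sg_def h.minus)
  qed
  have lin: "conv q f g (us @ (e, sv c x + y + z) # vs)
      = scl c (conv q f g (us @ (e, x) # vs)) + conv q f g (us @ (e, y) # vs)"
    if us: "list_all (good G) us" and vs: "list_all (good G) vs"
      and xyz: "x \<in> G (e + 1)" "y \<in> G (e + 1)" "z \<in> G (e + 1)" "z \<in> I"
    for us vs e c x y z
    using us f g
  proof (induction us arbitrary: q f g)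
    case Nil
    have 1: "conv q (contr (e, sv c x + y + z) f) g vs
        = conv q (\<lambda>w. scl c (contr (e, x) f w) + contr (e, y) f w) g vs"
      by (rule conv_cong[where ok = "good G"])
         (use sym_multi_linear[OF Nil(2), of "[]"] vs xyz in auto)
    have 2: "conv (q + e) f (contr (e, sv c x + y + z) g) vs
        = conv (q + e) f (\<lambda>w. scl c (contr (e, x) g w) + contr (e, y) g w) vs"
      by (rule conv_cong[where ok = "good G"])
         (use sym_multi_linear[OF Nil(3), of "[]"] vs xyz in auto)
    show ?case unfolding append_Nil conv.simps fst_conv 1 2
      by (simp add: conv_add_left conv_add_right conv_scal[of scl, OF add] ml mr add sg_add sg algebra_simps)
         (simp add: conv_scal(1)[of scl, OF add ml] conv_scal(2)[of scl, OF add mr] add sg_add sg algebra_simps flip: ml mr)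
  next
    case (Cons a us)
    have "sym_multi sv G I scl (contr a f)" "sym_multi sv G I scl (contr a g)"
      using Cons.prems by (auto intro: sym_multi_contr)
    then show ?case using Cons.IH Cons.prems by (simp add: add sg_add sg)
  qed
  have swap: "conv q f g (us @ a # b # vs) = sg (fst a * fst b) (conv q f g (us @ b # a # vs))"
    if us: "list_all (good G) us" and vs: "list_all (good G) vs" and ab: "good G a" "good G b" for us vs a b
    using us f g
  proof (induction us arbitrary: q f g)
    case Nil
    have 1: "conv q (contr b (contr a f)) g vs = conv q (\<lambda>w. sg (fst a * fst b) (contr a (contr b f) w)) g vs"
      by (rule conv_cong[where ok = "good G"])
         (use sym_multi_swap[OF Nil(2), of "[]" _ a b] vs ab in auto)
    have 2: "conv r f (contr b (contr a g)) vs = conv r f (\<lambda>w. sg (fst a * fst b) (contr a (contr b g) w)) vs" for r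
      by (rule conv_cong[where ok = "good G"])
         (use sym_multi_swap[OF Nil(3), of "[]" _ a b] vs ab in auto)
    have 3: "conv (q + fst a + fst b) f h vs = conv (q + fst b + fst a) f h vs" for h
      by (simp add: algebra_simps)
    show ?case unfolding append_Nil conv.simps 1 2 conv_sg_left conv_sg_right 3
      by (cases "even (fst a)"; cases "even (fst b)"; cases "even q") (simp_all add: sg_def)
  next
    case (Cons c us)
    have "sym_multi sv G I scl (contr c f)" "sym_multi sv G I scl (contr c g)"
      using Cons.prems by (auto intro: sym_multi_contr)
    then show ?case using Cons.IH Cons.prems by (simp add: sg_add sg_sg add.commute)
  qed
  show ?thesis
    unfolding sym_multi_def by (intro conjI allI impI; (rule lin swap; assumption))
qed

section \<open>Extension to inhomogeneous arguments\<close>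

text \<open>
  The extension of a cochain to lists of inhomogeneous elements by expanding each element into its components.
\<close>

fun mext :: "(int \<Rightarrow> 'a::comm_monoid_add set) \<Rightarrow> ('a, 'c::ab_group_add) cochain \<Rightarrow> 'a list \<Rightarrow> 'c" where
  "mext G f [] = f []"
| "mext G f (x # xs) = (\<Sum>i | hpart G x i \<noteq> 0. mext G (contr (i - 1, hpart G x i) f) xs)"

lemma mext_zero [simp]: "mext G (\<lambda>w. 0) xs = 0"
  by (induction xs) auto

lemma mext_add: "mext G (\<lambda>w. f w + g w) xs = mext G f xs + mext G g xs"
  by (induction xs arbitrary: f g) (auto simp: sum.distrib)

lemma mext_additive: "additive h \<Longrightarrow> mext G (\<lambda>w. h (f w)) xs = h (mext G f xs)"
  by (induction xs arbitrary: f) (auto simp: additive.sum)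

lemma additive_sg: "additive (sg n)"
  by unfold_locales (rule sg_add)

context graded_algebra begin

lemma mext_cong: "(\<And>w. list_all (good G) w \<Longrightarrow> f w = g w) \<Longrightarrow> mext G f xs = mext G g xs"
proof (induction xs arbitrary: f g)
  case (Cons x xs)
  have "mext G (contr (i - 1, hpart G x i) f) xs = mext G (contr (i - 1, hpart G x i) g) xs" for i
    by (rule Cons.IH, rule Cons.prems) (simp add: hpart_in)
  then show ?case by simp
qed simp

lemma sym_multi_kill:
  assumes f: "sym_multi sc G I scl f" and "0 \<in> I" and add: "\<And>c x y. scl c (x + y) = scl c x + scl c y"
    and one: "\<And>x. scl 1 x = x"
    and "list_all (good G) us" "list_all (good G) vs" "x \<in> G (e + 1)" "x \<in> I"
  shows "f (us @ (e, x) # vs) = 0"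
proof -
  have 0: "f (us @ (e, 0) # vs) = 0"
    using sym_multi_linear[OF f assms(5,6), of 0 e 0 0 1] assms(2) by (simp add: piece_zero one)
  show ?thesis
    using sym_multi_linear[OF f assms(5,6), of 0 e 0 x 1] assms by (simp add: piece_zero 0)
qed

context
  fixes I :: "'a set" and scl :: "'k \<Rightarrow> 'c::ab_group_add \<Rightarrow> 'c"
  assumes I0: "0 \<in> I" and I_hpart: "\<And>x i. x \<in> I \<Longrightarrow> hpart G x i \<in> I"
    and scl_add: "\<And>c x y. scl c (x + y) = scl c x + scl c y" and scl_one: "\<And>x. scl 1 x = x"
begin

lemma scl_additive: "additive (scl c)"
  by unfold_locales (rule scl_add)

lemma mext_contr_zero:
  assumes "sym_multi sc G I scl f" "x \<in> I" "x \<in> G (e + 1)"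
  shows "mext G (contr (e, x) f) xs = 0"
proof -
  have "mext G (contr (e, x) f) xs = mext G (\<lambda>w. 0) xs"
    using sym_multi_kill[OF assms(1) I0 scl_add scl_one, of "[]"] assms(2,3)
    by (intro mext_cong) auto
  then show ?thesis by simp
qed

text \<open>
  A cochain vanishes on zero components, so the sum may run over any finite set that contains their degrees; this
  permits a comparison of the expansions of different elements.
\<close>

lemma mext_superset:
  assumes f: "sym_multi sc G I scl f" and "finite S" "{i. hpart G x i \<noteq> 0} \<subseteq> S"
  shows "mext G f (x # xs) = (\<Sum>i\<in>S. mext G (contr (i - 1, hpart G x i) f) xs)"
  unfolding mext.simps
proof (rule sum.mono_neutral_left)
  show "\<forall>i\<in>S - {i. hpart G x i \<noteq> 0}. mext G (contr (i - 1, hpart G x i) f) xs = 0"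
    using mext_contr_zero[OF f I0 piece_zero] by simp
qed (use assms in auto)

lemma mext_homogeneous_Cons:
  assumes "sym_multi sc G I scl f" and "x \<in> G i"
  shows "mext G f (x # xs) = mext G (contr (i - 1, x) f) xs"
proof -
  have "mext G f (x # xs) = (\<Sum>j\<in>{i}. mext G (contr (j - 1, hpart G x j) f) xs)"
    by (rule mext_superset[OF assms(1)]) (auto simp: hpart_homogeneous[OF assms(2)])
  also have "\<dots> = mext G (contr (i - 1, x) f) xs"
    by (simp add: hpart_homogeneous[OF assms(2)])
  finally show ?thesis .
qed

lemma mext_linear:
  assumes "sym_multi sc G I scl f"
  shows "mext G f (us @ (sc c x + y) # vs) = scl c (mext G f (us @ x # vs)) + mext G f (us @ y # vs)"
  using assms
proof (induction us arbitrary: f)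
  case Nil
  let ?S = "{i. hpart G x i \<noteq> 0} \<union> {i. hpart G y i \<noteq> 0}"
  have 1: "mext G (contr (i - 1, hpart G (sc c x + y) i) f) vs
      = scl c (mext G (contr (i - 1, hpart G x i) f) vs) + mext G (contr (i - 1, hpart G y i) f) vs" for i
  proof -
    have "mext G (contr (i - 1, hpart G (sc c x + y) i) f) vs
      = mext G (\<lambda>w. scl c (contr (i - 1, hpart G x i) f w) + contr (i - 1, hpart G y i) f w) vs"
      using sym_multi_linear[OF Nil, of "[]" _ "hpart G x i" "i - 1" "hpart G y i" 0 c] I0
      by (intro mext_cong) (simp add: hpart_add hpart_scale hpart_in piece_zero)
    then show ?thesis by (simp add: mext_add mext_additive[OF scl_additive])
  qed
  have fin: "finite ?S" by (simp add: finite_hpart)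
  have sub: "{i. hpart G (sc c x + y) i \<noteq> 0} \<subseteq> ?S" by (auto simp: hpart_add hpart_scale)
  show ?case unfolding append_Nil
    by (subst (1 2 3) mext_superset[OF Nil fin])
       (use sub in \<open>auto simp: 1 sum.distrib additive.sum[OF scl_additive]\<close>)
next
  case (Cons a us)
  have "sym_multi sc G I scl (contr (i - 1, hpart G a i) f)" for i
    using Cons.prems by (rule sym_multi_contr) (simp add: hpart_in)
  then show ?case by (simp add: Cons.IH sum.distrib additive.sum[OF scl_additive])
qed

lemma mext_kill:
  assumes "sym_multi sc G I scl f" "x \<in> I"
  shows "mext G f (us @ x # vs) = 0"
  using assms(1)
proof (induction us arbitrary: f)
  case Nil
  have "mext G (contr (i - 1, hpart G x i) f) vs = 0" for i
    by (rule mext_contr_zero[OF Nil]) (simp_all add: I_hpart assms(2) hpart_in)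
  then show ?case by simp
next
  case (Cons a us)
  have "sym_multi sc G I scl (contr (i - 1, hpart G a i) f)" for i
    using Cons.prems by (rule sym_multi_contr) (simp add: hpart_in)
  then show ?case by (simp add: Cons.IH)
qed

lemma mext_swap:
  assumes "sym_multi sc G I scl f" "x \<in> G i" "y \<in> G j"
  shows "mext G f (us @ x # y # vs) = sg ((i - 1) * (j - 1)) (mext G f (us @ y # x # vs))"
  using assms(1)
proof (induction us arbitrary: f)
  case Nil
  have x: "good G (i - 1, x)" and y: "good G (j - 1, y)" using assms by auto
  have "mext G f (x # y # vs) = mext G (contr (j - 1, y) (contr (i - 1, x) f)) vs"
    by (simp only: mext_homogeneous_Cons[OF Nil assms(2)] mext_homogeneous_Cons[OF sym_multi_contr[OF Nil x] assms(3)])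
  also have "\<dots> = mext G (\<lambda>w. sg ((i - 1) * (j - 1)) (contr (i - 1, x) (contr (j - 1, y) f) w)) vs"
    using sym_multi_swap[OF Nil, of "[]" _ "(i - 1, x)" "(j - 1, y)"] x y by (intro mext_cong) auto
  also have "\<dots> = sg ((i - 1) * (j - 1)) (mext G (contr (i - 1, x) (contr (j - 1, y) f)) vs)"
    by (rule mext_additive[OF additive_sg])
  also have "mext G (contr (i - 1, x) (contr (j - 1, y) f)) vs = mext G f (y # x # vs)"
    by (simp only: mext_homogeneous_Cons[OF Nil assms(3)] mext_homogeneous_Cons[OF sym_multi_contr[OF Nil y] assms(2)])
  finally show ?case by (simp only: append_Nil)
next
  case (Cons a us)
  have "sym_multi sc G I scl (contr (i - 1, hpart G a i) f)" for i
    using Cons.prems by (rule sym_multi_contr) (simp add: hpart_in)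
  then show ?case by (simp add: Cons.IH sg_sum)
qed

end

end

context curved_projection begin

abbreviation "smA \<equiv> sym_multi (scal A) (piece A) I (scal A)"
abbreviation "smP \<equiv> sym_multi (scal A) (piece A) I pscal"

lemma sm_unit: "(\<And>c. scl c 0 = 0) \<Longrightarrow> sym_multi (scal A) (piece A) I scl (unit_co u)"
  by (auto simp: sym_multi_def unit_co_def)

lemma sec_vanish: "length w \<noteq> 1 \<Longrightarrow> sec_co p w = 0"
  by (auto simp: sec_co_def split: list.split)

lemma sm_sec: "smA (sec_co p)"
  unfolding sym_multi_def
proof (intro conjI allI impI)
  fix us vs e c x y z
  assume z: "z \<in> I"
  show "sec_co p (us @ (e, scal A c x + y + z) # vs)
      = scal A c (sec_co p (us @ (e, x) # vs)) + sec_co p (us @ (e, y) # vs)"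
  proof (cases "us = [] \<and> vs = []")
    case True
    then show ?thesis using z by (simp add: p_add p_scale p_kill)
  next
    case False
    then show ?thesis by (simp add: sec_vanish)
  qed
qed (simp add: sec_vanish)

lemma dsec_vanish: "length w \<ge> 3 \<Longrightarrow> dsec_co A p w = 0"
  by (cases w; cases "tl w"; cases "tl (tl w)") (auto simp: dsec_simps)

lemma sm_dsec: "smA (dsec_co A p)"
  unfolding sym_multi_def
proof (intro conjI allI impI)
  fix us vs e c x y z
  assume g: "list_all ok us" "list_all ok vs" and z: "z \<in> I"
  have pz: "p (der A z) = 0" "p (br z b) = 0" "p (br b z) = 0" for b
    using z by (auto intro: p_kill ideal_der ideal_br ideal_br_left)
  consider "us = []" "vs = []" | b where "us = []" "vs = [b]" | b where "us = [b]" "vs = []"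
    | "length us + length vs \<ge> 2"
    by (cases us; cases "tl us"; cases vs; cases "tl vs") auto
  then show "dsec_co A p (us @ (e, scal A c x + y + z) # vs)
      = scal A c (dsec_co A p (us @ (e, x) # vs)) + dsec_co A p (us @ (e, y) # vs)"
  proof cases
    case 1
    then show ?thesis
      using z pz by (simp add: dsec_simps p_add p_scale p_kill der_add der_scale algebra_simps scale_right_diff_distrib d.zero)
  next
    case 2
    then show ?thesis
      using pz by (simp add: dsec_simps p_add p_scale gcomm_add_left gcomm_scale_left sg_def scale_minus_right)
  next
    case 3
    then show ?thesis
      using pz by (simp add: dsec_simps p_add p_scale gcomm_add_right gcomm_scale_right sg_def scale_minus_right)
  qed (simp add: dsec_vanish)
next
  fix us vs a b
  assume ab: "ok a" "ok b"
  show "dsec_co A p (us @ a # b # vs) = sg (fst a * fst b) (dsec_co A p (us @ b # a # vs))"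
  proof (cases "us = [] \<and> vs = []")
    case True
    have "br (snd b) (snd a) = - sg ((fst a + 1) * (fst b + 1)) (br (snd a) (snd b))"
      using ab by (intro gcomm_swap) (auto simp: good_def)
    then show ?thesis using True
      by (simp add: dsec_simps) (simp add: sg_def p.minus)
  next
    case False
    then have "length us + length vs \<ge> 1" by (cases us; cases vs) auto
    then show ?thesis by (simp add: dsec_vanish)
  qed
qed

lemma pscal_add: "pscal c (x + y) = pscal c x + pscal c y"
  unfolding pscal_def by (rule mapp_add) (rule scale_right_distrib)

lemma pscal_single: "pscal c (Poly_Mapping.single m a) = Poly_Mapping.single m (scal A c a)"
  by (simp add: pscal_def mapp_single)

lemma pscal_mult: "pscal c (x * y) = pscal c x * y" "pscal c (x * y) = x * pscal c y"
  by (rule pm_biadditive_eqI[where B = "\<lambda>x y. pscal c (x * y)"];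
      simp add: pscal_add algebra_simps mult_single pscal_single scale_mult_left scale_mult_right)
     (rule pm_biadditive_eqI[where B = "\<lambda>x y. pscal c (x * y)"];
      simp add: pscal_add algebra_simps mult_single pscal_single flip: scale_mult_right)

lemma sm_lift: "smA f \<Longrightarrow> smP (lift m f)"
  unfolding lift_def
  by (rule sym_multi_additive) (auto simp: pscal_single single_add intro: additive.intro)

lemma sm_Rt: "smP Rt"
  unfolding curv_path_def
  by (intro sym_multi_add sm_lift sm_unit sm_dsec sym_multi_conv sm_sec)
     (rule pscal_add scale_right_distrib scale_mult_left scale_mult_right scale_zero_right)+

lemma pscal_zero: "pscal c 0 = 0"
  using pscal_add[of c 0 0] by simp

lemma sm_Pt: "smP (Pt k)"
  by (induction k) (auto intro: sm_unit pscal_zero sym_multi_conv sm_Rt pscal_add pscal_mult)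

lemma sm_cs: "smA (cs k)"
  unfolding chern_simons_def
proof (rule sym_multi_additive[where h = "\<lambda>x. scal A (1 / fact k) (pm_integral A x)"])
  show "smP (conv 0 ts (Pt k))"
    by (intro sym_multi_conv sm_lift sm_sec sm_Pt pscal_add pscal_mult)
  show "additive (\<lambda>x. scal A (1 / fact k) (pm_integral A x))"
    by unfold_locales (simp add: pm_integral_add scale_right_distrib)
qed (simp add: pm_integral_pscal mult.commute)

end

section \<open>The codifferential as a sum over unshuffles\<close>

lemma list_all_nths: "list_all P w \<Longrightarrow> list_all P (nths w X)"
  using set_nths_subset[of w X] by (auto simp: list_all_iff)

lemma nths_as_map: "nths xs X = map ((!) xs) (filter (\<lambda>m. m \<in> X) [0..<length xs])"
proof (induction xs rule: rev_induct)
  case (snoc x xs)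
  have "map ((!) (xs @ [x])) (filter (\<lambda>m. m \<in> X) [0..<length xs])
      = map ((!) xs) (filter (\<lambda>m. m \<in> X) [0..<length xs])"
    by (auto simp: nth_append)
  then show ?case using snoc by (auto simp: nths_append nth_append)
qed simp

lemma nths_Cons_Compl_0: "nths (a # w) (- {0}) = w"
  by (simp add: nths_Cons nths_all)

lemma nths_Cons_Compl_Suc: "nths (a # w) (- {Suc j}) = a # nths w (- {j})"
proof -
  have "{m. Suc m \<in> - {Suc j}} = - {j}" by auto
  then show ?thesis by (simp add: nths_Cons)
qed

lemma nths_Cons_Compl_0_Suc: "nths (a # w) (- {0, Suc j}) = nths w (- {j})"
proof -
  have "{m. Suc m \<in> - {0, Suc j}} = - {j}" by auto
  then show ?thesis by (simp add: nths_Cons)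
qed

lemma nths_Cons_Compl_Suc_Suc: "nths (a # w) (- {Suc i, Suc j}) = a # nths w (- {i, j})"
proof -
  have "{m. Suc m \<in> - {Suc i, Suc j}} = - {i, j}" by auto
  then show ?thesis by (simp add: nths_Cons)
qed

text \<open>
  The bracket of two arguments, which has degree one on \<open>L[1]\<close>.
\<close>

definition brp :: "('v \<Rightarrow> 'v \<Rightarrow> 'v) \<Rightarrow> int \<times> 'v \<Rightarrow> int \<times> 'v \<Rightarrow> int \<times> 'v" where
  "brp br a b = (fst a + fst b + 1, br (snd a) (snd b))"

context
  fixes sv :: "'k \<Rightarrow> 'v::ab_group_add \<Rightarrow> 'v" and G :: "int \<Rightarrow> 'v::ab_group_add set" and I :: "'v set"
    and scl :: "'k \<Rightarrow> 'c::ring \<Rightarrow> 'c" and dv :: "'v \<Rightarrow> 'v" and br :: "'v \<Rightarrow> 'v \<Rightarrow> 'v"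
  assumes br_good: "\<And>x y i j. x \<in> G i \<Longrightarrow> y \<in> G j \<Longrightarrow> br x y \<in> G (i + j)"
begin

lemma good_brp: "good G a \<Longrightarrow> good G b \<Longrightarrow> good G (brp br a b)"
  using br_good[of "snd a" "fst a + 1" "snd b" "fst b + 1"]
  by (simp add: good_def brp_def algebra_simps)

text \<open>
  For a symmetric cochain the bracket with the \<open>j\<close>-th argument can be moved to the front.  The sign for passing the
  arguments before it combines with the signs of the recursion to the Koszul sign for moving the \<open>j\<close>-th argument
  itself to the front.
\<close>

lemma lie_sum:
  assumes "sym_multi sv G I scl f" "good G a" "list_all (good G) w"
  shows "lie br a f w = (\<Sum>j<length w. sg (fst a + 1 + fst (w ! j) * (\<Sum>m<j. fst (w ! m)))
    (f (brp br a (w ! j) # nths w (- {j}))))"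
  using assms
proof (induction w arbitrary: f)
  case (Cons b w)
  have 1: "f (b # brp br a (w ! j) # nths w (- {j}))
      = sg (fst b * (fst a + fst (w ! j) + 1)) (f (brp br a (w ! j) # b # nths w (- {j})))" if "j < length w" for j
  proof -
    have "good G (w ! j)" using Cons.prems(3) that by (auto simp: list_all_iff)
    then have "good G (brp br a (w ! j))" using Cons.prems(2) good_brp by blast
    then show ?thesis
      using sym_multi_swap[OF Cons.prems(1), of "[]" "nths w (- {j})" b "brp br a (w ! j)"] Cons.prems
      by (simp add: list_all_nths brp_def)
  qed
  have "lie br a f (b # w) = sg (fst a + 1) (f (brp br a b # w))
    + sg ((fst a + 1) * fst b) (\<Sum>j<length w. sg (fst a + 1 + fst (w ! j) * (\<Sum>m<j. fst (w ! m)))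
      (f (b # brp br a (w ! j) # nths w (- {j}))))"
    using Cons.IH[OF sym_multi_contr[OF Cons.prems(1), of b]] Cons.prems by (simp add: brp_def)
  also have "\<dots> = sg (fst a + 1) (f (brp br a b # w))
    + (\<Sum>j<length w. sg ((fst a + 1) * fst b + (fst a + 1 + fst (w ! j) * (\<Sum>m<j. fst (w ! m)))
         + fst b * (fst a + fst (w ! j) + 1))
      (f (brp br a (w ! j) # b # nths w (- {j}))))"
    unfolding sg_sum by (intro arg_cong2[of _ _ _ _ "(+)"] sum.cong refl) (simp add: 1 sg_sg add.assoc)
  also have "(\<Sum>j<length w. sg ((fst a + 1) * fst b + (fst a + 1 + fst (w ! j) * (\<Sum>m<j. fst (w ! m)))
         + fst b * (fst a + fst (w ! j) + 1)) (f (brp br a (w ! j) # b # nths w (- {j}))))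
    = (\<Sum>j<length w. sg (fst a + 1 + fst (w ! j) * (fst b + (\<Sum>m<j. fst (w ! m))))
      (f (brp br a (w ! j) # b # nths w (- {j}))))"
    by (intro sum.cong refl sg_cong) (auto simp: algebra_simps)
  finally show ?case
    by (simp add: sum.lessThan_Suc_shift nths_Cons_Compl_0 nths_Cons_Compl_Suc del: sum.lessThan_Suc)
qed simp

text \<open>
  The exponent of the Koszul sign for moving the arguments at the positions \<open>i < j\<close> to the front.
\<close>

definition pair_sign :: "(int \<times> 'v) list \<Rightarrow> nat \<Rightarrow> nat \<Rightarrow> int" where
  "pair_sign w i j = fst (w ! i) * (\<Sum>m<i. fst (w ! m)) + fst (w ! j) * ((\<Sum>m<j. fst (w ! m)) - fst (w ! i))"

text \<open>
  The explicit form of \<open>f Q\<close>.  In the induction, pairs that contain the first position come from \<open>ad_a\<close>, the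
  others from the contracted cochain; in the latter the bracket is exchanged with \<open>a\<close>.
\<close>

lemma coder_sum:
  assumes "sym_multi sv G I scl f" "list_all (good G) w"
  shows "coder dv br f w =
    (\<Sum>i<length w. - sg (\<Sum>m<i. fst (w ! m)) (f (w[i := (fst (w ! i) + 1, dv (snd (w ! i)))])))
    + (\<Sum>j<length w. \<Sum>i<j. sg (fst (w ! i) + 1 + pair_sign w i j) (f (brp br (w ! i) (w ! j) # nths w (- {i, j}))))"
  using assms
proof (induction w arbitrary: f)
  case (Cons a w)
  have f: "sym_multi sv G I scl (contr a f)"
    using Cons.prems by (intro sym_multi_contr) auto
  have g: "list_all (good G) w" "good G a" using Cons.prems by auto
  have 1: "f (a # brp br (w ! i) (w ! j) # nths w (- {i, j}))
      = sg (fst a * (fst (w ! i) + fst (w ! j) + 1)) (f (brp br (w ! i) (w ! j) # a # nths w (- {i, j})))"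
    if "i < j" "j < length w" for i j
  proof -
    have "good G (w ! i)" "good G (w ! j)" using g(1) that by (simp_all add: list_all_length)
    then have "good G (brp br (w ! i) (w ! j))" using good_brp by blast
    then show ?thesis
      using sym_multi_swap[OF Cons.prems(1), of "[]" "nths w (- {i, j})" a "brp br (w ! i) (w ! j)"] g
      by (simp add: list_all_nths brp_def)
  qed
  have "sg (fst a) (coder dv br (contr a f) w)
    = sg (fst a) (\<Sum>i<length w. - sg (\<Sum>m<i. fst (w ! m)) (f (a # w[i := (fst (w ! i) + 1, dv (snd (w ! i)))])))
    + sg (fst a) (\<Sum>j<length w. \<Sum>i<j. sg (fst (w ! i) + 1 + pair_sign w i j)
        (f (a # brp br (w ! i) (w ! j) # nths w (- {i, j}))))"
    unfolding Cons.IH[OF f g(1)] sg_add ..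
  also have "sg (fst a) (\<Sum>i<length w. - sg (\<Sum>m<i. fst (w ! m)) (f (a # w[i := (fst (w ! i) + 1, dv (snd (w ! i)))])))
    = (\<Sum>i<length w. - sg (fst a + (\<Sum>m<i. fst (w ! m))) (f (a # w[i := (fst (w ! i) + 1, dv (snd (w ! i)))])))"
    by (simp add: sg_sum sg_uminus sg_sg)
  also have "sg (fst a) (\<Sum>j<length w. \<Sum>i<j. sg (fst (w ! i) + 1 + pair_sign w i j)
        (f (a # brp br (w ! i) (w ! j) # nths w (- {i, j}))))
    = (\<Sum>j<length w. \<Sum>i<j. sg (fst (w ! i) + 1 + pair_sign (a # w) (Suc i) (Suc j))
        (f (brp br (w ! i) (w ! j) # a # nths w (- {i, j}))))"
    unfolding sg_sum
  proof (intro sum.cong refl)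
    fix j i assume "j \<in> {..<length w}" "i \<in> {..<j}"
    then have "sg (fst a) (sg (fst (w ! i) + 1 + pair_sign w i j) (f (a # brp br (w ! i) (w ! j) # nths w (- {i, j}))))
      = sg (fst a + (fst (w ! i) + 1 + pair_sign w i j) + fst a * (fst (w ! i) + fst (w ! j) + 1))
          (f (brp br (w ! i) (w ! j) # a # nths w (- {i, j})))"
      by (simp add: 1 sg_sg add.assoc)
    also have "\<dots> = sg (fst (w ! i) + 1 + pair_sign (a # w) (Suc i) (Suc j))
          (f (brp br (w ! i) (w ! j) # a # nths w (- {i, j})))"
      by (rule sg_cong) (simp add: pair_sign_def sum.lessThan_Suc_shift algebra_simps del: sum.lessThan_Suc)
    finally show "sg (fst a) (sg (fst (w ! i) + 1 + pair_sign w i j) (f (a # brp br (w ! i) (w ! j) # nths w (- {i, j}))))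
      = sg (fst (w ! i) + 1 + pair_sign (a # w) (Suc i) (Suc j))
          (f (brp br (w ! i) (w ! j) # a # nths w (- {i, j})))" .
  qed
  finally have 2: "sg (fst a) (coder dv br (contr a f) w) =
    (\<Sum>i<length w. - sg (fst a + (\<Sum>m<i. fst (w ! m))) (f (a # w[i := (fst (w ! i) + 1, dv (snd (w ! i)))])))
    + (\<Sum>j<length w. \<Sum>i<j. sg (fst (w ! i) + 1 + pair_sign (a # w) (Suc i) (Suc j))
        (f (brp br (w ! i) (w ! j) # a # nths w (- {i, j}))))" .
  have 3: "lie br a f w = (\<Sum>j<length w. sg (fst a + 1 + pair_sign (a # w) 0 (Suc j))
    (f (brp br a (w ! j) # nths w (- {j}))))"
    unfolding lie_sum[OF Cons.prems(1) g(2,1)]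
    by (simp add: pair_sign_def sum.lessThan_Suc_shift del: sum.lessThan_Suc)
  show ?case
    unfolding coder.simps 2 3
    by (simp add: sum.lessThan_Suc_shift nths_Cons_Compl_0_Suc nths_Cons_Compl_Suc_Suc sum.distrib del: sum.lessThan_Suc)
qed simp

end

lemma ksign_add: "ksign (m + n) = (ksign m * ksign n :: 'k::comm_ring_1)"
  by (simp add: ksign_def)

lemma prod_ksign: "(\<Prod>m\<in>S. ksign (c * e m)) = (ksign (c * (\<Sum>m\<in>S. e m)) :: 'k::comm_ring_1)"
proof (induction S rule: infinite_finite_induct)
  case (insert x S)
  then show ?case by (simp add: distrib_left ksign_add)
qed (simp_all add: ksign_def)

lemma unshuffle_facts:
  assumes "\<tau> \<in> unshuffles2 n"
  shows "\<tau> 0 < \<tau> 1" "\<tau> 1 < n" "\<tau> ` {2..<n} = {..<n} - {\<tau> 0, \<tau> 1}" "2 \<le> n" "inj \<tau>"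
proof -
  have p: "\<tau> permutes {..<n}" and n: "2 \<le> n" and lt: "\<tau> 0 < \<tau> 1"
    using assms by (auto simp: unshuffles2_def)
  show "\<tau> 0 < \<tau> 1" "2 \<le> n" by fact+
  show inj: "inj \<tau>" using p by (rule permutes_inj)
  show "\<tau> 1 < n" using permutes_in_image[OF p, of 1] n by simp
  have "{..<n} = {0, 1} \<union> {2..<n}" using n by auto
  then have "{..<n} = {\<tau> 0, \<tau> 1} \<union> \<tau> ` {2..<n}" using permutes_image[OF p] by (metis image_Un image_empty image_insert)
  moreover have "\<tau> 0 \<notin> \<tau> ` {2..<n}" "\<tau> 1 \<notin> \<tau> ` {2..<n}"
    using inj by (auto simp: inj_image_mem_iff)
  ultimately show "\<tau> ` {2..<n} = {..<n} - {\<tau> 0, \<tau> 1}" by auto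
qed

text \<open>
  An unshuffle is determined by the two positions that it moves to the front, because it enumerates the others in
  increasing order.
\<close>

lemma unshuffle_rest:
  assumes "\<tau> \<in> unshuffles2 n"
  shows "map \<tau> [2..<n] = filter (\<lambda>m. m \<in> - {\<tau> 0, \<tau> 1}) [0..<n]"
proof -
  have "strict_mono_on {2..<n} \<tau>" using assms by (simp add: unshuffles2_def)
  then have 1: "sorted_wrt (<) (map \<tau> [2..<n])"
    unfolding sorted_wrt_map
    by (intro sorted_wrt_mono_rel[OF _ sorted_wrt_upt]) (auto simp: strict_mono_on_def)
  have 2: "sorted_wrt (<) (filter (\<lambda>m. m \<in> - {\<tau> 0, \<tau> 1}) [0..<n])"
    by (intro sorted_wrt_filter sorted_wrt_upt)
  have 3: "set (map \<tau> [2..<n]) = set (filter (\<lambda>m. m \<in> - {\<tau> 0, \<tau> 1}) [0..<n])"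
    using unshuffle_facts(3)[OF assms] by auto
  show ?thesis using strict_sorted_equal[OF 1 2] 3 by metis
qed

lemma unshuffle_nths:
  assumes "\<tau> \<in> unshuffles2 (length xs)"
  shows "map (\<lambda>m. xs ! \<tau> m) [2..<length xs] = nths xs (- {\<tau> 0, \<tau> 1})"
  unfolding nths_as_map unshuffle_rest[OF assms, symmetric] by simp

lemma unshuffles2_bij:
  "bij_betw (\<lambda>\<tau>. (\<tau> 1, \<tau> 0)) (unshuffles2 n) (SIGMA j:{..<n}. {..<j})"
proof (rule bij_betw_imageI)
  show "inj_on (\<lambda>\<tau>. (\<tau> 1, \<tau> 0)) (unshuffles2 n)"
  proof (rule inj_onI, rule ext)
    fix \<tau> \<tau>' :: "nat \<Rightarrow> nat" and m
    assume *: "\<tau> \<in> unshuffles2 n" "\<tau>' \<in> unshuffles2 n" "(\<tau> 1, \<tau> 0) = (\<tau>' 1, \<tau>' 0)"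
    then have "map \<tau> [2..<n] = map \<tau>' [2..<n]" by (simp only: unshuffle_rest) simp
    then have "\<tau> m = \<tau>' m" if "2 \<le> m" "m < n" using that by simp
    moreover have "\<tau> m = \<tau>' m" if "\<not> m < n"
      using *(1,2) that by (simp add: unshuffles2_def permutes_def)
    moreover have "m = 0 \<or> m = 1 \<or> 2 \<le> m" by auto
    ultimately show "\<tau> m = \<tau>' m" using *(3) by auto
  qed
  show "(\<lambda>\<tau>. (\<tau> 1, \<tau> 0)) ` unshuffles2 n = (SIGMA j:{..<n}. {..<j})"
  proof (intro equalityI subsetI)
    fix x assume "x \<in> (SIGMA j:{..<n}. {..<j})"
    then obtain i j where x: "x = (j, i)" and ij: "i < j" "j < n" by auto
    define l where "l = filter (\<lambda>m. m \<in> - {i, j}) [0..<n]"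
    have set_l: "set l = {..<n} - {i, j}" and dist: "distinct l" by (auto simp: l_def)
    have len: "length l = n - 2"
      using distinct_card[OF dist] set_l ij by (simp add: card_Diff_subset)
    define \<tau> where "\<tau> m = (if m = 0 then i else if m = 1 then j else if m < n then l ! (m - 2) else m)" for m
    have n: "{..<n} = {0, 1} \<union> {2..<n}" using ij by auto
    have "\<tau> ` {2..<n} = (!) l ` {..<length l}"
    proof (intro equalityI subsetI)
      fix y assume "y \<in> \<tau> ` {2..<n}"
      then show "y \<in> (!) l ` {..<length l}" by (force simp: \<tau>_def len)
    next
      fix y assume "y \<in> (!) l ` {..<length l}"
      then obtain m where "m < n - 2" "y = l ! m" by (auto simp: len)
      then have "y = \<tau> (m + 2)" "m + 2 \<in> {2..<n}" by (auto simp: \<tau>_def)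
      then show "y \<in> \<tau> ` {2..<n}" by blast
    qed
    then have im2: "\<tau> ` {2..<n} = {..<n} - {i, j}"
      using set_l by (auto simp: set_conv_nth)
    have "\<tau> ` ({0, 1} \<union> {2..<n}) = {i, j} \<union> ({..<n} - {i, j})"
      unfolding image_Un im2 by (auto simp: \<tau>_def)
    moreover have "{i, j} \<union> ({..<n} - {i, j}) = {..<n}" using ij by auto
    ultimately have im: "\<tau> ` {..<n} = {..<n}" using n by metis
    then have "inj_on \<tau> {..<n}" by (intro eq_card_imp_inj_on) auto
    then have perm: "\<tau> permutes {..<n}"
      using im ij by (intro bij_imp_permutes bij_betw_imageI) (auto simp: \<tau>_def)
    have "sorted_wrt (<) l" unfolding l_def by (intro sorted_wrt_filter sorted_wrt_upt)
    then have "strict_mono_on {2..<n} \<tau>"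
      by (auto simp: strict_mono_on_def \<tau>_def len sorted_wrt_iff_nth_less)
    then have "\<tau> \<in> unshuffles2 n" using perm ij by (simp add: unshuffles2_def \<tau>_def)
    moreover have "x = (\<tau> 1, \<tau> 0)" by (simp add: x \<tau>_def)
    ultimately show "x \<in> (\<lambda>\<tau>. (\<tau> 1, \<tau> 0)) ` unshuffles2 n" by blast
  qed (auto dest: unshuffle_facts(1,2))
qed

text \<open>
  The inversions of an unshuffle are the pairs formed by one of the first two places and a later place with a smaller
  value.
\<close>

lemma koszul_sign_unshuffle:
  assumes \<tau>: "\<tau> \<in> unshuffles2 (length es)"
  shows "koszul_sign es \<tau> = (ksign (es ! \<tau> 0 * (\<Sum>m<\<tau> 0. es ! m)
    + es ! \<tau> 1 * ((\<Sum>m<\<tau> 1. es ! m) - es ! \<tau> 0)) :: 'k::field)"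
proof -
  note facts = unshuffle_facts[OF \<tau>]
  let ?n = "length es"
  have mono: "\<tau> p < \<tau> q" if "2 \<le> p" "p < q" "q < ?n" for p q
    using \<tau> that by (auto simp: unshuffles2_def strict_mono_on_def)
  define X where "X = (\<lambda>i. {q \<in> {2..<?n}. \<tau> q < i})"
  have fin: "finite (X i)" for i by (simp add: X_def)
  have eq: "{(p, q). p < q \<and> q < ?n \<and> \<tau> q < \<tau> p} = Pair 0 ` X (\<tau> 0) \<union> Pair 1 ` X (\<tau> 1)"
  proof (intro equalityI subsetI)
    fix z assume "z \<in> {(p, q). p < q \<and> q < ?n \<and> \<tau> q < \<tau> p}"
    then obtain p q where z: "z = (p, q)" "p < q" "q < ?n" "\<tau> q < \<tau> p" by auto
    consider "p = 0" | "p = 1" | "2 \<le> p" by linarith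
    then show "z \<in> Pair 0 ` X (\<tau> 0) \<union> Pair 1 ` X (\<tau> 1)"
    proof cases
      case 1
      then have "q \<noteq> 1" using z facts(1) by auto
      then show ?thesis using z 1 by (auto simp: X_def)
    next
      case 2
      then show ?thesis using z by (auto simp: X_def)
    next
      case 3
      then show ?thesis using mono[of p q] z by auto
    qed
  qed (auto simp: X_def)
  have im: "\<tau> ` X i = {..<i} - {\<tau> 0, \<tau> 1}" if "i < ?n" for i
  proof -
    have "\<tau> ` X i = \<tau> ` {2..<?n} \<inter> {..<i}" by (auto simp: X_def)
    also have "\<dots> = {..<i} - {\<tau> 0, \<tau> 1}" unfolding facts(3) using that by auto
    finally show ?thesis .
  qed
  have inj: "inj_on \<tau> S" for S using facts(5) by (rule inj_on_subset) simp
  have sum: "(\<Prod>q\<in>X i. ksign (c * es ! \<tau> q)) = (ksign (c * (\<Sum>m\<in>{..<i} - {\<tau> 0, \<tau> 1}. es ! m)) :: 'k)"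
    if "i < ?n" for i c
    unfolding prod_ksign im[OF that, symmetric] by (simp add: sum.reindex inj)
  have "{..<\<tau> 0} - {\<tau> 0, \<tau> 1} = {..<\<tau> 0}" "{..<\<tau> 1} - {\<tau> 0, \<tau> 1} = {..<\<tau> 1} - {\<tau> 0}"
    using facts(1) by auto
  moreover have "(\<Sum>m\<in>{..<\<tau> 1} - {\<tau> 0}. es ! m) = (\<Sum>m<\<tau> 1. es ! m) - es ! \<tau> 0"
    using facts(1) by (simp add: sum_diff1)
  moreover have "(\<Prod>(p, q)\<in>Pair 0 ` X (\<tau> 0) \<union> Pair 1 ` X (\<tau> 1). ksign (es ! \<tau> p * es ! \<tau> q) :: 'k)
    = (\<Prod>q\<in>X (\<tau> 0). ksign (es ! \<tau> 0 * es ! \<tau> q)) * (\<Prod>q\<in>X (\<tau> 1). ksign (es ! \<tau> 1 * es ! \<tau> q))"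
    using fin by (subst prod.union_disjoint) (auto simp: prod.reindex inj_on_def)
  ultimately show ?thesis
    unfolding koszul_sign_def eq using sum[of "\<tau> 0"] sum[of "\<tau> 1"] facts(1,2) by (simp add: ksign_add)
qed

section \<open>Cosets\<close>

context vector_space begin

lemma coset_eq_iff: "subspace N \<Longrightarrow> x +o N = y +o N \<longleftrightarrow> x - y \<in> N"
proof
  assume N: "subspace N"
  show "x - y \<in> N" if eq: "x +o N = y +o N"
  proof -
    have "x + 0 \<in> x +o N" using N by (intro set_plus_intro2 subspace_0)
    then have "x \<in> y +o N" using eq by simp
    then show ?thesis by (rule set_plus_imp_minus)
  qed
  show "x +o N = y +o N" if xy: "x - y \<in> N"
  proof (intro equalityI subsetI)
    fix z assume "z \<in> x +o N"
    then have "z - x + (x - y) \<in> N" using xy N by (intro subspace_add) (auto dest: set_plus_imp_minus)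
    then show "z \<in> y +o N" by (intro set_minus_imp_plus) simp
  next
    fix z assume "z \<in> y +o N"
    then have "z - y - (x - y) \<in> N" using subspace_diff[OF N set_plus_imp_minus xy] by blast
    then show "z \<in> x +o N" by (intro set_minus_imp_plus) simp
  qed
qed

lemma subspace_set_plus: "subspace N \<Longrightarrow> N + N = N"
proof (intro equalityI subsetI)
  assume N: "subspace N"
  show "x \<in> N" if "x \<in> N + N" for x using that N by (auto elim!: set_plus_elim intro: subspace_add)
  show "x \<in> N + N" if "x \<in> N" for x
    using set_plus_intro[OF that subspace_0[OF N]] by simp
qed

lemma coset_add: "subspace N \<Longrightarrow> (x +o N) + (y +o N) = (x + y) +o N"
  by (simp add: set_plus_rearrange subspace_set_plus)

text \<open>
  The prescription by representatives: a map \<open>f\<close> that takes \<open>M\<close> into \<open>N\<close> descends to cosets.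
\<close>

lemma quot_map_coset:
  fixes f :: "'c::ab_group_add \<Rightarrow> 'b"
  assumes N: "subspace N" and add: "\<And>x y. f (x + y) = f x + f y"
    and M: "0 \<in> M" and im: "\<And>x. x \<in> M \<Longrightarrow> f x \<in> N"
  shows "quot_map f N (x +o M) = f x +o N"
  unfolding quot_map_def
proof (intro equalityI subsetI)
  fix z assume "z \<in> f ` (x +o M) + N"
  then obtain m n where "m \<in> M" "n \<in> N" "z = f (x + m) + n"
    by (auto simp: elt_set_plus_def elim!: set_plus_elim)
  then have "z = f x + (f m + n)" "f m + n \<in> N"
    using im N by (auto simp: add algebra_simps intro: subspace_add)
  then show "z \<in> f x +o N" by (simp add: set_plus_intro2)
next
  fix z assume "z \<in> f x +o N"
  then obtain n where "n \<in> N" "z = f x + n" by (auto simp: elt_set_plus_def)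
  moreover have "f x \<in> f ` (x +o M)" using set_plus_intro2[OF M, of x] by (metis add.right_neutral imageI)
  ultimately show "z \<in> f ` (x +o M) + N" by blast
qed

lemma scale_coset: "subspace N \<Longrightarrow> scale c ` (x +o N) + N = scale c x +o N"
  using quot_map_coset[of N "scale c" N x]
  by (simp add: quot_map_def scale_right_distrib subspace_0 subspace_scale)

end

lemma scale_ksign:
  assumes "vector_space sc"
  shows "sc (ksign n) x = sg n x"
proof -
  interpret vector_space sc by fact
  show ?thesis by (simp add: ksign_def sg_def)
qed

lemma lookup_pscale: "Poly_Mapping.lookup (pscale c q) x = c * Poly_Mapping.lookup q x"
  by (simp add: pscale_def Poly_Mapping.map.rep_eq when_def)

lemma vector_space_pscale: "vector_space (pscale :: 'k::field \<Rightarrow> ('x \<Rightarrow>\<^sub>0 'k) \<Rightarrow> _)"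
  by unfold_locales (auto intro!: poly_mapping_eqI simp: lookup_pscale lookup_add algebra_simps)

interpretation pscale: vector_space "pscale :: 'k::field \<Rightarrow> ('x \<Rightarrow>\<^sub>0 'k) \<Rightarrow> _"
  by (rule vector_space_pscale)

section \<open>Descent to the symmetric coalgebra\<close>

text \<open>
  The morphism on the free vector space of words: lift the letters by \<open>s\<close> and apply the Chern--Simons cochain.
\<close>

definition semireg_words ::
    "('k::field_char_0, 'a::{ring, monoid_mult}) curved_data \<Rightarrow> 'a set \<Rightarrow> ('a set \<Rightarrow> 'a) \<Rightarrow> nat \<Rightarrow>
     ('a set list \<Rightarrow>\<^sub>0 'k) \<Rightarrow> 'a" where
  "semireg_words A I s k = pm_ext (\<lambda>Xs c. scal A c
     (mext (piece A) (chern_simons A (\<lambda>x. s (x +o I)) k) (map s Xs)))"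

definition semireg ::
    "('k::field_char_0, 'a::{ring, monoid_mult}) curved_data \<Rightarrow> 'a set \<Rightarrow> ('a set \<Rightarrow> 'a) \<Rightarrow> nat \<Rightarrow>
     ('k, 'a set) sym \<Rightarrow> 'a set" where
  "semireg A I s k = quot_map (semireg_words A I s k) (trace_ideal A I k)"

lemma quot_dgla_simps:
  "car (quot_dgla A I) = range (\<lambda>x. x +o I)"
  "add (quot_dgla A I) = (+)"
  "null (quot_dgla A I) = I"
  "smul (quot_dgla A I) c X = scal A c ` X + I"
  "comp (quot_dgla A I) i = (\<lambda>x. x +o I) ` piece A i"
  "diff (quot_dgla A I) = quot_map (der A) I"
  "bracket (quot_dgla A I) = quot_map2 (gcomm (piece A)) I"
  by (simp_all add: quot_dgla_def quot_def gvs.defs)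

lemma gshift_simps:
  "car (gshift n V) = car V" "add (gshift n V) = add V" "null (gshift n V) = null V"
  "smul (gshift n V) = smul V" "comp (gshift n V) i = comp V (n + i)"
  by (simp_all add: gshift_def)

lemma target_simps:
  "car (dgshift n (trace_complex A I k)) = range (\<lambda>x. x +o trace_ideal A I k)"
  "add (dgshift n (trace_complex A I k)) = (+)"
  "null (dgshift n (trace_complex A I k)) = trace_ideal A I k"
  "smul (dgshift n (trace_complex A I k)) c X = scal A c ` X + trace_ideal A I k"
  "comp (dgshift n (trace_complex A I k)) i = (\<lambda>x. x +o trace_ideal A I k) ` piece A (n + i)"
  "diff (dgshift n (trace_complex A I k)) X
     = scal A (ksign n) ` (quot_map (der A) (trace_ideal A I k) X) + trace_ideal A I k"
  by (simp_all add: dgshift_def gshift_def trace_complex_def quot_def gvs.defs)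

locale curved_section = curved_dg_algebra A
  for A :: "('k::field_char_0, 'a::{ring, monoid_mult}) curved_data" +
  fixes I :: "'a set" and s :: "'a set \<Rightarrow> 'a"
  assumes lie_ideal: "curved_lie_ideal A I" and section_s: "graded_section A I s"
begin

lemma I_subspace: "subspace I"
  using lie_ideal by (simp add: curved_lie_ideal_def)

lemma s_add: "s ((x +o I) + (y +o I)) = s (x +o I) + s (y +o I)"
  and s_scale: "s (scal A c ` (x +o I) + I) = scal A c (s (x +o I))"
  and s_degree: "X \<in> comp (quot_dgla A I) i \<Longrightarrow> s X \<in> piece A i"
  and s_coset: "s (x +o I) +o I = x +o I"
  using section_s by (auto simp: graded_section_def graded_linear_def quot_dgla_simps gvs_of_def)

abbreviation "lift_of \<equiv> (\<lambda>x. s (x +o I))"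

sublocale curved_projection A I lift_of
proof
  show "curved_lie_ideal A I" by (rule lie_ideal)
  fix x y c i
  show "lift_of (x + y) = lift_of x + lift_of y"
    using s_add[of x y] by (simp add: coset_add[OF I_subspace])
  show "lift_of (scal A c x) = scal A c (lift_of x)"
    using s_scale[of c x] by (simp add: scale_coset[OF I_subspace])
  show "x \<in> piece A i \<Longrightarrow> lift_of x \<in> piece A i"
    by (rule s_degree) (simp add: quot_dgla_simps)
  have "lift_of 0 = 0" using s_scale[of 0 0] scale_coset[OF I_subspace, of 0 0] by simp
  moreover assume "x \<in> I"
  then have "x +o I = 0 +o I" by (subst coset_eq_iff[OF I_subspace]) simp
  ultimately show "lift_of x = 0" by simp
next
  fix x show "lift_of x - x \<in> I"
    using s_coset[of x] by (simp add: coset_eq_iff[OF I_subspace])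
qed

abbreviation "mcs k \<equiv> mext (piece A) (cs k)"

lemma mcs_linear: "mcs k (us @ (scal A c x + y) # vs) = scal A c (mcs k (us @ x # vs)) + mcs k (us @ y # vs)"
  by (rule mext_linear[OF ideal_0 ideal_hpart scale_right_distrib scale_one sm_cs])

lemma mcs_kill: "x \<in> I \<Longrightarrow> mcs k (us @ x # vs) = 0"
  by (rule mext_kill[OF ideal_0 ideal_hpart scale_right_distrib scale_one sm_cs])

lemma mcs_swap: "x \<in> piece A i \<Longrightarrow> y \<in> piece A j \<Longrightarrow>
    mcs k (us @ x # y # vs) = sg ((i - 1) * (j - 1)) (mcs k (us @ y # x # vs))"
  by (rule mext_swap[OF ideal_0 ideal_hpart scale_right_distrib scale_one sm_cs])

lemma mcs_add: "mcs k (us @ (x + y) # vs) = mcs k (us @ x # vs) + mcs k (us @ y # vs)"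
  using mcs_linear[of k us 1 x y vs] by simp

lemma mcs_scale: "mcs k (us @ scal A c x # vs) = scal A c (mcs k (us @ x # vs))"
  using mcs_linear[of k us c x 0 vs] mcs_kill[OF ideal_0, of k us vs] by simp

text \<open>
  Hence the choice of representatives of cosets does not matter.
\<close>

lemma mcs_cong: 
  assumes "x - y \<in> I"
  shows "mcs k (us @ x # vs) = mcs k (us @ y # vs)"
  using mcs_add[of k us "x - y" y vs] mcs_kill[OF assms, of k us vs] by simp

lemma mext_good:
  assumes "sym_multi (scal A) (piece A) I (scal A) f" "list_all ok w"
  shows "mext (piece A) f (map snd w) = f w"
  using assms
proof (induction w arbitrary: f)
  case (Cons a w)
  have a: "snd a \<in> piece A (fst a + 1)" using Cons.prems by (simp add: good_def)
  have "mext (piece A) f (map snd (a # w)) = mext (piece A) (contr (fst a + 1 - 1, snd a) f) (map snd w)"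
    unfolding list.map
    by (rule mext_homogeneous_Cons[OF ideal_0 ideal_hpart scale_right_distrib scale_one Cons.prems(1) a])
  then show ?case
    using Cons.IH[OF sym_multi_contr[OF Cons.prems(1)], of a] Cons.prems by simp
qed simp

abbreviation "V \<equiv> gshift 1 (quot_dgla A I)"
abbreviation "W k \<equiv> semireg_words A I s k"

lemma W_add: "W k (x + y) = W k x + W k y"
  unfolding semireg_words_def by (rule pm_ext_add) (rule scale_left_distrib)

sublocale W: additive "W k" for k
  by unfold_locales (rule W_add)

lemma W_scale: "W k (pscale c q) = scal A c (W k q)"
proof -
  have "W k (pscale c q) = (\<Sum>x\<in>Poly_Mapping.keys q. scal A (Poly_Mapping.lookup (pscale c q) x) (mcs k (map s x)))"
    unfolding semireg_words_def
    by (rule pm_ext_superset) (auto simp: in_keys_iff lookup_pscale)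
  then show ?thesis
    by (simp add: semireg_words_def pm_ext_def lookup_pscale scale_sum_right)
qed

lemma W_word: "W k (word Xs) = mcs k (map s Xs)"
  by (simp add: semireg_words_def pm_ext_single)

lemma car_coset: "X \<in> car V \<Longrightarrow> s X +o I = X"
  by (auto simp: gshift_simps quot_dgla_simps s_coset)

lemma subspace_kernel: "pscale.subspace {q. W k q = 0}"
  by (auto intro!: pscale.subspaceI simp: W.zero W_add W_scale)

text \<open>
  Each of the three kinds of relations is a property of the cochain: additivity, homogeneity and graded symmetry in an
  arbitrary position.
\<close>

lemma W_relations:
  assumes "q \<in> sym_relations V"
  shows "W k q = 0"
proof -
  let ?R = "{word (xs @ add V u v # ys) - word (xs @ u # ys) - word (xs @ v # ys) | xs u v ys.
        xs \<in> lists (car V) \<and> ys \<in> lists (car V) \<and> u \<in> car V \<and> v \<in> car V} \<union>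
     {word (xs @ smul V c u # ys) - pscale c (word (xs @ u # ys)) | xs c u ys.
        xs \<in> lists (car V) \<and> ys \<in> lists (car V) \<and> u \<in> car V} \<union>
     {word (xs @ u # v # ys) - pscale (ksign (i * j)) (word (xs @ v # u # ys)) | xs u v ys i j.
        xs \<in> lists (car V) \<and> ys \<in> lists (car V) \<and> u \<in> comp V i \<and> v \<in> comp V j}"
  have "?R \<subseteq> {q. W k q = 0}"
  proof (intro subsetI, elim UnE)
    fix q :: "'a set list \<Rightarrow>\<^sub>0 'k" assume "q \<in> {word (xs @ add V u v # ys) - word (xs @ u # ys) - word (xs @ v # ys) | xs u v ys.
        xs \<in> lists (car V) \<and> ys \<in> lists (car V) \<and> u \<in> car V \<and> v \<in> car V}"
    then obtain xs u v ys where q: "q = word (xs @ (u + v) # ys) - word (xs @ u # ys) - word (xs @ v # ys)"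
      and uv: "u \<in> car V" "v \<in> car V" by (auto simp: gshift_simps quot_dgla_simps)
    have "s (u + v) = s u + s v"
      using uv s_add by (auto simp: gshift_simps quot_dgla_simps)
    then show "q \<in> {q. W k q = 0}" by (simp add: q W.diff W_word mcs_add)
  next
    fix q :: "'a set list \<Rightarrow>\<^sub>0 'k" assume "q \<in> {word (xs @ smul V c u # ys) - pscale c (word (xs @ u # ys)) | xs c u ys.
        xs \<in> lists (car V) \<and> ys \<in> lists (car V) \<and> u \<in> car V}"
    then obtain xs c u ys where q: "q = word (xs @ smul V c u # ys) - pscale c (word (xs @ u # ys))"
      and u: "u \<in> car V" by auto
    have "s (smul V c u) = scal A c (s u)"
      using u s_scale by (auto simp: gshift_simps quot_dgla_simps)
    then show "q \<in> {q. W k q = 0}" by (simp add: q W.diff W_word W_scale mcs_scale)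
  next
    fix q :: "'a set list \<Rightarrow>\<^sub>0 'k" assume "q \<in> {word (xs @ u # v # ys) - pscale (ksign (i * j)) (word (xs @ v # u # ys)) | xs u v ys i j.
        xs \<in> lists (car V) \<and> ys \<in> lists (car V) \<and> u \<in> comp V i \<and> v \<in> comp V j}"
    then obtain xs u v ys i j where
      q: "q = word (xs @ u # v # ys) - pscale (ksign (i * j)) (word (xs @ v # u # ys))"
      and uv: "u \<in> comp V i" "v \<in> comp V j" by auto
    have "s u \<in> piece A (1 + i)" "s v \<in> piece A (1 + j)"
      using uv by (auto simp: gshift_simps intro: s_degree)
    from mcs_swap[OF this] show "q \<in> {q. W k q = 0}"
      by (simp add: q W.diff W_word W_scale scale_ksign[OF vector_space_axioms])
  qed
  then have "sym_relations V \<subseteq> {q. W k q = 0}"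
    unfolding sym_relations_def by (rule pscale.span_minimal[OF _ subspace_kernel])
  then show ?thesis using assms by auto
qed

lemma subspace_relations: "pscale.subspace (sym_relations V)"
  unfolding sym_relations_def by (rule pscale.subspace_span)

lemma semireg_class: "semireg A I s k (q +o sym_relations V) = W k q +o TT k"
  unfolding semireg_def
  by (rule quot_map_coset[OF subspace_TT W_add])
     (simp_all add: pscale.subspace_0[OF subspace_relations] W_relations subspace_0[OF subspace_TT])

section \<open>The differential on the target\<close>

lemma right_space_mult:
  assumes "x \<in> I" "y \<in> right_space A (power_space A I n)"
  shows "x * y \<in> right_space A (power_space A I (Suc n))"
  using assms(2) unfolding right_space_def
proof (induction rule: span_induct_alt)
  case base
  then show ?case by (simp add: span_zero)
next
  case (step c y z)
  then obtain e a where y: "y = e * a" "e \<in> power_space A I n" by auto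
  have "x * y = (x * e) * a" by (simp add: y(1) mult.assoc)
  then have 1: "x * y \<in> span {e * a | e a. e \<in> power_space A I (Suc n)}"
    using power_space_mult[OF assms(1) y(2)] by (intro span_base) blast
  have 2: "x * (scal A c y + z) = scal A c (x * y) + x * z"
    by (simp add: algebra_simps scale_mult_right)
  show ?case unfolding 2 using span_add[OF span_scale[OF 1] step(2)] .
qed

lemma prod_list_power_space: "set es \<subseteq> I \<Longrightarrow> prod_list es \<in> power_space A I (length es)"
  unfolding power_space_def by (rule span_base) auto

lemma right_spaceI: "e \<in> power_space A I n \<Longrightarrow> e * a \<in> right_space A (power_space A I n)"
  unfolding right_space_def by (rule span_base) auto

lemma subspace_right_space: "subspace (right_space A X)"
  unfolding right_space_def by (rule subspace_span)

text \<open>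
  The Leibniz rule requires homogeneous factors, so the first factor is expanded into its components, which lie in
  \<open>I\<close> as \<open>I\<close> is homogeneous.  The derivative either falls on that factor and stays in \<open>I\<close>, or on the rest.
\<close>

lemma der_prod_list:
  assumes "set es \<subseteq> I"
  shows "der A (prod_list es * a) \<in> right_space A (power_space A I (length es))"
  using assms
proof (induction es)
  case Nil
  have "1 * der A a \<in> right_space A (power_space A I 0)"
    using prod_list_power_space[of "[]"] by (intro right_spaceI) simp
  then show ?case by simp
next
  case (Cons x es)
  let ?y = "prod_list es * a" and ?RS = "right_space A (power_space A I (Suc (length es)))"
  have x: "x \<in> I" and es: "set es \<subseteq> I" using Cons.prems by auto
  have "der A (hpart (piece A) x i * ?y) \<in> ?RS" for i
  proof -
    have "der A (hpart (piece A) x i * ?y)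
      = prod_list (der A (hpart (piece A) x i) # es) * a + sg i (hpart (piece A) x i * der A ?y)"
      using d_mult[OF hpart_in] by (simp add: mult.assoc)
    moreover have "prod_list (der A (hpart (piece A) x i) # es) * a \<in> ?RS"
      using prod_list_power_space[of "der A (hpart (piece A) x i) # es"] es x
      by (intro right_spaceI) (simp add: ideal_der ideal_hpart)
    moreover have "hpart (piece A) x i * der A ?y \<in> ?RS"
      by (rule right_space_mult[OF ideal_hpart[OF x] Cons.IH[OF es]])
    ultimately show ?thesis
      using subspace_right_space by (simp add: sg_def subspace_add subspace_neg subspace_diff)
  qed
  then have "(\<Sum>i | hpart (piece A) x i \<noteq> 0. der A (hpart (piece A) x i * ?y)) \<in> ?RS"
    by (intro subspace_sum[OF subspace_right_space])
  also have "(\<Sum>i | hpart (piece A) x i \<noteq> 0. der A (hpart (piece A) x i * ?y)) = der A (x * ?y)"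
    by (simp only: d.sum[symmetric] sum_distrib_right[symmetric] hpart_sum_support)
  finally show ?case by (simp add: mult.assoc)
qed

lemma der_right_space:
  assumes "y \<in> right_space A (power_space A I n)"
  shows "der A y \<in> right_space A (power_space A I n)"
proof -
  let ?RS = "right_space A (power_space A I n)"
  have e: "der A (e * a) \<in> ?RS" if "e \<in> power_space A I n" for e a
    using that unfolding power_space_def
  proof (induction rule: span_induct_alt)
    case base
    then show ?case by (simp add: d.zero subspace_0[OF subspace_right_space])
  next
    case (step c y z)
    then have "der A (y * a) \<in> ?RS" using der_prod_list by auto
    moreover have "der A ((scal A c y + z) * a) = scal A c (der A (y * a)) + der A (z * a)"
      by (simp add: distrib_right d_add der_scale flip: scale_mult_left)
    ultimately show ?case
      using step subspace_right_space unfolding power_space_def by (simp add: subspace_add subspace_scale)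
  qed
  show ?thesis using assms unfolding right_space_def[of A "power_space A I n"]
  proof (induction rule: span_induct_alt)
    case base
    then show ?case by (simp add: d.zero span_zero)
  next
    case (step c y z)
    then have "der A y \<in> ?RS" using e by auto
    then show ?case using step by (auto simp: right_space_def d_add der_scale intro: span_add span_scale)
  qed
qed

lemma gcomm_comm_space: "br a b \<in> comm_space A"
  unfolding comm_space_def by (rule span_base) auto

lemma subspace_comm_space: "subspace (comm_space A)"
  unfolding comm_space_def by (rule subspace_span)

lemma der_comm_space:
  assumes "y \<in> comm_space A"
  shows "der A y \<in> comm_space A"
  using assms unfolding comm_space_def
proof (induction rule: span_induct_alt)
  case base
  then show ?case by (simp add: d.zero span_zero)
next
  case (step c y z)
  then obtain a b where y: "y = br a b" by auto
  have "der A (br (hpart (piece A) a i) (hpart (piece A) b j)) \<in> comm_space A" for i j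
    unfolding der_gcomm[OF hpart_in hpart_in]
    using subspace_comm_space gcomm_comm_space by (simp add: sg_def subspace_add subspace_neg subspace_diff)
  then have "der A y \<in> comm_space A"
    unfolding y gcomm_sum_homogeneous[of a b] d.sum by (intro subspace_sum[OF subspace_comm_space])
  then show ?case using step by (auto simp: comm_space_def d_add der_scale intro: span_add span_scale)
qed

lemma der_TT: "x \<in> TT k \<Longrightarrow> der A x \<in> TT k"
  unfolding trace_ideal_def
  by (elim set_plus_elim) (simp add: d_add set_plus_intro der_comm_space der_right_space)

section \<open>The equation of an \<open>L\<^sub>\<infinity>\<close> morphism\<close>

lemma semireg_graded_linear:
  "graded_linear (Sym V) (gshift 1 (dgshift (2 * int k) (trace_complex A I k))) (semireg A I s k)"
  unfolding graded_linear_def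
proof (intro conjI ballI allI)
  note Sym_simps = Sym_def quot_def
  fix X assume X: "X \<in> car (Sym V)"
  then obtain q where q: "X = q +o sym_relations V" by (auto simp: Sym_simps)
  show "semireg A I s k X \<in> car (gshift 1 (dgshift (2 * int k) (trace_complex A I k)))"
    by (simp add: q semireg_class gshift_simps target_simps)
  show "semireg A I s k (add (Sym V) X Y) = add (gshift 1 (dgshift (2 * int k) (trace_complex A I k)))
      (semireg A I s k X) (semireg A I s k Y)" if Y: "Y \<in> car (Sym V)" for Y
  proof -
    from Y obtain r where r: "Y = r +o sym_relations V" by (auto simp: Sym_simps)
    have "add (Sym V) X Y = (q + r) +o sym_relations V"
      unfolding q r by (simp add: Sym_simps pscale.coset_add[OF subspace_relations])
    then show ?thesis
      by (simp add: semireg_class q r gshift_simps target_simps coset_add[OF subspace_TT] W_add)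
  qed
  show "semireg A I s k (smul (Sym V) c X) = smul (gshift 1 (dgshift (2 * int k) (trace_complex A I k))) c
      (semireg A I s k X)" for c
  proof -
    have "smul (Sym V) c X = pscale c q +o sym_relations V"
      unfolding q by (simp add: Sym_simps pscale.scale_coset[OF subspace_relations])
    then show ?thesis
      by (simp add: semireg_class q gshift_simps target_simps scale_coset[OF subspace_TT] W_scale)
  qed
next
  fix i X assume "X \<in> comp (Sym V) i"
  then obtain q where q: "X = q +o sym_relations V"
    and "q \<in> pscale.span {word xs | xs ds. has_degrees V ds xs \<and> sum_list ds = i}"
    by (auto simp: Sym_def quot_def)
  from this(2) have "W k q \<in> piece A (2 * int k + (1 + i))"
  proof (induction rule: pscale.span_induct_alt)
    case base
    then show ?case by (simp add: W.zero piece_zero)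
  next
    case (step c y z)
    then obtain xs ds where y: "y = word xs" and xs: "has_degrees V ds xs" "sum_list ds = i" by auto
    let ?w = "zip ds (map s xs)"
    have len: "length ds = length xs" using xs by (auto simp: has_degrees_def dest: list_all2_lengthD)
    have good: "list_all ok ?w"
      using xs(1) len by (auto simp: has_degrees_def list_all2_conv_all_nth list_all_length gshift_simps
          add.commute intro: s_degree)
    have "W k y = cs k ?w"
      using mext_good[OF sm_cs good] len by (simp add: y W_word)
    moreover have "cs k ?w \<in> piece A (2 * int k + 1 + sum_list (map fst ?w))"
      using homog_cs good by (simp add: homog_def)
    ultimately have "W k y \<in> piece A (2 * int k + (1 + i))"
      using xs(2) len by (simp add: add.assoc)
    then show ?case using step by (simp add: W_add W_scale piece_add piece_scale)
  qed
  then show "semireg A I s k X \<in> comp (gshift 1 (dgshift (2 * int k) (trace_complex A I k))) i"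
    by (simp add: q semireg_class gshift_simps target_simps)
qed

lemma diff_coset: "X \<in> car V \<Longrightarrow> diff (quot_dgla A I) X = der A (s X) +o I"
  unfolding quot_dgla_simps
  by (subst car_coset[symmetric], assumption, rule quot_map_coset[OF I_subspace d_add ideal_0 ideal_der])

text \<open>
  The representatives of a coset may be inhomogeneous, so this rests on the biadditivity of the graded commutator.
\<close>

lemma bracket_coset:
  assumes "X \<in> car V" "Y \<in> car V"
  shows "bracket (quot_dgla A I) X Y = br (s X) (s Y) +o I"
proof -
  have X: "X = s X +o I" and Y: "Y = s Y +o I" using assms by (simp_all add: car_coset)
  have in_X: "s X \<in> X" "s Y \<in> Y"
    using set_plus_intro2[OF ideal_0, of "s X"] set_plus_intro2[OF ideal_0, of "s Y"] X Y by simp_all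
  show ?thesis
    unfolding quot_dgla_simps quot_map2_def
  proof (intro equalityI subsetI)
    fix z assume "z \<in> {br x y | x y. x \<in> X \<and> y \<in> Y} + I"
    then obtain x y i where z: "z = br x y + i" "x \<in> X" "y \<in> Y" "i \<in> I" by (auto elim!: set_plus_elim)
    have "x - s X \<in> I" "y - s Y \<in> I" using z X Y set_plus_imp_minus by metis+
    then have "br (x - s X) y + br (s X) (y - s Y) + i \<in> I"
      using z(4) by (intro ideal_add ideal_br ideal_br_left)
    moreover have "br x y = br (x - s X) y + br (s X) (y - s Y) + br (s X) (s Y)"
      using gcomm_add_left[of "x - s X" "s X" y] gcomm_add_right[of "s X" "y - s Y" "s Y"] by simp
    ultimately have "z - br (s X) (s Y) \<in> I" by (simp add: z(1))
    then show "z \<in> br (s X) (s Y) +o I" by (rule set_minus_imp_plus)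
  next
    fix z assume "z \<in> br (s X) (s Y) +o I"
    then obtain i where "z = br (s X) (s Y) + i" "i \<in> I" by (auto simp: elt_set_plus_def)
    then show "z \<in> {br x y | x y. x \<in> X \<and> y \<in> Y} + I" using in_X by blast
  qed
qed

text \<open>
  The unary terms of \<open>Q\<close> correspond to the first sum in \<open>coder_sum\<close>, and the unshuffles to the pairs \<open>i < j\<close> in
  the second.  The letters \<open>d X\<close> and \<open>[X, Y]\<close> are lifted by \<open>s\<close> and not by \<open>d (s X)\<close> and \<open>[s X, s Y]\<close>; the
  difference lies in \<open>I\<close>, where the cochain vanishes.
\<close>

lemma semireg_Q_value:
  assumes deg: "has_degrees (quot_dgla A I) ds xs"
  defines "w \<equiv> zip (map (\<lambda>e. e - 1) ds) (map s xs)"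
  shows "semireg A I s k (Q_value (quot_dgla A I) ds xs) = coder (der A) br (cs k) w +o TT k"
proof -
  let ?L = "quot_dgla A I"
  have len: "length ds = length xs" using deg by (auto simp: has_degrees_def dest: list_all2_lengthD)
  have lw: "length w = length xs" by (simp add: w_def len)
  have fst_w: "fst (w ! i) = ds ! i - 1" and snd_w: "snd (w ! i) = s (xs ! i)" if "i < length xs" for i
    using that len by (simp_all add: w_def)
  have comp: "xs ! i \<in> comp ?L (ds ! i)" if "i < length xs" for i
    using deg that len by (simp add: has_degrees_def list_all2_conv_all_nth)
  have car: "xs ! i \<in> car V" if "i < length xs" for i
    using comp[OF that] by (auto simp: gshift_simps quot_dgla_simps)
  have good: "list_all ok w"
    unfolding list_all_length using comp by (auto simp: lw good_def fst_w snd_w intro: s_degree)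
  have map_snd: "map snd w = map s xs" using len by (simp add: w_def)
  have unary: "W k (word (xs[i := diff ?L (xs ! i)])) = cs k (w[i := (fst (w ! i) + 1, der A (snd (w ! i)))])"
    if i: "i < length xs" for i
  proof -
    let ?y = "der A (s (xs ! i))" and ?us = "take i (map s xs)" and ?vs = "drop (Suc i) (map s xs)"
    have "W k (word (xs[i := diff ?L (xs ! i)])) = mcs k (?us @ lift_of ?y # ?vs)"
      using i by (simp add: W_word diff_coset[OF car] upd_conv_take_nth_drop take_map drop_map)
    also have "\<dots> = mcs k (?us @ ?y # ?vs)" by (rule mcs_cong) (rule p_mod)
    also have "?us @ ?y # ?vs = map snd (w[i := (fst (w ! i) + 1, der A (snd (w ! i)))])"
      using i by (simp add: map_update map_snd snd_w upd_conv_take_nth_drop)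
    also have "mcs k \<dots> = cs k (w[i := (fst (w ! i) + 1, der A (snd (w ! i)))])"
    proof (rule mext_good[OF sm_cs])
      have "der A (s (xs ! i)) \<in> piece A (ds ! i + 1)"
        using comp[OF i] by (intro der_degree s_degree)
      then have "ok (fst (w ! i) + 1, der A (snd (w ! i)))" using i by (simp add: fst_w snd_w)
      then show "list_all ok (w[i := (fst (w ! i) + 1, der A (snd (w ! i)))])"
        using good set_update_subset_insert by (fastforce simp: list_all_iff)
    qed
    finally show ?thesis .
  qed
  have brgood: "\<And>x y i j. x \<in> piece A i \<Longrightarrow> y \<in> piece A j \<Longrightarrow> br x y \<in> piece A (i + j)"
    by (rule gcomm_degree)
  have binary: "W k (word (bracket ?L (xs ! \<tau> 0) (xs ! \<tau> 1) # map (\<lambda>m. xs ! \<tau> m) [2..<length xs]))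
      = cs k (brp br (w ! \<tau> 0) (w ! \<tau> 1) # nths w (- {\<tau> 0, \<tau> 1}))"
    if \<tau>: "\<tau> \<in> unshuffles2 (length xs)" for \<tau>
  proof -
    have i: "\<tau> 0 < length xs" and j: "\<tau> 1 < length xs" using unshuffle_facts(1,2)[OF \<tau>] by simp_all
    let ?y = "br (s (xs ! \<tau> 0)) (s (xs ! \<tau> 1))" and ?vs = "nths (map s xs) (- {\<tau> 0, \<tau> 1})"
    have "W k (word (bracket ?L (xs ! \<tau> 0) (xs ! \<tau> 1) # map (\<lambda>m. xs ! \<tau> m) [2..<length xs]))
      = mcs k ([] @ lift_of ?y # ?vs)"
      unfolding unshuffle_nths[OF \<tau>] W_word bracket_coset[OF car[OF i] car[OF j]] by (simp add: nths_map)
    also have "\<dots> = mcs k ([] @ ?y # ?vs)" by (rule mcs_cong) (rule p_mod)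
    also have "[] @ ?y # ?vs = map snd (brp br (w ! \<tau> 0) (w ! \<tau> 1) # nths w (- {\<tau> 0, \<tau> 1}))"
      using i j by (simp add: nths_map[symmetric] map_snd brp_def snd_w)
    also have "mcs k \<dots> = cs k (brp br (w ! \<tau> 0) (w ! \<tau> 1) # nths w (- {\<tau> 0, \<tau> 1}))"
    proof (rule mext_good[OF sm_cs])
      have "ok (w ! \<tau> 0)" "ok (w ! \<tau> 1)" using good i j lw by (auto simp: list_all_length)
      then show "list_all ok (brp br (w ! \<tau> 0) (w ! \<tau> 1) # nths w (- {\<tau> 0, \<tau> 1}))"
        using good by (simp add: good_brp[where G = "piece A" and br = br, OF brgood] list_all_nths)
    qed
    finally show ?thesis .
  qed
  have sums: "(\<Sum>m<i. fst (w ! m)) = (\<Sum>m<i. ds ! m) - int i" if "i \<le> length xs" for i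
  proof -
    have "(\<Sum>m<i. fst (w ! m)) = (\<Sum>m<i. ds ! m - 1)" using that by (intro sum.cong) (auto simp: fst_w)
    then show ?thesis by (simp add: sum_subtractf)
  qed
  let ?es = "map (\<lambda>e. e - 1) ds"
  have U: "(\<Sum>\<tau>\<in>unshuffles2 (length xs). scal A (koszul_sign ?es \<tau> * ksign (ds ! \<tau> 0))
        (W k (word (bracket ?L (xs ! \<tau> 0) (xs ! \<tau> 1) # map (\<lambda>m. xs ! \<tau> m) [2..<length xs]))))
    = (\<Sum>j<length w. \<Sum>i<j. sg (fst (w ! i) + 1 + pair_sign w i j) (cs k (brp br (w ! i) (w ! j) # nths w (- {i, j}))))"
  proof -
    have "(\<Sum>j<length w. \<Sum>i<j. sg (fst (w ! i) + 1 + pair_sign w i j) (cs k (brp br (w ! i) (w ! j) # nths w (- {i, j}))))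
      = (\<Sum>(j, i)\<in>(SIGMA j:{..<length xs}. {..<j}).
          sg (fst (w ! i) + 1 + pair_sign w i j) (cs k (brp br (w ! i) (w ! j) # nths w (- {i, j}))))"
      by (simp add: sum.Sigma lw)
    also have "\<dots> = (\<Sum>\<tau>\<in>unshuffles2 (length xs).
        sg (fst (w ! \<tau> 0) + 1 + pair_sign w (\<tau> 0) (\<tau> 1)) (cs k (brp br (w ! \<tau> 0) (w ! \<tau> 1) # nths w (- {\<tau> 0, \<tau> 1}))))"
      by (subst sum.reindex_bij_betw[OF unshuffles2_bij, symmetric]) simp
    also have "\<dots> = (\<Sum>\<tau>\<in>unshuffles2 (length xs). scal A (koszul_sign ?es \<tau> * ksign (ds ! \<tau> 0))
        (W k (word (bracket ?L (xs ! \<tau> 0) (xs ! \<tau> 1) # map (\<lambda>m. xs ! \<tau> m) [2..<length xs]))))"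
    proof (rule sum.cong[OF refl])
      fix \<tau> assume \<tau>: "\<tau> \<in> unshuffles2 (length xs)"
      have i: "\<tau> 0 < length xs" and j: "\<tau> 1 < length xs" using unshuffle_facts(1,2)[OF \<tau>] by simp_all
      have es: "?es ! m = fst (w ! m)" if "m < length xs" for m using that len by (simp add: fst_w)
      have sums_es: "(\<Sum>m<l. ?es ! m) = (\<Sum>m<l. fst (w ! m))" if "l < length xs" for l
        using that by (intro sum.cong) (auto simp: es)
      have "koszul_sign ?es \<tau> = (ksign (pair_sign w (\<tau> 0) (\<tau> 1)) :: 'k)"
        using koszul_sign_unshuffle[of \<tau> ?es, where 'k = 'k] \<tau> len
        by (simp only: length_map es[OF i] es[OF j] sums_es[OF i] sums_es[OF j] pair_sign_def)
      moreover have "ds ! \<tau> 0 = fst (w ! \<tau> 0) + 1" using i by (simp add: fst_w)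
      ultimately have "koszul_sign ?es \<tau> * ksign (ds ! \<tau> 0)
          = (ksign (fst (w ! \<tau> 0) + 1 + pair_sign w (\<tau> 0) (\<tau> 1)) :: 'k)"
        by (simp only: ksign_add) (simp only: mult.commute)
      then show "sg (fst (w ! \<tau> 0) + 1 + pair_sign w (\<tau> 0) (\<tau> 1)) (cs k (brp br (w ! \<tau> 0) (w ! \<tau> 1) # nths w (- {\<tau> 0, \<tau> 1})))
        = scal A (koszul_sign ?es \<tau> * ksign (ds ! \<tau> 0))
        (W k (word (bracket ?L (xs ! \<tau> 0) (xs ! \<tau> 1) # map (\<lambda>m. xs ! \<tau> m) [2..<length xs])))"
        by (simp only: binary[OF \<tau>] scale_ksign[OF vector_space_axioms])
    qed
    finally show ?thesis by (rule sym)
  qed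
  have S: "(\<Sum>i<length xs. scal A (ksign (int i + 1 + (\<Sum>m<i. ds ! m))) (W k (word (xs[i := diff ?L (xs ! i)]))))
    = (\<Sum>i<length w. - sg (\<Sum>m<i. fst (w ! m)) (cs k (w[i := (fst (w ! i) + 1, der A (snd (w ! i)))])))"
    unfolding lw
  proof (intro sum.cong refl)
    fix i assume i: "i \<in> {..<length xs}"
    have "- sg (\<Sum>m<i. fst (w ! m)) x = sg (int i + 1 + (\<Sum>m<i. ds ! m)) x" for x :: 'a
    proof -
      have "- sg (\<Sum>m<i. fst (w ! m)) x = sg (1 + (\<Sum>m<i. fst (w ! m))) x" by (simp add: sg_def)
      also have "\<dots> = sg (int i + 1 + (\<Sum>m<i. ds ! m)) x" using i by (intro sg_cong) (simp add: sums)
      finally show ?thesis .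
    qed
    then show "scal A (ksign (int i + 1 + (\<Sum>m<i. ds ! m))) (W k (word (xs[i := diff ?L (xs ! i)])))
      = - sg (\<Sum>m<i. fst (w ! m)) (cs k (w[i := (fst (w ! i) + 1, der A (snd (w ! i)))]))"
      using i by (simp add: unary scale_ksign[OF vector_space_axioms])
  qed
  show ?thesis
    unfolding Q_value_def sym_class_def semireg_class W_add W.sum W_scale S U
    by (rule arg_cong[where f = "\<lambda>x. x +o TT k"], rule sym, rule coder_sum[where G = "piece A" and br = br, OF brgood sm_cs good])
qed

lemma semireg_sym_prod: "semireg A I s k (sym_prod V Xs) = mcs k (map s Xs) +o TT k"
  by (simp add: sym_prod_def sym_class_def semireg_class W_word)

lemma semireg_morphism:
  "linfty_morphism_abelian (quot_dgla A I) (dgshift (2 * int k) (trace_complex A I k)) (semireg A I s k)"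
  unfolding linfty_morphism_abelian_def
proof (intro conjI allI impI)
  show "graded_linear (Sym V) (gshift 1 (dgshift (2 * int k) (trace_complex A I k))) (semireg A I s k)"
    by (rule semireg_graded_linear)
  show "semireg A I s k (sym_prod V []) = null (dgshift (2 * int k) (trace_complex A I k))"
    by (simp add: semireg_sym_prod cs_Nil target_simps)
next
  fix ds xs assume deg: "has_degrees (quot_dgla A I) ds xs"
  let ?M = "dgshift (2 * int k) (trace_complex A I k)"
  define w where "w = zip (map (\<lambda>e. e - 1) ds) (map s xs)"
  have len: "length ds = length xs" using deg by (auto simp: has_degrees_def dest: list_all2_lengthD)
  have good: "list_all ok w"
    using deg len by (auto simp: w_def has_degrees_def list_all2_conv_all_nth list_all_length intro: s_degree)
  have "map snd w = map s xs" using len by (simp add: w_def)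
  then have F: "semireg A I s k (sym_prod V xs) = cs k w +o TT k"
    using mext_good[OF sm_cs good] by (simp add: semireg_sym_prod)
  have "smul ?M (- 1) (diff ?M (semireg A I s k (sym_prod V xs))) = - der A (cs k w) +o TT k"
  proof -
    have "quot_map (der A) (TT k) (cs k w +o TT k) = der A (cs k w) +o TT k"
      by (rule quot_map_coset[OF subspace_TT d_add subspace_0[OF subspace_TT] der_TT])
    then show ?thesis unfolding F target_simps by (simp only: scale_coset[OF subspace_TT]) (simp add: ksign_def)
  qed
  also have "\<dots> = coder (der A) br (cs k) w +o TT k"
  proof -
    have "- (der A (cs k w) + coder (der A) br (cs k) w) \<in> TT k"
      using subspace_neg[OF subspace_TT cs_cocycle[OF good, of k]] .
    then show ?thesis unfolding coset_eq_iff[OF subspace_TT] by simp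
  qed
  also have "\<dots> = semireg A I s k (Q_value (quot_dgla A I) ds xs)"
    using semireg_Q_value[OF deg] unfolding w_def by simp
  finally show "smul ?M (- 1) (diff ?M (semireg A I s k (sym_prod V xs)))
    = semireg A I s k (Q_value (quot_dgla A I) ds xs)" .
qed

lemma power_piece: "r \<in> piece A 2 \<Longrightarrow> r ^ k \<in> piece A (2 * int k)"
proof (induction k)
  case 0
  then show ?case by (simp add: one_piece)
next
  case (Suc k)
  then show ?case using mult_piece[of r 2 "r ^ k" "2 * int k"] by (simp add: algebra_simps)
qed

text \<open>
  In arity one the Chern--Simons cochain is \<open>p x R^k / k!\<close>.  Modulo commutators \<open>p x R^k\<close> is \<open>R^k p x\<close> because
  \<open>R^k\<close> has even degree, and \<open>R^k (p x - x)\<close> is a product of \<open>k + 1\<close> elements of \<open>I\<close>.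
\<close>

lemma semireg_linear_component:
  "linear_component (quot_dgla A I) (semireg A I s k) (x +o I)
     = tr A I k (scal A (1 / fact k) (curv A ^ k * x))"
proof -
  let ?R = "curv A ^ k" and ?S = "{i. hpart (piece A) x i \<noteq> 0}" and ?c = "1 / fact k :: 'k"
  have R: "?R \<in> piece A (2 * int k)" by (rule power_piece[OF curv_degree])
  have "mcs k [lift_of x] = mcs k [x]"
    using mcs_cong[OF p_mod, of k "[]" x "[]"] by simp
  also have "\<dots> = (\<Sum>i\<in>?S. scal A ?c (lift_of (hpart (piece A) x i) * ?R))"
    by (simp add: cs_single)
  finally have 1: "mcs k [lift_of x] = (\<Sum>i\<in>?S. scal A ?c (lift_of (hpart (piece A) x i) * ?R))" .
  have 2: "scal A ?c (?R * x) = (\<Sum>i\<in>?S. scal A ?c (?R * hpart (piece A) x i))"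
    by (simp only: scale_sum_right[symmetric] sum_distrib_left[symmetric] hpart_sum_support)
  have "lift_of y * ?R - ?R * y \<in> TT k" if y: "y \<in> piece A i" for y i
  proof -
    have "lift_of y * ?R - ?R * lift_of y \<in> TT k"
      using T_commutator[OF p_degree[OF y] R, of k] by (simp add: sg_def)
    moreover have "?R * (lift_of y - y) \<in> TT k"
    proof (rule power_space_T)
      have "prod_list (replicate k (curv A) @ [lift_of y - y]) \<in> power_space A I (length (replicate k (curv A) @ [lift_of y - y]))"
        by (rule prod_list_power_space) (auto simp: ideal_curv p_mod)
      then show "?R * (lift_of y - y) \<in> power_space A I (k + 1)"
        by (simp add: prod_list_replicate)
    qed
    ultimately have "(lift_of y * ?R - ?R * lift_of y) + ?R * (lift_of y - y) \<in> TT k" by (rule T_add)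
    then show ?thesis by (simp add: algebra_simps)
  qed
  from subspace_scale[OF subspace_TT this[OF hpart_in]]
  have "(\<Sum>i\<in>?S. scal A ?c (lift_of (hpart (piece A) x i) * ?R - ?R * hpart (piece A) x i)) \<in> TT k"
    by (intro subspace_sum[OF subspace_TT])
  then have "mcs k [lift_of x] - scal A ?c (?R * x) \<in> TT k"
    unfolding 1 2 by (simp add: scale_right_diff_distrib sum_subtractf)
  then show ?thesis
    by (simp add: linear_component_def semireg_sym_prod tr_def coset_eq_iff[OF subspace_TT])
qed

end

section \<open>Naturality\<close>

text \<open>
  A morphism of the data commutes with all the ingredients of the Chern--Simons cochain, and hence with the cochain.
\<close>

locale section_morphism = S: curved_section A I s + T: curved_section B J t
  for A :: "('k::field_char_0, 'a::{ring, monoid_mult}) curved_data" and I s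
    and B :: "('k, 'b::{ring, monoid_mult}) curved_data" and J t +
  fixes \<phi> :: "'a \<Rightarrow> 'b"
  assumes morphism: "curved_morphism A I s B J t \<phi>"
begin

lemma phi_add: "\<phi> (x + y) = \<phi> x + \<phi> y" and phi_scale: "\<phi> (scal A c x) = scal B c (\<phi> x)"
  and phi_degree: "x \<in> piece A i \<Longrightarrow> \<phi> x \<in> piece B i" and phi_one: "\<phi> 1 = 1"
  and phi_mult: "\<phi> (x * y) = \<phi> x * \<phi> y" and phi_der: "\<phi> (der A x) = der B (\<phi> x)"
  and phi_curv: "\<phi> (curv A) = curv B" and phi_ideal: "x \<in> I \<Longrightarrow> \<phi> x \<in> J"
  and phi_section: "\<phi> (s (x +o I)) = t (\<phi> x +o J)"
  using morphism by (auto simp: curved_morphism_def graded_linear_def gvs_of_def)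

sublocale phi: additive \<phi> by unfold_locales (rule phi_add)

lemma phi_sg: "\<phi> (sg n x) = sg n (\<phi> x)"
  by (simp add: sg_def phi.minus)

lemma phi_hpart: "hpart (piece B) (\<phi> x) i = \<phi> (hpart (piece A) x i)"
proof -
  have "hpart (piece B) (\<phi> x) = (\<lambda>i. \<phi> (hpart (piece A) x i))"
    by (rule T.hpart_eqI_sum[where S = "{i. hpart (piece A) x i \<noteq> 0}"])
       (auto simp: S.finite_hpart S.hpart_sum_support phi.zero phi_degree S.hpart_in simp flip: phi.sum)
  then show ?thesis by simp
qed

lemma phi_gcomm:
  "x \<in> piece A i \<Longrightarrow> y \<in> piece A j \<Longrightarrow> \<phi> (gcomm (piece A) x y) = gcomm (piece B) (\<phi> x) (\<phi> y)"
  by (simp add: S.gcomm_sg T.gcomm_sg[OF phi_degree phi_degree] phi.diff phi_mult phi_sg)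

lemma phi_comm_space:
  assumes "x \<in> comm_space A"
  shows "\<phi> x \<in> comm_space B"
  using assms unfolding comm_space_def[of A]
proof (induction rule: S.span_induct_alt)
  case base
  then show ?case by (simp add: phi.zero T.subspace_0[OF T.subspace_comm_space])
next
  case (step c y z)
  then obtain a b where y: "y = gcomm (piece A) a b" by auto
  have "\<phi> y = (\<Sum>i | hpart (piece A) a i \<noteq> 0. \<Sum>j | hpart (piece A) b j \<noteq> 0.
      gcomm (piece B) (\<phi> (hpart (piece A) a i)) (\<phi> (hpart (piece A) b j)))"
    unfolding y S.gcomm_sum_homogeneous[of a b] phi.sum phi_gcomm[OF S.hpart_in S.hpart_in] ..
  also have "\<dots> \<in> comm_space B"
    by (intro T.subspace_sum[OF T.subspace_comm_space] T.gcomm_comm_space)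
  finally show ?case
    using step T.subspace_comm_space by (simp add: phi_add phi_scale T.subspace_add T.subspace_scale)
qed

lemma phi_power_space:
  assumes "x \<in> power_space A I n"
  shows "\<phi> x \<in> power_space B J n"
  using assms unfolding power_space_def
proof (induction rule: S.span_induct_alt)
  case base
  then show ?case by (simp add: phi.zero T.span_zero)
next
  case (step c y z)
  then obtain es where y: "y = prod_list es" "length es = n" "set es \<subseteq> I" by auto
  have "\<phi> (prod_list es) = prod_list (map \<phi> es)" by (induction es) (simp_all add: phi_one phi_mult)
  then have "\<phi> y \<in> {prod_list es | es. length es = n \<and> set es \<subseteq> J}"
    using y by (auto intro!: exI[of _ "map \<phi> es"] phi_ideal)
  then show ?case using step by (auto simp: phi_add phi_scale intro: T.span_add T.span_scale T.span_base)
qed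

lemma phi_right_space:
  assumes "x \<in> right_space A (power_space A I n)"
  shows "\<phi> x \<in> right_space B (power_space B J n)"
  using assms unfolding right_space_def[of A]
proof (induction rule: S.span_induct_alt)
  case base
  then show ?case by (simp add: phi.zero T.subspace_0[OF T.subspace_right_space])
next
  case (step c y z)
  then obtain e a where "y = e * a" "e \<in> power_space A I n" by auto
  then have "\<phi> y \<in> right_space B (power_space B J n)"
    by (simp add: phi_mult T.right_spaceI phi_power_space)
  then show ?case
    using step T.subspace_right_space by (simp add: phi_add phi_scale T.subspace_add T.subspace_scale)
qed

lemma phi_trace_ideal: "x \<in> trace_ideal A I k \<Longrightarrow> \<phi> x \<in> trace_ideal B J k"
  unfolding trace_ideal_def
  by (elim set_plus_elim) (simp add: phi_add set_plus_intro phi_comm_space phi_right_space)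

abbreviation "mw \<equiv> map (apsnd \<phi>)"
abbreviation "pphi \<equiv> Poly_Mapping.mapp (\<lambda>_::nat. \<phi>)"

lemma pphi_add: "pphi (x + y) = pphi x + pphi y"
  by (rule mapp_add) (rule phi_add)

lemma pphi_single: "pphi (Poly_Mapping.single m a) = Poly_Mapping.single m (\<phi> a)"
  by (simp add: mapp_single phi.zero)

lemma pphi_mult: "pphi (x * y) = pphi x * pphi y"
  by (rule pm_biadditive_eqI[where B = "\<lambda>x y. pphi (x * y)"])
     (simp_all add: distrib_left distrib_right pphi_add pphi_single mult_single phi_mult)

lemma pphi_zero: "pphi 0 = 0"
  using pphi_add[of 0 0] by simp

lemma
  assumes "list_all (good (piece A)) w"
  shows phi_conv: "(\<And>w. list_all (good (piece A)) w \<Longrightarrow> \<phi> (f w) = f' (mw w)) \<Longrightarrow>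
      (\<And>w. list_all (good (piece A)) w \<Longrightarrow> \<phi> (g w) = g' (mw w)) \<Longrightarrow>
      \<phi> (conv q f g w) = conv q f' g' (mw w)"
    and pphi_conv: "(\<And>w. list_all (good (piece A)) w \<Longrightarrow> pphi (F w) = F' (mw w)) \<Longrightarrow>
      (\<And>w. list_all (good (piece A)) w \<Longrightarrow> pphi (K w) = K' (mw w)) \<Longrightarrow>
      pphi (conv q F K w) = conv q F' K' (mw w)"
  by (rule conv_natural[where h = \<phi> and ok = "good (piece A)"]; simp add: phi_add phi_mult assms)
     (rule conv_natural[where h = pphi and ok = "good (piece A)"]; simp add: pphi_add pphi_mult assms)

lemma phi_sec: "\<phi> (sec_co S.lift_of w) = sec_co T.lift_of (mw w)"
  by (cases w; cases "tl w") (auto simp: phi.zero phi_section sec_co_def)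

lemma phi_unit: "\<phi> (unit_co (curv A) w) = unit_co (curv B) (mw w)"
  by (cases w) (auto simp: phi.zero phi_curv)

lemma phi_dsec:
  assumes "list_all (good (piece A)) w"
  shows "\<phi> (dsec_co A S.lift_of w) = dsec_co B T.lift_of (mw w)"
proof -
  consider "w = []" | a where "w = [a]" | a b where "w = [a, b]" | a b c v where "w = a # b # c # v"
    by (metis list.exhaust)
  then show ?thesis
  proof cases
    case (3 a b)
    then have "\<phi> (gcomm (piece A) (snd a) (snd b)) = gcomm (piece B) (\<phi> (snd a)) (\<phi> (snd b))"
      using assms by (intro phi_gcomm) (auto simp: good_def)
    then show ?thesis using 3 by (simp add: S.dsec_simps T.dsec_simps phi_sg phi_section)
  qed (simp_all add: S.dsec_simps T.dsec_simps phi.zero phi.diff phi_der phi_section)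
qed

lemma pphi_curv_path:
  assumes w: "list_all (good (piece A)) w"
  shows "pphi (curv_path A S.lift_of w) = curv_path B T.lift_of (mw w)"
proof -
  have "\<phi> (conv 1 (sec_co S.lift_of) (sec_co S.lift_of) w) = conv 1 (sec_co T.lift_of) (sec_co T.lift_of) (mw w)"
    by (rule phi_conv[OF w]) (rule phi_sec)+
  then show ?thesis
    by (simp add: curv_path_def lift_def pphi_add pphi_single phi_unit phi_dsec[OF w])
qed

lemma pphi_cpow:
  assumes "list_all (good (piece A)) w"
  shows "pphi (cpow (Poly_Mapping.single 0 1) (curv_path A S.lift_of) k w)
    = cpow (Poly_Mapping.single 0 1) (curv_path B T.lift_of) k (mw w)"
  using assms
proof (induction k arbitrary: w)
  case 0
  show ?case by (cases w) (simp_all add: pphi_single phi_one pphi_zero)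
next
  case (Suc k)
  show ?case unfolding cpow.simps
    by (rule pphi_conv[OF Suc.prems]) (erule pphi_curv_path, erule Suc.IH)
qed

lemma phi_integral: "\<phi> (pm_integral A x) = pm_integral B (pphi x)"
  by (rule pm_closed[where p = x and Q = "\<lambda>x. \<phi> (pm_integral A x) = pm_integral B (pphi x)"])
     (simp_all add: S.pm_integral.zero T.pm_integral.zero pphi_zero phi.zero S.pm_integral_add T.pm_integral_add
       phi_add pphi_add pphi_single S.pm_integral_single T.pm_integral_single phi_scale)

lemma phi_chern_simons:
  assumes w: "list_all (good (piece A)) w"
  shows "\<phi> (chern_simons A S.lift_of k w) = chern_simons B T.lift_of k (mw w)"
proof -
  have "pphi (conv 0 (lift 1 (sec_co S.lift_of)) (cpow (Poly_Mapping.single 0 1) (curv_path A S.lift_of) k) w)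
    = conv 0 (lift 1 (sec_co T.lift_of)) (cpow (Poly_Mapping.single 0 1) (curv_path B T.lift_of) k) (mw w)"
    by (rule pphi_conv[OF w]) (simp add: lift_def pphi_single phi_sec, erule pphi_cpow)
  then show ?thesis by (simp add: chern_simons_def phi_scale phi_integral)
qed

text \<open>
  The components of \<open>\<phi> x\<close> are the images of those of \<open>x\<close>, some of which may vanish; \<open>mext_superset\<close> allows the
  same set of degrees on both sides.
\<close>

lemma phi_mext:
  assumes "\<And>w. list_all (good (piece A)) w \<Longrightarrow> \<phi> (f w) = g (mw w)"
    and "sym_multi (scal B) (piece B) J (scal B) g"
  shows "\<phi> (mext (piece A) f xs) = mext (piece B) g (map \<phi> xs)"
  using assms
proof (induction xs arbitrary: f g)
  case Nil
  show ?case using Nil.prems(1)[of "[]"] by simp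
next
  case (Cons x xs)
  let ?S = "{i. hpart (piece A) x i \<noteq> 0}"
  have sub: "{i. hpart (piece B) (\<phi> x) i \<noteq> 0} \<subseteq> ?S" by (auto simp: phi_hpart phi.zero)
  have "\<phi> (mext (piece A) f (x # xs)) = (\<Sum>i\<in>?S. \<phi> (mext (piece A) (contr (i - 1, hpart (piece A) x i) f) xs))"
    by (simp add: phi.sum)
  also have "\<dots> = (\<Sum>i\<in>?S. mext (piece B) (contr (i - 1, hpart (piece B) (\<phi> x) i) g) (map \<phi> xs))"
  proof (rule sum.cong[OF refl])
    fix i
    have "good (piece B) (i - 1, hpart (piece B) (\<phi> x) i)" by (simp add: T.hpart_in)
    note sm = sym_multi_contr[OF Cons.prems(2) this]
    show "\<phi> (mext (piece A) (contr (i - 1, hpart (piece A) x i) f) xs)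
      = mext (piece B) (contr (i - 1, hpart (piece B) (\<phi> x) i) g) (map \<phi> xs)"
    proof (rule Cons.IH[OF _ sm])
      fix w assume "list_all (good (piece A)) w"
      then show "\<phi> (contr (i - 1, hpart (piece A) x i) f w) = contr (i - 1, hpart (piece B) (\<phi> x) i) g (mw w)"
        using Cons.prems(1)[of "(i - 1, hpart (piece A) x i) # w"] by (simp add: phi_hpart S.hpart_in)
    qed
  qed
  also have "\<dots> = mext (piece B) g (\<phi> x # map \<phi> xs)"
    by (rule T.mext_superset[where scl = "scal B", OF T.ideal_0 T.ideal_hpart T.scale_right_distrib T.scale_one
          Cons.prems(2) S.finite_hpart sub, symmetric])
  finally show ?case by simp
qed

lemma semireg_natural:
  "quot_map \<phi> (trace_ideal B J k)
      (semireg A I s k (sym_prod (gshift 1 (quot_dgla A I)) (map (\<lambda>x. x +o I) xs)))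
    = semireg B J t k (sym_prod (gshift 1 (quot_dgla B J)) (map (\<lambda>x. \<phi> x +o J) xs))"
proof -
  have "\<phi> (S.mcs k (map S.lift_of xs)) = T.mcs k (map \<phi> (map S.lift_of xs))"
    by (rule phi_mext[OF phi_chern_simons T.sm_cs])
  moreover have "map \<phi> (map S.lift_of xs) = map t (map (\<lambda>x. \<phi> x +o J) xs)"
    by (simp add: phi_section)
  moreover have "map S.lift_of xs = map s (map (\<lambda>x. x +o I) xs)" by simp
  moreover have "quot_map \<phi> (T.TT k) (x +o S.TT k) = \<phi> x +o T.TT k" for x
    by (rule T.quot_map_coset[OF T.subspace_TT phi_add S.subspace_0[OF S.subspace_TT] phi_trace_ideal])
  ultimately show ?thesis
    by (simp only: S.semireg_sym_prod T.semireg_sym_prod)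
qed

end

theorem theorem2p8:
  shows
  "\<exists>(\<sigma> :: ('k::field_char_0, 'a::{ring, monoid_mult}) curved_data \<Rightarrow> 'a set \<Rightarrow> ('a set \<Rightarrow> 'a) \<Rightarrow> nat \<Rightarrow>
            ('k, 'a set) sym \<Rightarrow> 'a set)
    (\<sigma>' :: ('k, 'b::{ring, monoid_mult}) curved_data \<Rightarrow> 'b set \<Rightarrow> ('b set \<Rightarrow> 'b) \<Rightarrow> nat \<Rightarrow>
            ('k, 'b set) sym \<Rightarrow> 'b set).
     (\<forall>A I s k. curved_dg_algebra A \<and> curved_lie_ideal A I \<and> graded_section A I s \<longrightarrow>
        linfty_morphism_abelian (quot_dgla A I) (dgshift (2 * int k) (trace_complex A I k)) (\<sigma> A I s k) \<and>
        (\<forall>x. linear_component (quot_dgla A I) (\<sigma> A I s k) (x +o I)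
               = tr A I k (scal A (1 / fact k) (curv A ^ k * x)))) \<and>
     (\<forall>B J t k. curved_dg_algebra B \<and> curved_lie_ideal B J \<and> graded_section B J t \<longrightarrow>
        linfty_morphism_abelian (quot_dgla B J) (dgshift (2 * int k) (trace_complex B J k)) (\<sigma>' B J t k) \<and>
        (\<forall>x. linear_component (quot_dgla B J) (\<sigma>' B J t k) (x +o J)
               = tr B J k (scal B (1 / fact k) (curv B ^ k * x)))) \<and>
     (\<forall>A I s B J t \<phi> k.
        curved_dg_algebra A \<and> curved_lie_ideal A I \<and> graded_section A I s \<and>
        curved_dg_algebra B \<and> curved_lie_ideal B J \<and> graded_section B J t \<and>
        curved_morphism A I s B J t \<phi> \<longrightarrow>
        (\<forall>xs. quot_map \<phi> (trace_ideal B J k) (\<sigma> A I s k (sym_prod (gshift 1 (quot_dgla A I)) (map (\<lambda>x. x +o I) xs)))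
               = \<sigma>' B J t k (sym_prod (gshift 1 (quot_dgla B J)) (map (\<lambda>x. \<phi> x +o J) xs))))"
proof (intro exI[of _ semireg] conjI allI impI)
  fix A :: "('k, 'a) curved_data" and I s k x
  assume "curved_dg_algebra A \<and> curved_lie_ideal A I \<and> graded_section A I s"
  then interpret curved_section A I s
    by (simp add: curved_section_def curved_section_axioms_def)
  show "linfty_morphism_abelian (quot_dgla A I) (dgshift (2 * int k) (trace_complex A I k)) (semireg A I s k)"
    by (rule semireg_morphism)
  show "linear_component (quot_dgla A I) (semireg A I s k) (x +o I)
      = tr A I k (scal A (1 / fact k) (curv A ^ k * x))"
    by (rule semireg_linear_component)
next
  fix B :: "('k, 'b) curved_data" and J t k x
  assume "curved_dg_algebra B \<and> curved_lie_ideal B J \<and> graded_section B J t"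
  then interpret curved_section B J t
    by (simp add: curved_section_def curved_section_axioms_def)
  show "linfty_morphism_abelian (quot_dgla B J) (dgshift (2 * int k) (trace_complex B J k)) (semireg B J t k)"
    by (rule semireg_morphism)
  show "linear_component (quot_dgla B J) (semireg B J t k) (x +o J)
      = tr B J k (scal B (1 / fact k) (curv B ^ k * x))"
    by (rule semireg_linear_component)
next
  fix A :: "('k, 'a) curved_data" and I s and B :: "('k, 'b) curved_data" and J t \<phi> k xs
  assume *: "curved_dg_algebra A \<and> curved_lie_ideal A I \<and> graded_section A I s \<and>
        curved_dg_algebra B \<and> curved_lie_ideal B J \<and> graded_section B J t \<and>
        curved_morphism A I s B J t \<phi>"
  interpret section_morphism A I s B J t \<phi>
    using * by (simp add: section_morphism_def section_morphism_axioms_def curved_section_def curved_section_axioms_def)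
  show "quot_map \<phi> (trace_ideal B J k) (semireg A I s k (sym_prod (gshift 1 (quot_dgla A I)) (map (\<lambda>x. x +o I) xs)))
      = semireg B J t k (sym_prod (gshift 1 (quot_dgla B J)) (map (\<lambda>x. \<phi> x +o J) xs))"
    by (rule semireg_natural)
qed

end
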